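(* Let $G$ be an out-tree and let $(k_n)$ be a sequence of positive integers with $k_1=|G^0|$ and $k_n\mid k_{n+1}$ for all $n$. If $G$ is not a total ordering (i.e. $G$ is not a single directed path), then the tree-refinement algebra $\mathcal A(G,\{k_n\})$ is a semi-Dirichlet algebra which is neither a Dirichlet algebra nor isometrically isomorphic to the tensor algebra of a $\mathrm C^*$-correspondence.
   Context: An out-tree is a finite connected directed graph having a root vertex $p$ such that for every other vertex $q$ there is exactly one directed path from $p$ to $q$, and in which no vertex receives more than one edge and the underlying undirected graph is acyclic. For an out-tree $G$ with vertex set $G^0$ identified with $\{1,\dots,k\}$, an edge from $j$ to $i$ is identified with the matrix unit $e_{ij}\in M_k(\mathbb C)$, and the tensor (quiver) algebra $\mathcal T_G^+$ of $G$ is represented faithfully in $M_k(\mathbb C)$ as the span of all $e_{ij}$ such that there is a directed path (possibly of length $0$) from $j$ to $i$ in $G$. Ampliation. For $m\ge1$, the ampliation $G^{(m)}$ of $G$ of multiplicity $m$ is the out-tree with vertices $(i,s)$, $1\le i\le k$, $1\le s\le m$, where $(i,s)$ is identified with the index $(i-1)m+s\in\{1,\dots,km\}$, and with edges: from $(i,s)$ to $(i,s+1)$ for $1\le i\le k$, $1\le s\le m-1$; and from $(j,m)$ to $(i,1)$ whenever there is an edge of $G$ from $j$ to $i$. Tree-refinement algebra. Let $G$ and $(k_n)$ be as in the claim. Put $G_1=G$ and $G_{n+1}=G_n^{(k_{n+1}/k_n)}$. Let $\sigma_n:M_{k_n}(\mathbb C)\to M_{k_{n+1}}(\mathbb C)$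 be the refinement embedding $\sigma_n(e_{ij})=\sum_{s=1}^{m}e_{(i-1)m+s,\,(j-1)m+s}$ with $m=k_{n+1}/k_n$. Then $\sigma_n(\mathcal T_{G_n}^+)\subseteq\mathcal T_{G_{n+1}}^+$ and $\mathcal A(G,\{k_n\})=\varinjlim(\mathcal T_{G_n}^+,\sigma_n)$, the norm-closed union inside $\varinjlim(M_{k_n}(\mathbb C),\sigma_n)$. Dirichlet and semi-Dirichlet. An operator algebra $\mathcal A$, regarded inside its $\mathrm C^*$-envelope $\mathrm C^*_{\mathrm{env}}(\mathcal A)$, is Dirichlet if $\mathcal A+\mathcal A^*$ is dense in $\mathrm C^*_{\mathrm{env}}(\mathcal A)$, and semi-Dirichlet if $\mathcal A^*\mathcal A\subseteq\overline{\mathcal A+\mathcal A^*}$. Tensor algebras. A $\mathrm C^*$-correspondence $(X,D)$ is a (right) Hilbert $D$-module $X$ over a $\mathrm C^*$-algebra $D$ with a $*$-homomorphism $\varphi:D\to L(X)$ into the adjointable operators. A Toeplitz representation $(\pi,t)$ into a $\mathrm C^*$-algebra $B$ consists of a $*$-homomorphism $\pi:D\to B$ and a linear map $t:X\to B$ with $\pi(d)t(\xi)=t(\varphi(d)\xi)$ and $t(\xi)^*t(\eta)=\pi(\langle\xi,\eta\rangle)$. If $(\pi_\infty,t_\infty)$ is the universal Toeplitz representation, the tensor algebra $\mathcal T_X^+$ is the norm-closed algebra generated by $\pi_\infty(D)$ and $t_\infty(X)$.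
   Formalization: The claim of not being isometrically isomorphic to a tensor algebra is proved only for unbounded (k_n): if (k_n) is eventually constant, A(G,{k_n}) is T^+ of an out-tree, itself a tensor algebra. C*-covers and Toeplitz targets range over one type, enough by cardinality. *)

theory Defs
  imports
    "HOL-Algebra.Module"
    "Jordan_Normal_Form.Schur_Decomposition"
    "Graph_Theory.Digraph_Component"
begin

section \<open>C*-algebras\<close>

definition complex_field :: "complex ring" where
  "complex_field = \<lparr>carrier = UNIV, monoid.mult = (*), one = 1, zero = 0, add = (+)\<rparr>"

text \<open>
  C*-algebras are not assumed to be unital: no axiom mentions the field \<^const>\<open>one\<close>, which is
  present only because the record extends the one of HOL-Algebra.
\<close>

record 'a cstar = "(complex, 'a) module" +
  star :: "'a \<Rightarrow> 'a"
  nrm :: "'a \<Rightarrow> real"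

locale cstar_algebra = Module.module complex_field A for A :: "'a cstar" (structure) +
  assumes mult_closed: "\<lbrakk>x \<in> carrier A; y \<in> carrier A\<rbrakk> \<Longrightarrow> x \<otimes> y \<in> carrier A"
    and mult_assoc: "\<lbrakk>x \<in> carrier A; y \<in> carrier A; z \<in> carrier A\<rbrakk> \<Longrightarrow> (x \<otimes> y) \<otimes> z = x \<otimes> (y \<otimes> z)"
    and mult_l_distr:
      "\<lbrakk>x \<in> carrier A; y \<in> carrier A; z \<in> carrier A\<rbrakk> \<Longrightarrow> (x \<oplus> y) \<otimes> z = x \<otimes> z \<oplus> y \<otimes> z"
    and mult_r_distr:
      "\<lbrakk>x \<in> carrier A; y \<in> carrier A; z \<in> carrier A\<rbrakk> \<Longrightarrow> z \<otimes> (x \<oplus> y) = z \<otimes> x \<oplus> z \<otimes> y"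
    and smult_mult_l: "\<lbrakk>x \<in> carrier A; y \<in> carrier A\<rbrakk> \<Longrightarrow> (c \<odot> x) \<otimes> y = c \<odot> (x \<otimes> y)"
    and smult_mult_r: "\<lbrakk>x \<in> carrier A; y \<in> carrier A\<rbrakk> \<Longrightarrow> x \<otimes> (c \<odot> y) = c \<odot> (x \<otimes> y)"
    and star_closed: "x \<in> carrier A \<Longrightarrow> star A x \<in> carrier A"
    and star_star: "x \<in> carrier A \<Longrightarrow> star A (star A x) = x"
    and star_add: "\<lbrakk>x \<in> carrier A; y \<in> carrier A\<rbrakk> \<Longrightarrow> star A (x \<oplus> y) = star A x \<oplus> star A y"
    and star_smult: "x \<in> carrier A \<Longrightarrow> star A (c \<odot> x) = cnj c \<odot> star A x"
    and star_mult: "\<lbrakk>x \<in> carrier A; y \<in> carrier A\<rbrakk> \<Longrightarrow> star A (x \<otimes> y) = star A y \<otimes> star A x"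
    and nrm_nonneg: "x \<in> carrier A \<Longrightarrow> 0 \<le> nrm A x"
    and nrm_eq_0: "x \<in> carrier A \<Longrightarrow> nrm A x = 0 \<longleftrightarrow> x = \<zero>"
    and nrm_smult: "x \<in> carrier A \<Longrightarrow> nrm A (c \<odot> x) = cmod c * nrm A x"
    and nrm_triangle: "\<lbrakk>x \<in> carrier A; y \<in> carrier A\<rbrakk> \<Longrightarrow> nrm A (x \<oplus> y) \<le> nrm A x + nrm A y"
    and nrm_mult: "\<lbrakk>x \<in> carrier A; y \<in> carrier A\<rbrakk> \<Longrightarrow> nrm A (x \<otimes> y) \<le> nrm A x * nrm A y"
    and cstar_identity: "x \<in> carrier A \<Longrightarrow> nrm A (star A x \<otimes> x) = (nrm A x)\<^sup>2"
    and nrm_complete: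
      "\<lbrakk>\<And>n::nat. u n \<in> carrier A; \<forall>e>0. \<exists>N. \<forall>m\<ge>N. \<forall>n\<ge>N. nrm A (u m \<ominus> u n) < e\<rbrakk>
        \<Longrightarrow> \<exists>x\<in>carrier A. (\<lambda>n. nrm A (u n \<ominus> x)) \<longlonglongrightarrow> 0"

definition cstar_closure :: "'a cstar \<Rightarrow> 'a set \<Rightarrow> 'a set" where
  "cstar_closure A S = {x \<in> carrier A. \<forall>e>0. \<exists>y\<in>S. nrm A (x \<ominus>\<^bsub>A\<^esub> y) < e}"

text \<open>Norm-closed (not necessarily self-adjoint) subalgebras of a C*-algebra.\<close>

definition operator_algebra :: "'a cstar \<Rightarrow> 'a set \<Rightarrow> bool" where
  "operator_algebra A S \<longleftrightarrow>
     S \<subseteq> carrier A \<and> \<zero>\<^bsub>A\<^esub> \<in> S \<and>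
     (\<forall>x\<in>S. \<forall>y\<in>S. x \<oplus>\<^bsub>A\<^esub> y \<in> S \<and> x \<otimes>\<^bsub>A\<^esub> y \<in> S) \<and>
     (\<forall>c. \<forall>x\<in>S. c \<odot>\<^bsub>A\<^esub> x \<in> S) \<and>
     cstar_closure A S = S"

definition closed_algebra_generated :: "'a cstar \<Rightarrow> 'a set \<Rightarrow> 'a set" where
  "closed_algebra_generated A Y = \<Inter>{S. operator_algebra A S \<and> Y \<subseteq> S}"

definition cstar_generated :: "'a cstar \<Rightarrow> 'a set \<Rightarrow> 'a set" where
  "cstar_generated A Y = \<Inter>{S. operator_algebra A S \<and> star A ` S \<subseteq> S \<and> Y \<subseteq> S}"

definition alg_hom :: "'a cstar \<Rightarrow> 'a set \<Rightarrow> 'b cstar \<Rightarrow> ('a \<Rightarrow> 'b) \<Rightarrow> bool" where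
  "alg_hom A S B f \<longleftrightarrow>
     f ` S \<subseteq> carrier B \<and>
     (\<forall>x\<in>S. \<forall>y\<in>S. f (x \<oplus>\<^bsub>A\<^esub> y) = f x \<oplus>\<^bsub>B\<^esub> f y \<and> f (x \<otimes>\<^bsub>A\<^esub> y) = f x \<otimes>\<^bsub>B\<^esub> f y) \<and>
     (\<forall>c. \<forall>x\<in>S. f (c \<odot>\<^bsub>A\<^esub> x) = c \<odot>\<^bsub>B\<^esub> f x)"

definition star_hom :: "'a cstar \<Rightarrow> 'b cstar \<Rightarrow> ('a \<Rightarrow> 'b) \<Rightarrow> bool" where
  "star_hom A B f \<longleftrightarrow>
     alg_hom A (carrier A) B f \<and> (\<forall>x\<in>carrier A. f (star A x) = star B (f x))"

definition isometrically_isomorphic ::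
    "'a cstar \<Rightarrow> 'a set \<Rightarrow> 'b cstar \<Rightarrow> 'b set \<Rightarrow> bool" where
  "isometrically_isomorphic A S B R \<longleftrightarrow>
     (\<exists>f. bij_betw f S R \<and> alg_hom A S B f \<and> (\<forall>x\<in>S. nrm B (f x) = nrm A x))"

section \<open>The C*-envelope; Dirichlet and semi-Dirichlet algebras\<close>

text \<open>
  \<open>mat_nrm A n a\<close> is the norm of the \<open>n \<times> n\<close> matrix \<open>a\<close> over \<open>A\<close> as an operator on the right
  Hilbert module \<open>A\<^sup>n\<close> with inner product \<open>\<langle>\<xi>, \<eta>\<rangle> = \<Sum>i. \<xi>\<^sub>i\<^sup>* \<eta>\<^sub>i\<close>. Since this represents \<open>M\<^sub>n(A)\<close>
  faithfully by adjointable operators, it is the unique C*-norm on \<open>M\<^sub>n(A)\<close>.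
\<close>

definition col_inner :: "'a cstar \<Rightarrow> nat \<Rightarrow> (nat \<Rightarrow> 'a) \<Rightarrow> (nat \<Rightarrow> 'a) \<Rightarrow> 'a" where
  "col_inner A n \<xi> \<eta> = (\<Oplus>\<^bsub>A\<^esub>i\<in>{..<n}. star A (\<xi> i) \<otimes>\<^bsub>A\<^esub> \<eta> i)"

definition mat_apply :: "'a cstar \<Rightarrow> nat \<Rightarrow> (nat \<Rightarrow> nat \<Rightarrow> 'a) \<Rightarrow> (nat \<Rightarrow> 'a) \<Rightarrow> nat \<Rightarrow> 'a" where
  "mat_apply A n a \<eta> i = (\<Oplus>\<^bsub>A\<^esub>j\<in>{..<n}. a i j \<otimes>\<^bsub>A\<^esub> \<eta> j)"

definition mat_nrm :: "'a cstar \<Rightarrow> nat \<Rightarrow> (nat \<Rightarrow> nat \<Rightarrow> 'a) \<Rightarrow> real" where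
  "mat_nrm A n a =
     Sup {sqrt (nrm A (col_inner A n (mat_apply A n a \<eta>) (mat_apply A n a \<eta>))) |\<eta>.
            (\<forall>j<n. \<eta> j \<in> carrier A) \<and> nrm A (col_inner A n \<eta> \<eta>) \<le> 1}"

definition completely_isometric ::
    "'a cstar \<Rightarrow> 'a set \<Rightarrow> 'b cstar \<Rightarrow> ('a \<Rightarrow> 'b) \<Rightarrow> bool" where
  "completely_isometric A S B f \<longleftrightarrow>
     (\<forall>n a. (\<forall>i<n. \<forall>j<n. a i j \<in> S) \<longrightarrow> mat_nrm B n (\<lambda>i j. f (a i j)) = mat_nrm A n a)"

definition cstar_cover ::
    "'a cstar \<Rightarrow> 'a set \<Rightarrow> 'b cstar \<Rightarrow> ('a \<Rightarrow> 'b) \<Rightarrow> bool" where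
  "cstar_cover A S C j \<longleftrightarrow>
     cstar_algebra C \<and> alg_hom A S C j \<and> completely_isometric A S C j \<and>
     cstar_generated C (j ` S) = carrier C"

text \<open>
  The universal property of the C*-envelope \<open>(C, j)\<close> of an operator algebra \<open>S \<subseteq> A\<close>. All C*-covers
  are taken with elements in the type \<^typ>\<open>'a\<close> of the elements of \<open>S\<close>. This loses no generality: a
  C*-cover of \<open>S\<close> has at most \<open>|S|\<^bsup>\<aleph>\<^esup>\<close> (\<open>\<aleph>\<close> the countable cardinal) elements, and
  \<open>|S|\<^bsup>\<aleph>\<^esup> = |S|\<close> because \<open>S\<close> is a Banach space.
\<close>

definition cstar_envelope :: "'a cstar \<Rightarrow> 'a set \<Rightarrow> 'a cstar \<Rightarrow> ('a \<Rightarrow> 'a) \<Rightarrow> bool" where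
  "cstar_envelope A S C j \<longleftrightarrow>
     cstar_cover A S C j \<and>
     (\<forall>(B::'a cstar) i. cstar_cover A S B i \<longrightarrow>
        (\<exists>\<pi>. star_hom B C \<pi> \<and> (\<forall>x\<in>S. \<pi> (i x) = j x)))"

definition plus_adjoint :: "'a cstar \<Rightarrow> 'a set \<Rightarrow> 'a set" where
  "plus_adjoint C S = {x \<oplus>\<^bsub>C\<^esub> star C y |x y. x \<in> S \<and> y \<in> S}"

definition dirichlet :: "'a cstar \<Rightarrow> 'a set \<Rightarrow> bool" where
  "dirichlet A S \<longleftrightarrow>
     (\<exists>C j. cstar_envelope A S C j \<and> cstar_closure C (plus_adjoint C (j ` S)) = carrier C)"

definition semi_dirichlet :: "'a cstar \<Rightarrow> 'a set \<Rightarrow> bool" where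
  "semi_dirichlet A S \<longleftrightarrow>
     (\<exists>C j. cstar_envelope A S C j \<and>
        (\<forall>x\<in>j ` S. \<forall>y\<in>j ` S. star C x \<otimes>\<^bsub>C\<^esub> y \<in> cstar_closure C (plus_adjoint C (j ` S))))"

section \<open>C*-correspondences and their tensor algebras\<close>

text \<open>
  As for \<^locale>\<open>Module.module\<close>, the multiplicative fields of the record of a correspondence carry no
  meaning. The inner product is linear in its second argument.
\<close>

record ('d, 'x) corr = "(complex, 'x) module" +
  ract :: "'x \<Rightarrow> 'd \<Rightarrow> 'x"
  inner :: "'x \<Rightarrow> 'x \<Rightarrow> 'd"
  lact :: "'d \<Rightarrow> 'x \<Rightarrow> 'x"

definition corr_nrm :: "'d cstar \<Rightarrow> ('d, 'x) corr \<Rightarrow> 'x \<Rightarrow> real" where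
  "corr_nrm D X \<xi> = sqrt (nrm D (inner X \<xi> \<xi>))"

locale hilbert_module = D: cstar_algebra D + X: Module.module complex_field X
  for D :: "'d cstar" and X :: "('d, 'x) corr" +
  assumes ract_closed: "\<lbrakk>\<xi> \<in> carrier X; d \<in> carrier D\<rbrakk> \<Longrightarrow> ract X \<xi> d \<in> carrier X"
    and ract_add_l:
      "\<lbrakk>\<xi> \<in> carrier X; \<eta> \<in> carrier X; d \<in> carrier D\<rbrakk>
        \<Longrightarrow> ract X (\<xi> \<oplus>\<^bsub>X\<^esub> \<eta>) d = ract X \<xi> d \<oplus>\<^bsub>X\<^esub> ract X \<eta> d"
    and ract_add_r:
      "\<lbrakk>\<xi> \<in> carrier X; d \<in> carrier D; e \<in> carrier D\<rbrakk>
        \<Longrightarrow> ract X \<xi> (d \<oplus>\<^bsub>D\<^esub> e) = ract X \<xi> d \<oplus>\<^bsub>X\<^esub> ract X \<xi> e"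
    and ract_smult_l:
      "\<lbrakk>\<xi> \<in> carrier X; d \<in> carrier D\<rbrakk> \<Longrightarrow> ract X (c \<odot>\<^bsub>X\<^esub> \<xi>) d = c \<odot>\<^bsub>X\<^esub> ract X \<xi> d"
    and ract_smult_r:
      "\<lbrakk>\<xi> \<in> carrier X; d \<in> carrier D\<rbrakk> \<Longrightarrow> ract X \<xi> (c \<odot>\<^bsub>D\<^esub> d) = c \<odot>\<^bsub>X\<^esub> ract X \<xi> d"
    and ract_mult:
      "\<lbrakk>\<xi> \<in> carrier X; d \<in> carrier D; e \<in> carrier D\<rbrakk>
        \<Longrightarrow> ract X \<xi> (d \<otimes>\<^bsub>D\<^esub> e) = ract X (ract X \<xi> d) e"
    and inner_closed: "\<lbrakk>\<xi> \<in> carrier X; \<eta> \<in> carrier X\<rbrakk> \<Longrightarrow> inner X \<xi> \<eta> \<in> carrier D"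
    and inner_add:
      "\<lbrakk>\<xi> \<in> carrier X; \<eta> \<in> carrier X; \<zeta> \<in> carrier X\<rbrakk>
        \<Longrightarrow> inner X \<xi> (\<eta> \<oplus>\<^bsub>X\<^esub> \<zeta>) = inner X \<xi> \<eta> \<oplus>\<^bsub>D\<^esub> inner X \<xi> \<zeta>"
    and inner_smult:
      "\<lbrakk>\<xi> \<in> carrier X; \<eta> \<in> carrier X\<rbrakk> \<Longrightarrow> inner X \<xi> (c \<odot>\<^bsub>X\<^esub> \<eta>) = c \<odot>\<^bsub>D\<^esub> inner X \<xi> \<eta>"
    and inner_ract:
      "\<lbrakk>\<xi> \<in> carrier X; \<eta> \<in> carrier X; d \<in> carrier D\<rbrakk>
        \<Longrightarrow> inner X \<xi> (ract X \<eta> d) = inner X \<xi> \<eta> \<otimes>\<^bsub>D\<^esub> d"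
    and inner_star:
      "\<lbrakk>\<xi> \<in> carrier X; \<eta> \<in> carrier X\<rbrakk> \<Longrightarrow> star D (inner X \<xi> \<eta>) = inner X \<eta> \<xi>"
    and inner_pos: "\<xi> \<in> carrier X \<Longrightarrow> \<exists>d\<in>carrier D. inner X \<xi> \<xi> = star D d \<otimes>\<^bsub>D\<^esub> d"
    and inner_definite: "\<lbrakk>\<xi> \<in> carrier X; inner X \<xi> \<xi> = \<zero>\<^bsub>D\<^esub>\<rbrakk> \<Longrightarrow> \<xi> = \<zero>\<^bsub>X\<^esub>"
    and corr_complete:
      "\<lbrakk>\<And>n::nat. u n \<in> carrier X;
        \<forall>e>0. \<exists>N. \<forall>m\<ge>N. \<forall>n\<ge>N. corr_nrm D X (u m \<ominus>\<^bsub>X\<^esub> u n) < e\<rbrakk>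
        \<Longrightarrow> \<exists>\<xi>\<in>carrier X. (\<lambda>n. corr_nrm D X (u n \<ominus>\<^bsub>X\<^esub> \<xi>)) \<longlonglongrightarrow> 0"

text \<open>
  The assumption \<open>lact_adjoint\<close> says that \<open>\<phi>(d) = lact X d\<close> is adjointable with adjoint \<open>\<phi>(d\<^sup>*)\<close>;
  maps having an adjoint are automatically linear, bounded and \<open>D\<close>-linear.
\<close>

locale cstar_correspondence = hilbert_module D X
  for D :: "'d cstar" and X :: "('d, 'x) corr" +
  assumes lact_closed: "\<lbrakk>d \<in> carrier D; \<xi> \<in> carrier X\<rbrakk> \<Longrightarrow> lact X d \<xi> \<in> carrier X"
    and lact_adjoint:
      "\<lbrakk>d \<in> carrier D; \<xi> \<in> carrier X; \<eta> \<in> carrier X\<rbrakk>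
        \<Longrightarrow> inner X (lact X d \<xi>) \<eta> = inner X \<xi> (lact X (star D d) \<eta>)"
    and lact_add:
      "\<lbrakk>d \<in> carrier D; e \<in> carrier D; \<xi> \<in> carrier X\<rbrakk>
        \<Longrightarrow> lact X (d \<oplus>\<^bsub>D\<^esub> e) \<xi> = lact X d \<xi> \<oplus>\<^bsub>X\<^esub> lact X e \<xi>"
    and lact_smult:
      "\<lbrakk>d \<in> carrier D; \<xi> \<in> carrier X\<rbrakk> \<Longrightarrow> lact X (c \<odot>\<^bsub>D\<^esub> d) \<xi> = c \<odot>\<^bsub>X\<^esub> lact X d \<xi>"
    and lact_mult:
      "\<lbrakk>d \<in> carrier D; e \<in> carrier D; \<xi> \<in> carrier X\<rbrakk>
        \<Longrightarrow> lact X (d \<otimes>\<^bsub>D\<^esub> e) \<xi> = lact X d (lact X e \<xi>)"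

definition toeplitz_rep ::
    "'d cstar \<Rightarrow> ('d, 'x) corr \<Rightarrow> 'b cstar \<Rightarrow> ('d \<Rightarrow> 'b) \<Rightarrow> ('x \<Rightarrow> 'b) \<Rightarrow> bool" where
  "toeplitz_rep D X B \<pi> t \<longleftrightarrow>
     star_hom D B \<pi> \<and>
     t ` carrier X \<subseteq> carrier B \<and>
     (\<forall>\<xi>\<in>carrier X. \<forall>\<eta>\<in>carrier X. t (\<xi> \<oplus>\<^bsub>X\<^esub> \<eta>) = t \<xi> \<oplus>\<^bsub>B\<^esub> t \<eta>) \<and>
     (\<forall>c. \<forall>\<xi>\<in>carrier X. t (c \<odot>\<^bsub>X\<^esub> \<xi>) = c \<odot>\<^bsub>B\<^esub> t \<xi>) \<and>
     (\<forall>d\<in>carrier D. \<forall>\<xi>\<in>carrier X. \<pi> d \<otimes>\<^bsub>B\<^esub> t \<xi> = t (lact X d \<xi>)) \<and>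
     (\<forall>\<xi>\<in>carrier X. \<forall>\<eta>\<in>carrier X. star B (t \<xi>) \<otimes>\<^bsub>B\<^esub> t \<eta> = \<pi> (inner X \<xi> \<eta>))"

text \<open>
  The target algebras have elements in the type \<^typ>\<open>'d + 'x\<close>. Again this loses no generality, since
  the C*-algebra generated by a Toeplitz representation has at most \<open>max |D| |X|\<close> elements, \<open>D\<close> and
  \<open>X\<close> being Banach spaces.
\<close>

definition universal_toeplitz_rep ::
    "'d cstar \<Rightarrow> ('d, 'x) corr \<Rightarrow> ('d + 'x) cstar \<Rightarrow> ('d \<Rightarrow> 'd + 'x) \<Rightarrow> ('x \<Rightarrow> 'd + 'x) \<Rightarrow> bool" where
  "universal_toeplitz_rep D X T \<pi>\<^sub>u t\<^sub>u \<longleftrightarrow>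
     cstar_algebra T \<and> toeplitz_rep D X T \<pi>\<^sub>u t\<^sub>u \<and>
     cstar_generated T (\<pi>\<^sub>u ` carrier D \<union> t\<^sub>u ` carrier X) = carrier T \<and>
     (\<forall>(B::('d + 'x) cstar) \<pi> t. cstar_algebra B \<longrightarrow> toeplitz_rep D X B \<pi> t \<longrightarrow>
        (\<exists>\<rho>. star_hom T B \<rho> \<and>
          (\<forall>d\<in>carrier D. \<rho> (\<pi>\<^sub>u d) = \<pi> d) \<and> (\<forall>\<xi>\<in>carrier X. \<rho> (t\<^sub>u \<xi>) = t \<xi>)))"

definition is_tensor_algebra ::
    "'d cstar \<Rightarrow> ('d, 'x) corr \<Rightarrow> ('d + 'x) cstar \<Rightarrow> ('d + 'x) set \<Rightarrow> bool" where
  "is_tensor_algebra D X T S \<longleftrightarrow>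
     cstar_correspondence D X \<and>
     (\<exists>\<pi> t. universal_toeplitz_rep D X T \<pi> t \<and>
        S = closed_algebra_generated T (\<pi> ` carrier D \<union> t ` carrier X))"

section \<open>Out-trees and their ampliations\<close>

text \<open>
  The underlying undirected multigraph, each edge \<open>e\<close> being traversable forwards as \<open>(e, True)\<close> and
  backwards as \<open>(e, False)\<close>. An undirected cycle uses no edge twice.
\<close>

definition underlying :: "'v pair_pre_digraph \<Rightarrow> ('v, ('v \<times> 'v) \<times> bool) pre_digraph" where
  "underlying G =
     \<lparr>verts = pverts G, arcs = parcs G \<times> UNIV,
      tail = (\<lambda>(e, b). if b then fst e else snd e),
      head = (\<lambda>(e, b). if b then snd e else fst e)\<rparr>"

definition undirected_acyclic :: "'v pair_pre_digraph \<Rightarrow> bool" where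
  "undirected_acyclic G \<longleftrightarrow>
     \<not> (\<exists>p. pre_digraph.cycle (underlying G) p \<and> distinct (map fst p))"

text \<open>
  An edge from \<open>j\<close> to \<open>i\<close> is the pair \<open>(j, i)\<close>. Parallel edges are excluded by the bound on the
  in-degree, so that sets of pairs suffice.
\<close>

definition out_tree :: "'v pair_pre_digraph \<Rightarrow> bool" where
  "out_tree G \<longleftrightarrow>
     pair_fin_digraph G \<and>
     Digraph_Component.connected (with_proj G) \<and>
     (\<exists>p\<in>pverts G. \<forall>q\<in>pverts G. q \<noteq> p \<longrightarrow> (\<exists>!w. pre_digraph.apath (with_proj G) p w q)) \<and>
     (\<forall>v\<in>pverts G. in_degree (with_proj G) v \<le> 1) \<and>
     undirected_acyclic G"

definition single_directed_path :: "'v pair_pre_digraph \<Rightarrow> bool" where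
  "single_directed_path G \<longleftrightarrow>
     (\<exists>u w v. pre_digraph.apath (with_proj G) u w v \<and>
        set (pre_digraph.awalk_verts (with_proj G) u w) = pverts G \<and> set w = parcs G)"

text \<open>
  Vertices and matrix indices are counted from \<open>0\<close>: for a graph on \<open>{..<c}\<close> the vertex \<open>(i, s)\<close> of
  the ampliation is \<open>i * m + s\<close>, where \<open>i < c\<close> and \<open>s < m\<close>.
\<close>

definition ampliation :: "nat pair_pre_digraph \<Rightarrow> nat \<Rightarrow> nat pair_pre_digraph" where
  "ampliation G m =
     \<lparr>pverts = {i * m + s |i s. i \<in> pverts G \<and> s < m},
      parcs = {(i * m + s, i * m + (s + 1)) |i s. i \<in> pverts G \<and> s + 1 < m} \<union>
              {(j * m + (m - 1), i * m) |j i. (j, i) \<in> parcs G}\<rparr>"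

primrec refined_tree :: "nat pair_pre_digraph \<Rightarrow> (nat \<Rightarrow> nat) \<Rightarrow> nat \<Rightarrow> nat pair_pre_digraph" where
  "refined_tree G k 0 = G"
| "refined_tree G k (Suc n) = ampliation (refined_tree G k n) (k (Suc n) div k n)"

section \<open>Tree-refinement algebras\<close>

definition vec_l2norm :: "complex vec \<Rightarrow> real" where
  "vec_l2norm v = sqrt (\<Sum>i<dim_vec v. (cmod (v $ i))\<^sup>2)"

definition mat_opnorm :: "complex mat \<Rightarrow> real" where
  "mat_opnorm a = Sup {vec_l2norm (a *\<^sub>v v) |v. v \<in> carrier_vec (dim_col a) \<and> vec_l2norm v \<le> 1}"

definition mat_cstar :: "nat \<Rightarrow> complex mat cstar" where
  "mat_cstar c =
     \<lparr>carrier = carrier_mat c c, monoid.mult = (*), one = 1\<^sub>m c, zero = 0\<^sub>m c c, add = (+),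
      module.smult = (\<cdot>\<^sub>m), star = mat_adjoint, nrm = mat_opnorm\<rparr>"

text \<open>The span of the matrix units \<open>e\<^sub>i\<^sub>j\<close> such that there is a directed path from \<open>j\<close> to \<open>i\<close>.\<close>

definition quiver_algebra :: "nat pair_pre_digraph \<Rightarrow> nat \<Rightarrow> complex mat set" where
  "quiver_algebra G c =
     range (\<lambda>a. mat c c (\<lambda>(i, j). if j \<rightarrow>\<^sup>*\<^bsub>with_proj G\<^esub> i then a i j else 0))"

text \<open>The linear extension of \<open>e\<^sub>i\<^sub>j \<mapsto> \<Sum>s<m. e\<^sub>p\<^sub>q\<close> with \<open>p = i * m + s\<close> and \<open>q = j * m + s\<close>.\<close>

definition refinement :: "nat \<Rightarrow> complex mat \<Rightarrow> complex mat" where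
  "refinement m a =
     mat (dim_row a * m) (dim_col a * m)
       (\<lambda>(p, q). if p mod m = q mod m then a $$ (p div m, q div m) else 0)"

text \<open>
  \<open>E\<close> with the canonical maps \<open>\<iota> n\<close> is the inductive limit of the C*-algebras \<open>M n\<close> along the
  injective *-homomorphisms \<open>\<sigma> n\<close>. Such a limit exists and is determined up to a unique isomorphism
  compatible with the canonical maps.
\<close>

definition cstar_inductive_limit ::
    "(nat \<Rightarrow> 'a cstar) \<Rightarrow> (nat \<Rightarrow> 'a \<Rightarrow> 'a) \<Rightarrow> 'e cstar \<Rightarrow> (nat \<Rightarrow> 'a \<Rightarrow> 'e) \<Rightarrow> bool" where
  "cstar_inductive_limit M \<sigma> E \<iota> \<longleftrightarrow>
     cstar_algebra E \<and>
     (\<forall>n. star_hom (M n) E (\<iota> n)) \<and>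
     (\<forall>n. \<forall>x\<in>carrier (M n). nrm E (\<iota> n x) = nrm (M n) x) \<and>
     (\<forall>n. \<forall>x\<in>carrier (M n). \<iota> (Suc n) (\<sigma> n x) = \<iota> n x) \<and>
     cstar_closure E (\<Union>n. \<iota> n ` carrier (M n)) = carrier E"

definition is_refinement_limit ::
    "(nat \<Rightarrow> nat) \<Rightarrow> 'e cstar \<Rightarrow> (nat \<Rightarrow> complex mat \<Rightarrow> 'e) \<Rightarrow> bool" where
  "is_refinement_limit k E \<iota> \<longleftrightarrow>
     cstar_inductive_limit (\<lambda>n. mat_cstar (k n)) (\<lambda>n. refinement (k (Suc n) div k n)) E \<iota>"

definition tree_refinement_algebra ::
    "nat pair_pre_digraph \<Rightarrow> (nat \<Rightarrow> nat) \<Rightarrow> 'e cstar \<Rightarrow> (nat \<Rightarrow> complex mat \<Rightarrow> 'e) \<Rightarrow> 'e set" where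
  "tree_refinement_algebra G k E \<iota> =
     cstar_closure E (\<Union>n. \<iota> n ` quiver_algebra (refined_tree G k n) (k n))"

end

theory Submission
  imports Defs
begin

text \<open>
  Positivity of \<open>x\<^sup>* x\<close> in an abstract C*-algebra is obtained without spectral theory, from square
  roots built by iteration in the unitization.

  The limit algebra \<open>E\<close> is itself the C*-envelope. In any completely isometric representation the
  column of the matrix units into the root keeps its norm \<open>sqrt (k n)\<close>, so there are almost isometric
  copies of \<open>\<complex>\<^sup>k\<close> on which every *-polynomial in the represented algebra acts almost like its matrix;
  hence the *-polynomials map contractively back to \<open>E\<close>. Comparability of the vertices above a given
  vertex yields the semi-Dirichlet inclusion at every level. A matrix unit between incomparable
  vertices has distance at least \<open>1\<close> from \<open>A + A\<^sup>*\<close>, even in the envelope.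

  In a tensor algebra let \<open>I L\<close> be the closed span of the homogeneous parts of degree at least \<open>L\<close>.
  Fejer means for the gauge action show that these ideals intersect in zero. The image of a matrix unit
  between distinct vertices lies in \<open>I 1\<close>, because the opposite corner of the algebra vanishes; after
  further refinement it is a sum of products of such units, so it lies in every \<open>I L\<close>.
\<close>

section \<open>Square roots and positivity\<close>

text \<open>The envelope is tested against all C*-covers as abstract algebras, so there is no
  Hilbert space from which vectors could be chosen. Elements y of the unitized cover take over their
  role, with y^* y as the value of the inner product. In a cover the image of an off-diagonal matrix
  unit need not be a partial isometry, and units of norm one may attain their norms at unrelated
  vectors. Only the norm of the whole column forces one vector on which all its entries are nearly
  isometric at once. The column is taken at the root because every vertex is reachable from it, so
  that all its entries belong to the algebra.

  For the tensor algebra the obstacle is that an isometric isomorphism of operator algebras says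
  nothing about adjoints. Diagonal units are rescued because contractive idempotents are
  self-adjoint. The degree zero part of a tensor algebra comes from the self-adjoint algebra D, so a
  degree zero part in one corner would force a nonzero element into the opposite corner.\<close>

lemma complex_field_simps [simp]:
  "carrier complex_field = UNIV" "a \<otimes>\<^bsub>complex_field\<^esub> b = a * b" "\<one>\<^bsub>complex_field\<^esub> = 1"
  "\<zero>\<^bsub>complex_field\<^esub> = 0" "a \<oplus>\<^bsub>complex_field\<^esub> b = a + b"
  by (simp_all add: complex_field_def)

definition ind :: "'a \<Rightarrow> 'a \<Rightarrow> complex" where
  "ind x z = (if z = x then 1 else 0)"

section \<open>Linear calculus and norm estimates in a possibly non-unital C*-algebra\<close>

context cstar_algebra
begin

lemma smultC_closed [simp]: "x \<in> carrier A \<Longrightarrow> c \<odot> x \<in> carrier A"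
  using smult_closed[of c x] by simp

lemma smult_add_l: "x \<in> carrier A \<Longrightarrow> (a + b) \<odot> x = a \<odot> x \<oplus> b \<odot> x"
  using smult_l_distr[of a b x] by simp

lemma smult_add_r: "\<lbrakk>x \<in> carrier A; y \<in> carrier A\<rbrakk> \<Longrightarrow> a \<odot> (x \<oplus> y) = a \<odot> x \<oplus> a \<odot> y"
  using smult_r_distr[of a x y] by simp

lemma smult_smult [simp]: "x \<in> carrier A \<Longrightarrow> a \<odot> (b \<odot> x) = (a * b) \<odot> x"
  using smult_assoc1[of a b x] by simp

lemma smult_1 [simp]: "x \<in> carrier A \<Longrightarrow> 1 \<odot> x = x"
  using smult_one[of x] by simp

lemma smult_0 [simp]: "x \<in> carrier A \<Longrightarrow> 0 \<odot> x = \<zero>"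
  using smult_add_l[of x 0 0] M.add.l_cancel_one[of "0 \<odot> x" "0 \<odot> x"] by simp

lemma smult_zero [simp]: "c \<odot> \<zero> = \<zero>"
  using smult_0[of \<zero>] smult_smult[of \<zero> c 0] by simp

lemma a_inv_smult: "x \<in> carrier A \<Longrightarrow> \<ominus> x = (- 1) \<odot> x"
  using smult_add_l[of x 1 "-1"] M.minus_equality[of "(- 1) \<odot> x" x] by (simp add: M.a_comm)

lemma minus_smult: "\<lbrakk>x \<in> carrier A; y \<in> carrier A\<rbrakk> \<Longrightarrow> x \<ominus> y = x \<oplus> (- 1) \<odot> y"
  by (simp add: a_minus_def a_inv_smult)

lemma mult_zero_l [simp]: "x \<in> carrier A \<Longrightarrow> \<zero> \<otimes> x = \<zero>"
  using smult_mult_l[of \<zero> x 0] mult_closed[of \<zero> x] by simp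

lemma mult_zero_r [simp]: "x \<in> carrier A \<Longrightarrow> x \<otimes> \<zero> = \<zero>"
  using smult_mult_r[of x \<zero> 0] mult_closed[of x \<zero>] by simp

lemma star_zero [simp]: "star A \<zero> = \<zero>"
  using star_smult[of \<zero> 0] star_closed[of \<zero>] by simp

lemmas closed [simp] = mult_closed star_closed

lemma a_diff_closed [simp]: "\<lbrakk>x \<in> carrier A; y \<in> carrier A\<rbrakk> \<Longrightarrow> x \<ominus> y \<in> carrier A"
  by (simp add: minus_smult)

text \<open>Linear identities are proved by comparing coefficient functions, with the products as atoms.\<close>

definition coeffs :: "'a \<Rightarrow> ('a \<Rightarrow> complex) \<Rightarrow> bool" where
  "coeffs s f \<longleftrightarrow> (\<exists>F. finite F \<and> F \<subseteq> carrier A \<and> (\<forall>z. z \<notin> F \<longrightarrow> f z = 0) \<and> s = (\<Oplus>z\<in>F. f z \<odot> z))"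

text \<open>The support may be enlarged to any finite subset of the carrier, since the added terms
  have coefficient zero. Two expansions can therefore be compared over the union of their
  supports.\<close>

lemma coeffsE:
  assumes "coeffs s f"
  obtains F where "finite F" "F \<subseteq> carrier A"
    "\<And>G. \<lbrakk>finite G; F \<subseteq> G; G \<subseteq> carrier A\<rbrakk> \<Longrightarrow> s = (\<Oplus>z\<in>G. f z \<odot> z)" "\<And>z. z \<notin> F \<Longrightarrow> f z = 0"
proof -
  obtain F where F: "finite F" "F \<subseteq> carrier A" "\<forall>z. z \<notin> F \<longrightarrow> f z = 0" "s = (\<Oplus>z\<in>F. f z \<odot> z)"
    using assms unfolding coeffs_def by blast
  show ?thesis
  proof (rule that[OF F(1,2)])
    fix G assume G: "finite G" "F \<subseteq> G" "G \<subseteq> carrier A"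
    have "(\<Oplus>z\<in>F. f z \<odot> z) = (\<Oplus>z\<in>G. f z \<odot> z)"
      by (rule M.add.finprod_mono_neutral_cong_left) (use F G in auto)
    then show "s = (\<Oplus>z\<in>G. f z \<odot> z)" using F by simp
  qed (use F in blast)
qed

lemma coeffs_eq: "\<lbrakk>coeffs s f; coeffs t g; \<And>z. f z = g z\<rbrakk> \<Longrightarrow> s = t"
proof (elim coeffsE)
  fix F G
  assume F: "finite F" "F \<subseteq> carrier A"
    "\<And>H. \<lbrakk>finite H; F \<subseteq> H; H \<subseteq> carrier A\<rbrakk> \<Longrightarrow> s = (\<Oplus>z\<in>H. f z \<odot> z)"
    and G: "finite G" "G \<subseteq> carrier A"
    "\<And>H. \<lbrakk>finite H; G \<subseteq> H; H \<subseteq> carrier A\<rbrakk> \<Longrightarrow> t = (\<Oplus>z\<in>H. g z \<odot> z)"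
    and e: "\<And>z. f z = g z"
  show "s = t"
    using F(3)[of "F \<union> G"] G(3)[of "F \<union> G"] F(1,2) G(1,2) e by simp
qed

lemma coeffs_atom: "x \<in> carrier A \<Longrightarrow> coeffs x (ind x)"
  unfolding coeffs_def ind_def by (rule exI[of _ "{x}"]) auto

lemma coeffs_zero: "coeffs \<zero> (\<lambda>_. 0)"
  unfolding coeffs_def by (rule exI[of _ "{}"]) auto

lemma coeffs_add:
  assumes "coeffs s f" "coeffs t g" shows "coeffs (s \<oplus> t) (\<lambda>z. f z + g z)"
proof -
  from assms(1) obtain F where F: "finite F" "F \<subseteq> carrier A"
    "\<And>H. \<lbrakk>finite H; F \<subseteq> H; H \<subseteq> carrier A\<rbrakk> \<Longrightarrow> s = (\<Oplus>z\<in>H. f z \<odot> z)" "\<And>z. z \<notin> F \<Longrightarrow> f z = 0"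
    by (rule coeffsE) blast
  from assms(2) obtain G where G: "finite G" "G \<subseteq> carrier A"
    "\<And>H. \<lbrakk>finite H; G \<subseteq> H; H \<subseteq> carrier A\<rbrakk> \<Longrightarrow> t = (\<Oplus>z\<in>H. g z \<odot> z)" "\<And>z. z \<notin> G \<Longrightarrow> g z = 0"
    by (rule coeffsE) blast
  have "s \<oplus> t = (\<Oplus>z\<in>F \<union> G. f z \<odot> z \<oplus> g z \<odot> z)"
    using F(1,2) G(1,2) F(3)[of "F \<union> G"] G(3)[of "F \<union> G"] by (subst M.finsum_addf) auto
  also have "\<dots> = (\<Oplus>z\<in>F \<union> G. (f z + g z) \<odot> z)"
    using F G by (intro M.finsum_cong') (auto simp: smult_add_l)
  finally show ?thesis
    unfolding coeffs_def using F G by (intro exI[of _ "F \<union> G"]) auto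
qed

lemma finsum_smultC:
  assumes "finite F" "h \<in> F \<rightarrow> carrier A"
  shows "c \<odot> (\<Oplus>z\<in>F. h z) = (\<Oplus>z\<in>F. c \<odot> h z)"
  using assms by (induction F rule: finite_induct) (auto simp: smult_add_r Pi_iff)

lemma coeffs_smult:
  assumes "coeffs s f" shows "coeffs (c \<odot> s) (\<lambda>z. c * f z)"
proof -
  obtain F where F: "finite F" "F \<subseteq> carrier A" "s = (\<Oplus>z\<in>F. f z \<odot> z)" "\<And>z. z \<notin> F \<Longrightarrow> f z = 0"
    using assms unfolding coeffs_def by blast
  have "c \<odot> s = (\<Oplus>z\<in>F. c \<odot> (f z \<odot> z))"
    unfolding F(3) by (rule finsum_smultC) (use F in auto)
  also have "\<dots> = (\<Oplus>z\<in>F. (c * f z) \<odot> z)"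
    using F by (intro M.finsum_cong') auto
  finally show ?thesis
    unfolding coeffs_def using F by (intro exI[of _ F]) auto
qed

lemma coeffs_carrier: "coeffs s f \<Longrightarrow> s \<in> carrier A"
  unfolding coeffs_def by (auto intro!: M.finsum_closed)

lemma coeffs_uminus: "coeffs s f \<Longrightarrow> coeffs (\<ominus> s) (\<lambda>z. - f z)"
  using coeffs_smult[of s f "-1"] by (simp add: a_inv_smult coeffs_carrier)

lemma coeffs_minus: "\<lbrakk>coeffs s f; coeffs t g\<rbrakk> \<Longrightarrow> coeffs (s \<ominus> t) (\<lambda>z. f z - g z)"
  unfolding a_minus_def using coeffs_add[OF _ coeffs_uminus] by fastforce

text \<open>The atom rule matches every term and stands last, so that sums, differences and
  multiples are taken apart before anything is declared an atom. Products are never taken apart;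
  \<open>expand\<close> has to bring them into a common form beforehand.\<close>

lemmas coeffs_rules = coeffs_zero coeffs_add coeffs_minus coeffs_uminus coeffs_smult coeffs_atom

lemma mult_uminus_l: "\<lbrakk>x \<in> carrier A; y \<in> carrier A\<rbrakk> \<Longrightarrow> (\<ominus> x) \<otimes> y = \<ominus> (x \<otimes> y)"
  by (simp add: a_inv_smult smult_mult_l)

lemma mult_uminus_r: "\<lbrakk>x \<in> carrier A; y \<in> carrier A\<rbrakk> \<Longrightarrow> x \<otimes> (\<ominus> y) = \<ominus> (x \<otimes> y)"
  by (simp add: a_inv_smult smult_mult_r)

lemma star_uminus: "x \<in> carrier A \<Longrightarrow> star A (\<ominus> x) = \<ominus> (star A x)"
  by (simp add: a_inv_smult star_smult)

lemma star_minus: "\<lbrakk>x \<in> carrier A; y \<in> carrier A\<rbrakk> \<Longrightarrow> star A (x \<ominus> y) = star A x \<ominus> star A y"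
  by (simp add: a_minus_def star_add star_uminus)

lemma mult_minus_l:
  "\<lbrakk>x \<in> carrier A; y \<in> carrier A; z \<in> carrier A\<rbrakk> \<Longrightarrow> (x \<ominus> y) \<otimes> z = x \<otimes> z \<ominus> y \<otimes> z"
  by (simp add: a_minus_def mult_l_distr mult_uminus_l)

lemma mult_minus_r:
  "\<lbrakk>x \<in> carrier A; y \<in> carrier A; z \<in> carrier A\<rbrakk> \<Longrightarrow> z \<otimes> (x \<ominus> y) = z \<otimes> x \<ominus> z \<otimes> y"
  by (simp add: a_minus_def mult_r_distr mult_uminus_r)

lemmas expand = mult_l_distr mult_r_distr mult_minus_l mult_minus_r mult_uminus_l mult_uminus_r
  smult_mult_l smult_mult_r mult_assoc star_add star_smult star_mult star_minus star_uminus star_star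

lemma minus_self [simp]: "x \<in> carrier A \<Longrightarrow> x \<ominus> x = \<zero>"
  by (rule coeffs_eq, (rule coeffs_rules | (simp; fail))+)

lemma minus_add_cancel: "\<lbrakk>x \<in> carrier A; y \<in> carrier A\<rbrakk> \<Longrightarrow> x \<ominus> y \<oplus> y = x"
  by (rule coeffs_eq, (rule coeffs_rules | (simp; fail))+)

lemma minus_eq_zero_iff: "\<lbrakk>x \<in> carrier A; y \<in> carrier A\<rbrakk> \<Longrightarrow> x \<ominus> y = \<zero> \<longleftrightarrow> x = y"
  using minus_add_cancel[of x y] by auto

lemma nrm_zero [simp]: "nrm A \<zero> = 0"
  using nrm_eq_0[of \<zero>] by simp

lemma nrm_uminus: "x \<in> carrier A \<Longrightarrow> nrm A (\<ominus> x) = nrm A x"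
  by (simp add: a_inv_smult nrm_smult)

lemma minus_swap: "\<lbrakk>x \<in> carrier A; y \<in> carrier A\<rbrakk> \<Longrightarrow> x \<ominus> y = \<ominus> (y \<ominus> x)"
  by (rule coeffs_eq, (rule coeffs_rules | (simp add: algebra_simps; fail))+)

lemma nrm_minus_commute: "\<lbrakk>x \<in> carrier A; y \<in> carrier A\<rbrakk> \<Longrightarrow> nrm A (x \<ominus> y) = nrm A (y \<ominus> x)"
  by (subst minus_swap) (simp_all add: nrm_uminus)

lemma minus_trans: "\<lbrakk>x \<in> carrier A; y \<in> carrier A; z \<in> carrier A\<rbrakk> \<Longrightarrow> x \<ominus> z = (x \<ominus> y) \<oplus> (y \<ominus> z)"
  by (rule coeffs_eq, (rule coeffs_rules | (simp add: algebra_simps; fail))+)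

lemma nrm_dist_triangle:
  "\<lbrakk>x \<in> carrier A; y \<in> carrier A; z \<in> carrier A\<rbrakk> \<Longrightarrow> nrm A (x \<ominus> z) \<le> nrm A (x \<ominus> y) + nrm A (y \<ominus> z)"
  by (subst minus_trans[of x y z]) (simp_all add: nrm_triangle)

lemma nrm_dist_ge: "\<lbrakk>x \<in> carrier A; y \<in> carrier A\<rbrakk> \<Longrightarrow> nrm A x - nrm A y \<le> nrm A (x \<ominus> y)"
proof -
  assume a: "x \<in> carrier A" "y \<in> carrier A"
  have "x = (x \<ominus> y) \<oplus> y"
    by (rule coeffs_eq, (rule coeffs_rules | (simp add: a algebra_simps; fail))+)
  then show ?thesis using nrm_triangle[of "x \<ominus> y" y] a by simp
qed

text \<open>The C*-identity and submultiplicativity bound the square of \<open>nrm A y\<close> by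
  \<open>nrm A (star A y) * nrm A y\<close>. Cancelling gives one inequality, and applying it to the
  adjoint gives the other.\<close>

lemma nrm_star [simp]: "x \<in> carrier A \<Longrightarrow> nrm A (star A x) = nrm A x"
proof -
  have *: "nrm A y \<le> nrm A (star A y)" if "y \<in> carrier A" for y
  proof (cases "nrm A y = 0")
    case False
    have "(nrm A y)\<^sup>2 \<le> nrm A (star A y) * nrm A y"
      using cstar_identity[OF that] nrm_mult[of "star A y" y] that by simp
    then show ?thesis using False nrm_nonneg[OF that] by (simp add: power2_eq_square)
  qed (use that nrm_nonneg in simp)
  assume "x \<in> carrier A"
  then show ?thesis using *[of x] *[of "star A x"] by (simp add: star_star)
qed

lemma finsum_nrm_le:
  assumes "finite F" "h \<in> F \<rightarrow> carrier A"
  shows "nrm A (\<Oplus>z\<in>F. h z) \<le> (\<Sum>z\<in>F. nrm A (h z))"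
  using assms
proof (induction F rule: finite_induct)
  case (insert x F)
  have "nrm A (h x \<oplus> (\<Oplus>z\<in>F. h z)) \<le> nrm A (h x) + nrm A (\<Oplus>z\<in>F. h z)"
    using insert by (intro nrm_triangle M.finsum_closed) auto
  then show ?case using insert by (auto simp: Pi_iff)
qed simp

lemma finsum_mult_r:
  assumes "finite F" "h \<in> F \<rightarrow> carrier A" "x \<in> carrier A"
  shows "(\<Oplus>z\<in>F. h z) \<otimes> x = (\<Oplus>z\<in>F. h z \<otimes> x)"
  using assms by (induction F rule: finite_induct) (auto simp: mult_l_distr Pi_iff)

lemma finsum_mult_l:
  assumes "finite F" "h \<in> F \<rightarrow> carrier A" "x \<in> carrier A"
  shows "x \<otimes> (\<Oplus>z\<in>F. h z) = (\<Oplus>z\<in>F. x \<otimes> h z)"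
  using assms by (induction F rule: finite_induct) (auto simp: mult_r_distr Pi_iff)

section \<open>Convergent sequences and continuity of the operations\<close>

definition conv :: "(nat \<Rightarrow> 'a) \<Rightarrow> 'a \<Rightarrow> bool" where
  "conv u x \<longleftrightarrow> (\<forall>n. u n \<in> carrier A) \<and> x \<in> carrier A \<and> (\<lambda>n. nrm A (u n \<ominus> x)) \<longlonglongrightarrow> 0"

lemma conv_bound:
  assumes "\<And>n. u n \<in> carrier A" "x \<in> carrier A" "\<And>n. nrm A (u n \<ominus> x) \<le> e n" "e \<longlonglongrightarrow> 0"
  shows "conv u x"
proof -
  have "(\<lambda>n. nrm A (u n \<ominus> x)) \<longlonglongrightarrow> 0"
    by (rule tendsto_sandwich[of "\<lambda>_. 0" _ sequentially e]) (use assms in \<open>simp_all add: nrm_nonneg\<close>)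
  then show ?thesis using assms by (simp add: conv_def)
qed

lemma conv_const: "x \<in> carrier A \<Longrightarrow> conv (\<lambda>_. x) x"
  by (simp add: conv_def)

lemma conv_add: "\<lbrakk>conv u x; conv v y\<rbrakk> \<Longrightarrow> conv (\<lambda>n. u n \<oplus> v n) (x \<oplus> y)"
proof (rule conv_bound[where e = "\<lambda>n. nrm A (u n \<ominus> x) + nrm A (v n \<ominus> y)"])
  fix n assume a: "conv u x" "conv v y"
  then have c: "u n \<in> carrier A" "v n \<in> carrier A" "x \<in> carrier A" "y \<in> carrier A"
    by (auto simp: conv_def)
  have "u n \<oplus> v n \<ominus> (x \<oplus> y) = (u n \<ominus> x) \<oplus> (v n \<ominus> y)"
    by (rule coeffs_eq, (rule coeffs_rules | (simp add: c algebra_simps; fail))+)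
  then show "nrm A (u n \<oplus> v n \<ominus> (x \<oplus> y)) \<le> nrm A (u n \<ominus> x) + nrm A (v n \<ominus> y)"
    using c by (simp add: nrm_triangle)
qed (auto simp: conv_def intro: tendsto_add_zero)

lemma conv_smult: "conv u x \<Longrightarrow> conv (\<lambda>n. c \<odot> u n) (c \<odot> x)"
proof (rule conv_bound[where e = "\<lambda>n. cmod c * nrm A (u n \<ominus> x)"])
  fix n assume a: "conv u x"
  then have c: "u n \<in> carrier A" "x \<in> carrier A" by (auto simp: conv_def)
  have "c \<odot> u n \<ominus> c \<odot> x = c \<odot> (u n \<ominus> x)"
    by (rule coeffs_eq, (rule coeffs_rules | (simp add: c algebra_simps; fail))+)
  then show "nrm A (c \<odot> u n \<ominus> c \<odot> x) \<le> cmod c * nrm A (u n \<ominus> x)"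
    using c by (simp add: nrm_smult)
qed (auto simp: conv_def intro: tendsto_mult_right_zero)

lemma conv_star: "conv u x \<Longrightarrow> conv (\<lambda>n. star A (u n)) (star A x)"
  by (rule conv_bound[where e = "\<lambda>n. nrm A (u n \<ominus> x)"]) (auto simp: conv_def star_minus[symmetric])

lemma conv_mult: "\<lbrakk>conv u x; conv v y\<rbrakk> \<Longrightarrow> conv (\<lambda>n. u n \<otimes> v n) (x \<otimes> y)"
proof (rule conv_bound[where e = "\<lambda>n. nrm A (u n \<ominus> x) * (nrm A (v n \<ominus> y) + nrm A y) + nrm A x * nrm A (v n \<ominus> y)"])
  fix n assume a: "conv u x" "conv v y"
  then have c: "u n \<in> carrier A" "v n \<in> carrier A" "x \<in> carrier A" "y \<in> carrier A"
    by (auto simp: conv_def)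
  have e: "u n \<otimes> v n \<ominus> x \<otimes> y = (u n \<ominus> x) \<otimes> v n \<oplus> x \<otimes> (v n \<ominus> y)"
    apply (simp add: c expand)
    by (rule coeffs_eq, (rule coeffs_rules | (simp add: c algebra_simps; fail))+)
  \<comment> \<open>The norm of \<open>v n\<close> is estimated through its distance to
    \<open>y\<close>, which spares a separate boundedness argument for convergent sequences.\<close>
  have v: "nrm A (v n) \<le> nrm A (v n \<ominus> y) + nrm A y"
    using nrm_dist_ge[of "v n" y] c by simp
  have "nrm A (u n \<otimes> v n \<ominus> x \<otimes> y) \<le> nrm A ((u n \<ominus> x) \<otimes> v n) + nrm A (x \<otimes> (v n \<ominus> y))"
    unfolding e using c by (intro nrm_triangle) auto
  also have "\<dots> \<le> nrm A (u n \<ominus> x) * nrm A (v n) + nrm A x * nrm A (v n \<ominus> y)"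
    using c by (intro add_mono nrm_mult) auto
  also have "\<dots> \<le> nrm A (u n \<ominus> x) * (nrm A (v n \<ominus> y) + nrm A y) + nrm A x * nrm A (v n \<ominus> y)"
    using c v by (intro add_mono mult_left_mono order_refl) (auto simp: nrm_nonneg)
  finally show "nrm A (u n \<otimes> v n \<ominus> x \<otimes> y)
      \<le> nrm A (u n \<ominus> x) * (nrm A (v n \<ominus> y) + nrm A y) + nrm A x * nrm A (v n \<ominus> y)" .
next
  assume a: "conv u x" "conv v y"
  then have "(\<lambda>n. nrm A (u n \<ominus> x) * (nrm A (v n \<ominus> y) + nrm A y) + nrm A x * nrm A (v n \<ominus> y))
      \<longlonglongrightarrow> 0 * (0 + nrm A y) + nrm A x * 0"
    unfolding conv_def by (intro tendsto_intros) auto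
  then show "(\<lambda>n. nrm A (u n \<ominus> x) * (nrm A (v n \<ominus> y) + nrm A y) + nrm A x * nrm A (v n \<ominus> y))
      \<longlonglongrightarrow> 0" by simp
qed (auto simp: conv_def)

lemma conv_nrm:
  assumes a: "conv u x" shows "(\<lambda>n. nrm A (u n)) \<longlonglongrightarrow> nrm A x"
proof (rule LIM_zero_cancel)
  have d: "\<bar>nrm A (u n) - nrm A x\<bar> \<le> nrm A (u n \<ominus> x)" for n
    using a nrm_dist_ge[of "u n" x] nrm_dist_ge[of x "u n"] nrm_minus_commute[of x "u n"]
    by (auto simp: conv_def abs_le_iff)
  have z: "(\<lambda>n. nrm A (u n \<ominus> x)) \<longlonglongrightarrow> 0" using a by (simp add: conv_def)
  show "(\<lambda>n. nrm A (u n) - nrm A x) \<longlonglongrightarrow> 0"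
    by (rule tendsto_0_le[OF z, of _ 1]) (use d order_trans[OF d abs_ge_self] in simp)
qed

lemma conv_unique:
  assumes "conv u x" "conv u y" shows "x = y"
proof -
  have "conv (\<lambda>n. u n \<oplus> (- 1) \<odot> u n) (x \<oplus> (- 1) \<odot> y)"
    using assms by (intro conv_add conv_smult)
  then have "(\<lambda>n. nrm A (u n \<oplus> (- 1) \<odot> u n)) \<longlonglongrightarrow> nrm A (x \<oplus> (- 1) \<odot> y)"
    by (rule conv_nrm)
  moreover have "(\<lambda>n. nrm A (u n \<oplus> (- 1) \<odot> u n)) = (\<lambda>n. 0)"
    using assms by (auto simp: conv_def minus_smult[symmetric])
  ultimately have "nrm A (x \<oplus> (- 1) \<odot> y) = 0"
    using LIMSEQ_unique[OF _ tendsto_const] by fastforce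
  then show ?thesis
    using assms by (simp add: conv_def minus_smult[symmetric] nrm_eq_0 minus_eq_zero_iff)
qed

end

section \<open>Unitization by left multiplication operators\<close>

locale unital_cstar_algebra = cstar_algebra +
  assumes one_closed [simp]: "\<one> \<in> carrier A"
    and l_one [simp]: "x \<in> carrier A \<Longrightarrow> \<one> \<otimes> x = x"
    and r_one [simp]: "x \<in> carrier A \<Longrightarrow> x \<otimes> \<one> = x"

definition lmult :: "'a cstar \<Rightarrow> 'a \<times> complex \<Rightarrow> 'a \<Rightarrow> 'a" where
  "lmult A T y = fst T \<otimes>\<^bsub>A\<^esub> y \<oplus>\<^bsub>A\<^esub> snd T \<odot>\<^bsub>A\<^esub> y"

definition lmult_nrm :: "'a cstar \<Rightarrow> 'a \<times> complex \<Rightarrow> real" where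
  "lmult_nrm A T = Sup ((\<lambda>y. nrm A (lmult A T y)) ` {y \<in> carrier A. nrm A y \<le> 1})"

text \<open>
  If \<open>A\<close> already has a unit then left multiplication by \<open>(- 1, 1)\<close> is zero; the maximum with
  \<open>cmod (snd T)\<close> makes the norm definite in this case too.
\<close>

definition unitization :: "'a cstar \<Rightarrow> ('a \<times> complex) cstar" where
  "unitization A =
     \<lparr>carrier = carrier A \<times> UNIV,
      monoid.mult = (\<lambda>S T. (fst S \<otimes>\<^bsub>A\<^esub> fst T \<oplus>\<^bsub>A\<^esub> (snd T \<odot>\<^bsub>A\<^esub> fst S \<oplus>\<^bsub>A\<^esub> snd S \<odot>\<^bsub>A\<^esub> fst T), snd S * snd T)),
      one = (\<zero>\<^bsub>A\<^esub>, 1), zero = (\<zero>\<^bsub>A\<^esub>, 0),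
      add = (\<lambda>S T. (fst S \<oplus>\<^bsub>A\<^esub> fst T, snd S + snd T)),
      module.smult = (\<lambda>c T. (c \<odot>\<^bsub>A\<^esub> fst T, c * snd T)),
      star = (\<lambda>T. (star A (fst T), cnj (snd T))),
      nrm = (\<lambda>T. max (cmod (snd T)) (lmult_nrm A T))\<rparr>"

lemma unitization_simps [simp]:
  "carrier (unitization A) = carrier A \<times> UNIV"
  "S \<otimes>\<^bsub>unitization A\<^esub> T = (fst S \<otimes>\<^bsub>A\<^esub> fst T \<oplus>\<^bsub>A\<^esub> (snd T \<odot>\<^bsub>A\<^esub> fst S \<oplus>\<^bsub>A\<^esub> snd S \<odot>\<^bsub>A\<^esub> fst T), snd S * snd T)"
  "\<one>\<^bsub>unitization A\<^esub> = (\<zero>\<^bsub>A\<^esub>, 1)" "\<zero>\<^bsub>unitization A\<^esub> = (\<zero>\<^bsub>A\<^esub>, 0)"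
  "S \<oplus>\<^bsub>unitization A\<^esub> T = (fst S \<oplus>\<^bsub>A\<^esub> fst T, snd S + snd T)"
  "c \<odot>\<^bsub>unitization A\<^esub> T = (c \<odot>\<^bsub>A\<^esub> fst T, c * snd T)"
  "star (unitization A) T = (star A (fst T), cnj (snd T))"
  "nrm (unitization A) T = max (cmod (snd T)) (lmult_nrm A T)"
  by (simp_all add: unitization_def)

context cstar_algebra
begin

lemma lmult_closed [simp]: "\<lbrakk>fst T \<in> carrier A; y \<in> carrier A\<rbrakk> \<Longrightarrow> lmult A T y \<in> carrier A"
  by (simp add: lmult_def)

lemma lmult_nrm_bdd:
  assumes "fst T \<in> carrier A"
  shows "bdd_above ((\<lambda>y. nrm A (lmult A T y)) ` {y \<in> carrier A. nrm A y \<le> 1})"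
proof (rule bdd_aboveI2)
  fix y assume y: "y \<in> {y \<in> carrier A. nrm A y \<le> 1}"
  have "nrm A (lmult A T y) \<le> nrm A (fst T \<otimes> y) + nrm A (snd T \<odot> y)"
    unfolding lmult_def using assms y by (intro nrm_triangle) auto
  also have "\<dots> \<le> nrm A (fst T) * nrm A y + cmod (snd T) * nrm A y"
    using assms y by (intro add_mono nrm_mult) (auto simp: nrm_smult)
  also have "\<dots> \<le> nrm A (fst T) * 1 + cmod (snd T) * 1"
    using assms y by (intro add_mono mult_left_mono) (auto simp: nrm_nonneg)
  finally show "nrm A (lmult A T y) \<le> nrm A (fst T) + cmod (snd T)" by simp
qed

lemma lmult_nrm_least:
  "(\<And>y. \<lbrakk>y \<in> carrier A; nrm A y \<le> 1\<rbrakk> \<Longrightarrow> nrm A (lmult A T y) \<le> c) \<Longrightarrow> lmult_nrm A T \<le> c"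
  unfolding lmult_nrm_def by (rule cSUP_least) (auto intro: exI[of _ \<zero>])

lemma lmult_nrm_nonneg: "fst T \<in> carrier A \<Longrightarrow> 0 \<le> lmult_nrm A T"
  unfolding lmult_nrm_def
  by (rule cSUP_upper2[OF lmult_nrm_bdd, of _ \<zero>]) (auto simp: nrm_nonneg)

lemma lmult_smult:
  "\<lbrakk>fst T \<in> carrier A; y \<in> carrier A\<rbrakk> \<Longrightarrow> lmult A T (c \<odot> y) = c \<odot> lmult A T y"
  by (simp add: lmult_def smult_mult_r smult_add_r mult.commute)

lemma lmult_le:
  assumes "fst T \<in> carrier A" "y \<in> carrier A"
  shows "nrm A (lmult A T y) \<le> lmult_nrm A T * nrm A y"
proof (cases "y = \<zero>")
  case True then show ?thesis using assms by (simp add: lmult_def)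
next
  case False
  then have n: "nrm A y > 0" using assms nrm_eq_0[of y] nrm_nonneg[of y] by linarith
  define y' where "y' = complex_of_real (1 / nrm A y) \<odot> y"
  have y': "y' \<in> carrier A" "nrm A y' = 1" using n assms by (auto simp: y'_def nrm_smult norm_divide)
  have "y = complex_of_real (nrm A y) \<odot> y'" using n assms by (simp add: y'_def)
  then have "nrm A (lmult A T y) = nrm A y * nrm A (lmult A T y')"
    using assms n y' by (metis lmult_smult lmult_closed nrm_smult norm_of_real abs_of_pos)
  moreover have "nrm A (lmult A T y') \<le> lmult_nrm A T"
    unfolding lmult_nrm_def using y' by (intro cSUP_upper lmult_nrm_bdd assms) auto
  ultimately show ?thesis using n by (simp add: mult.commute)
qed

text \<open>The lower bound tests left multiplication by x on the adjoint of x, where the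
  C*-identity makes it attain the norm of x. This makes the embedding into the unitization
  isometric.\<close>

lemma lmult_nrm_embed:
  assumes x: "x \<in> carrier A" shows "lmult_nrm A (x, 0) = nrm A x"
proof (rule antisym)
  show "lmult_nrm A (x, 0) \<le> nrm A x"
  proof (rule lmult_nrm_least)
    fix y assume y: "y \<in> carrier A" "nrm A y \<le> 1"
    have "nrm A (x \<otimes> y) \<le> nrm A x * nrm A y" using x y by (rule_tac nrm_mult)
    also have "\<dots> \<le> nrm A x * 1" using x y by (intro mult_left_mono) (auto simp: nrm_nonneg)
    finally show "nrm A (lmult A (x, 0) y) \<le> nrm A x" using x y by (simp add: lmult_def)
  qed
  have "(nrm A x)\<^sup>2 \<le> lmult_nrm A (x, 0) * nrm A x"
    using lmult_le[of "(x, 0)" "star A x"] cstar_identity[of "star A x"] x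
    by (simp add: lmult_def star_star)
  then show "nrm A x \<le> lmult_nrm A (x, 0)"
    using lmult_nrm_nonneg[of "(x, 0)"] nrm_nonneg[OF x] x
    by (cases "nrm A x = 0") (auto simp: power2_eq_square)
qed

lemma lmult_mult:
  "\<lbrakk>fst S \<in> carrier A; fst T \<in> carrier A; y \<in> carrier A\<rbrakk>
    \<Longrightarrow> lmult A (S \<otimes>\<^bsub>unitization A\<^esub> T) y = lmult A S (lmult A T y)"
  apply (simp add: lmult_def expand)
  by (rule coeffs_eq, (rule coeffs_rules | (simp add: algebra_simps; fail))+)

lemma lmult_nrm_mult:
  assumes "fst S \<in> carrier A" "fst T \<in> carrier A"
  shows "lmult_nrm A (S \<otimes>\<^bsub>unitization A\<^esub> T) \<le> lmult_nrm A S * lmult_nrm A T"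
proof (rule lmult_nrm_least)
  fix y assume y: "y \<in> carrier A" "nrm A y \<le> 1"
  have "nrm A (lmult A S (lmult A T y)) \<le> lmult_nrm A S * nrm A (lmult A T y)"
    using assms y by (intro lmult_le) auto
  also have "\<dots> \<le> lmult_nrm A S * (lmult_nrm A T * nrm A y)"
    using assms y by (intro mult_left_mono lmult_le lmult_nrm_nonneg)
  also have "\<dots> \<le> lmult_nrm A S * (lmult_nrm A T * 1)"
    using assms y by (intro mult_left_mono lmult_nrm_nonneg)
  finally show "nrm A (lmult A (S \<otimes>\<^bsub>unitization A\<^esub> T) y) \<le> lmult_nrm A S * lmult_nrm A T"
    using assms y by (simp only: lmult_mult mult_1_right)
qed

text \<open>For y in the unit ball the square of the norm of T y is the norm of y^* T^* T y, hence
  at most the operator norm of T^* T. This is the nontrivial half of the C*-identity in the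
  unitization.\<close>

lemma lmult_nrm_star_mult:
  assumes T: "fst T \<in> carrier A"
  shows "(lmult_nrm A T)\<^sup>2 \<le> lmult_nrm A (star (unitization A) T \<otimes>\<^bsub>unitization A\<^esub> T)" (is "_ \<le> ?r")
proof -
  let ?S = "star (unitization A) T \<otimes>\<^bsub>unitization A\<^esub> T"
  have S: "fst ?S \<in> carrier A" using T by simp
  have "lmult_nrm A T \<le> sqrt ?r"
  proof (rule lmult_nrm_least, rule real_le_rsqrt)
    fix y assume y: "y \<in> carrier A" "nrm A y \<le> 1"
    have "star A (lmult A T y) \<otimes> lmult A T y = star A y \<otimes> lmult A (star (unitization A) T) (lmult A T y)"
      apply (simp add: lmult_def expand T y)
      by (rule coeffs_eq, (rule coeffs_rules | (simp add: T y algebra_simps; fail))+)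
    also have "lmult A (star (unitization A) T) (lmult A T y) = lmult A ?S y"
      using T y by (intro lmult_mult[symmetric]) auto
    finally have "(nrm A (lmult A T y))\<^sup>2 = nrm A (star A y \<otimes> lmult A ?S y)"
      using T y by (simp add: cstar_identity[symmetric] del: unitization_simps)
    also have "\<dots> \<le> nrm A (star A y) * nrm A (lmult A ?S y)"
      using T y S by (intro nrm_mult) (auto simp del: unitization_simps)
    also have "\<dots> \<le> 1 * (?r * nrm A y)"
      using T y S by (intro mult_mono lmult_le) (auto simp: nrm_nonneg simp del: unitization_simps)
    also have "\<dots> \<le> 1 * (?r * 1)"
      using y S by (intro mult_left_mono lmult_nrm_nonneg) auto
    finally show "(nrm A (lmult A T y))\<^sup>2 \<le> ?r" by simp
  qed
  then show ?thesis
    using lmult_nrm_nonneg[OF T] lmult_nrm_nonneg[OF S] by (metis power_mono real_sqrt_pow2)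
qed

lemma lmult_nrm_star:
  assumes T: "fst T \<in> carrier A" shows "lmult_nrm A (star (unitization A) T) = lmult_nrm A T"
proof -
  have *: "lmult_nrm A S \<le> lmult_nrm A (star (unitization A) S)" if S: "fst S \<in> carrier A" for S
  proof (cases "lmult_nrm A S = 0")
    case False
    have "(lmult_nrm A S)\<^sup>2 \<le> lmult_nrm A (star (unitization A) S) * lmult_nrm A S"
      using lmult_nrm_star_mult[OF S] lmult_nrm_mult[of "star (unitization A) S" S] S by simp
    then show ?thesis using False lmult_nrm_nonneg[OF S] by (simp add: power2_eq_square)
  qed (use S lmult_nrm_nonneg in simp)
  show ?thesis using *[OF T] *[of "star (unitization A) T"] T by (simp add: star_star)
qed

lemma abelian_group_unitization: "abelian_group (unitization A)"
proof (rule abelian_groupI)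
  show "\<exists>y\<in>carrier (unitization A). y \<oplus>\<^bsub>unitization A\<^esub> x = \<zero>\<^bsub>unitization A\<^esub>"
    if "x \<in> carrier (unitization A)" for x
    using that by (intro bexI[of _ "(\<ominus> fst x, - snd x)"]) (auto simp: M.l_neg)
qed (auto simp: M.a_ac)

lemma module_unitization: "Module.module complex_field (unitization A)"
  by (rule moduleI)
    (auto simp: abelian_group_unitization R.cring_axioms smult_add_l smult_add_r algebra_simps)

lemma a_inv_unitization:
  "T \<in> carrier (unitization A) \<Longrightarrow> \<ominus>\<^bsub>unitization A\<^esub> T = (\<ominus> fst T, - snd T)"
  by (rule abelian_group.minus_equality[OF abelian_group_unitization]) (auto simp: M.l_neg)

lemma minus_unitization:
  "\<lbrakk>S \<in> carrier (unitization A); T \<in> carrier (unitization A)\<rbrakk>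
    \<Longrightarrow> S \<ominus>\<^bsub>unitization A\<^esub> T = (fst S \<ominus> fst T, snd S - snd T)"
  unfolding a_minus_def by (simp add: a_inv_unitization)

lemma lmult_nrm_add:
  assumes "fst S \<in> carrier A" "fst T \<in> carrier A"
  shows "lmult_nrm A (fst S \<oplus> fst T, snd S + snd T) \<le> lmult_nrm A S + lmult_nrm A T"
proof (rule lmult_nrm_least)
  fix y assume y: "y \<in> carrier A" "nrm A y \<le> 1"
  have "lmult A (fst S \<oplus> fst T, snd S + snd T) y = lmult A S y \<oplus> lmult A T y"
    apply (simp add: lmult_def expand assms y)
    by (rule coeffs_eq, (rule coeffs_rules | (simp add: assms y algebra_simps; fail))+)
  then have "nrm A (lmult A (fst S \<oplus> fst T, snd S + snd T) y) \<le> nrm A (lmult A S y) + nrm A (lmult A T y)"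
    using assms y by (simp add: nrm_triangle)
  also have "\<dots> \<le> lmult_nrm A S * nrm A y + lmult_nrm A T * nrm A y"
    using assms y by (intro add_mono lmult_le)
  also have "\<dots> \<le> lmult_nrm A S * 1 + lmult_nrm A T * 1"
    using assms y by (intro add_mono mult_left_mono lmult_nrm_nonneg)
  finally show "nrm A (lmult A (fst S \<oplus> fst T, snd S + snd T) y) \<le> lmult_nrm A S + lmult_nrm A T" by simp
qed

lemma lmult_nrm_smult:
  assumes T: "fst T \<in> carrier A"
  shows "lmult_nrm A (c \<odot> fst T, c * snd T) = cmod c * lmult_nrm A T"
proof -
  have *: "lmult_nrm A (c \<odot> fst T, c * snd T) \<le> cmod c * lmult_nrm A T" if T: "fst T \<in> carrier A" for c T
  proof (rule lmult_nrm_least)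
    fix y assume y: "y \<in> carrier A" "nrm A y \<le> 1"
    have "lmult A (c \<odot> fst T, c * snd T) y = c \<odot> lmult A T y"
      using T y by (simp add: lmult_def expand smult_add_r)
    then have "nrm A (lmult A (c \<odot> fst T, c * snd T) y) = cmod c * nrm A (lmult A T y)"
      using T y by (simp add: nrm_smult)
    also have "\<dots> \<le> cmod c * (lmult_nrm A T * nrm A y)"
      using T y by (intro mult_left_mono lmult_le) auto
    also have "\<dots> \<le> cmod c * (lmult_nrm A T * 1)"
      using T y by (intro mult_left_mono lmult_nrm_nonneg) auto
    finally show "nrm A (lmult A (c \<odot> fst T, c * snd T) y) \<le> cmod c * lmult_nrm A T" by simp
  qed
  show ?thesis
  proof (cases "c = 0")
    case True
    have "lmult_nrm A (\<zero>, 0) = 0" by (simp add: lmult_nrm_embed)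
    then show ?thesis using True T by simp
  next
    case False
    \<comment> \<open>The reverse inequality is the first one for the scalar \<open>1 / c\<close>
      and the multiplied operator.\<close>
    have "lmult_nrm A T \<le> cmod (1 / c) * lmult_nrm A (c \<odot> fst T, c * snd T)"
      using *[of "(c \<odot> fst T, c * snd T)" "1 / c"] T False by simp
    then have "cmod c * lmult_nrm A T \<le> lmult_nrm A (c \<odot> fst T, c * snd T)"
      using False by (simp add: norm_divide field_simps)
    then show ?thesis using *[OF T, of c] by simp
  qed
qed

text \<open>The norm of the unitization is equivalent to the sum of the norms of its two components,
  which reduces completeness to that of A and of the complex numbers. The factor 2 arises on
  subtracting the scalar part: the operator norm and \<open>cmod a\<close> are each at most the
  maximum.\<close>

lemma nrm_le_unitization:
  assumes "x \<in> carrier A"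
  shows "nrm A x \<le> 2 * nrm (unitization A) (x, a)"
    and "nrm (unitization A) (x, a) \<le> nrm A x + cmod a"
proof -
  have s: "lmult_nrm A (\<zero>, b) \<le> cmod b" for b
  proof (rule lmult_nrm_least)
    fix y assume y: "y \<in> carrier A" "nrm A y \<le> 1"
    then have "nrm A (lmult A (\<zero>, b) y) = cmod b * nrm A y" by (simp add: lmult_def nrm_smult)
    also have "\<dots> \<le> cmod b * 1" using y by (intro mult_left_mono) auto
    finally show "nrm A (lmult A (\<zero>, b) y) \<le> cmod b" by simp
  qed
  have "nrm A x \<le> lmult_nrm A (x, a) + lmult_nrm A (\<zero>, - a)"
    using lmult_nrm_add[of "(x, a)" "(\<zero>, - a)"] lmult_nrm_embed[OF assms] assms by simp
  then show "nrm A x \<le> 2 * nrm (unitization A) (x, a)" using s[of "- a"] by simp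
  have "lmult_nrm A (x, a) \<le> nrm A x + lmult_nrm A (\<zero>, a)"
    using lmult_nrm_add[of "(x, 0)" "(\<zero>, a)"] lmult_nrm_embed[OF assms] assms by simp
  then show "nrm (unitization A) (x, a) \<le> nrm A x + cmod a"
    using s[of a] nrm_nonneg[OF assms] by simp
qed

lemma unitization_complete:
  assumes u: "\<And>n::nat. u n \<in> carrier (unitization A)"
    and cauchy: "\<forall>e>0. \<exists>N. \<forall>m\<ge>N. \<forall>n\<ge>N. nrm (unitization A) (u m \<ominus>\<^bsub>unitization A\<^esub> u n) < e"
  shows "\<exists>T\<in>carrier (unitization A). (\<lambda>n. nrm (unitization A) (u n \<ominus>\<^bsub>unitization A\<^esub> T)) \<longlonglongrightarrow> 0"
proof -
  have uf: "fst (u n) \<in> carrier A" for n using u[of n] by auto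
  have d: "u m \<ominus>\<^bsub>unitization A\<^esub> u n = (fst (u m) \<ominus> fst (u n), snd (u m) - snd (u n))" for m n
    using u by (intro minus_unitization)
  have "\<exists>N. \<forall>m\<ge>N. \<forall>n\<ge>N. nrm A (fst (u m) \<ominus> fst (u n)) < e" if "e > 0" for e
  proof -
    obtain N where "\<forall>m\<ge>N. \<forall>n\<ge>N. nrm (unitization A) (u m \<ominus>\<^bsub>unitization A\<^esub> u n) < e / 2"
      using cauchy \<open>e > 0\<close> half_gt_zero by blast
    then show ?thesis
      using nrm_le_unitization(1) uf unfolding d
      by (intro exI[of _ N] allI impI) (smt (verit) a_diff_closed field_sum_of_halves)
  qed
  then obtain x where x: "x \<in> carrier A" "(\<lambda>n. nrm A (fst (u n) \<ominus> x)) \<longlonglongrightarrow> 0"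
    using nrm_complete[of "\<lambda>n. fst (u n)"] uf by blast
  have "Cauchy (\<lambda>n. snd (u n))"
  proof (rule CauchyI)
    fix e :: real assume "e > 0"
    then obtain N where "\<forall>m\<ge>N. \<forall>n\<ge>N. nrm (unitization A) (u m \<ominus>\<^bsub>unitization A\<^esub> u n) < e"
      using cauchy by blast
    then show "\<exists>N. \<forall>m\<ge>N. \<forall>n\<ge>N. cmod (snd (u m) - snd (u n)) < e"
      unfolding d by auto
  qed
  then obtain a where a: "(\<lambda>n. snd (u n)) \<longlonglongrightarrow> a"
    using Cauchy_convergent convergent_def by blast
  have lim: "(\<lambda>n. nrm A (fst (u n) \<ominus> x) + cmod (snd (u n) - a)) \<longlonglongrightarrow> 0"
    using x(2) a by (auto intro!: tendsto_add_zero tendsto_norm_zero simp: LIM_zero)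
  have "\<bar>nrm (unitization A) (fst (u n) \<ominus> x, snd (u n) - a)\<bar>
      \<le> nrm A (fst (u n) \<ominus> x) + cmod (snd (u n) - a)" for n
    using nrm_le_unitization(2)[of "fst (u n) \<ominus> x" "snd (u n) - a"] x uf
    by (simp add: abs_if le_max_iff_disj)
  then have "\<bar>nrm (unitization A) (fst (u n) \<ominus> x, snd (u n) - a)\<bar>
      \<le> \<bar>nrm A (fst (u n) \<ominus> x) + cmod (snd (u n) - a)\<bar>" for n
    by (rule order_trans[OF _ abs_ge_self])
  then have "(\<lambda>n. nrm (unitization A) (fst (u n) \<ominus> x, snd (u n) - a)) \<longlonglongrightarrow> 0"
    by (intro tendsto_0_le[OF lim, of _ 1] always_eventually allI) (simp del: unitization_simps)
  then show ?thesis
    using x(1) u by (intro bexI[of _ "(x, a)"]) (auto simp: minus_unitization simp del: unitization_simps(8))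
qed

lemma unital_unitization: "unital_cstar_algebra (unitization A)"
proof -
  interpret U: Module.module complex_field "unitization A" by (rule module_unitization)
  show ?thesis
  proof unfold_locales
    fix x y z assume x: "x \<in> carrier (unitization A)" and y: "y \<in> carrier (unitization A)"
      and z: "z \<in> carrier (unitization A)"
    have c: "fst x \<in> carrier A" "fst y \<in> carrier A" "fst z \<in> carrier A" using x y z by auto
    show "x \<otimes>\<^bsub>unitization A\<^esub> y \<otimes>\<^bsub>unitization A\<^esub> z = x \<otimes>\<^bsub>unitization A\<^esub> (y \<otimes>\<^bsub>unitization A\<^esub> z)"
      apply (simp add: expand c)
      by (rule coeffs_eq, (rule coeffs_rules | (simp add: c algebra_simps; fail))+)
    show "(x \<oplus>\<^bsub>unitization A\<^esub> y) \<otimes>\<^bsub>unitization A\<^esub> z = x \<otimes>\<^bsub>unitization A\<^esub> z \<oplus>\<^bsub>unitization A\<^esub> y \<otimes>\<^bsub>unitization A\<^esub> z"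
      apply (simp add: expand c distrib_right)
      by (rule coeffs_eq, (rule coeffs_rules | (simp add: c algebra_simps; fail))+)
    show "z \<otimes>\<^bsub>unitization A\<^esub> (x \<oplus>\<^bsub>unitization A\<^esub> y) = z \<otimes>\<^bsub>unitization A\<^esub> x \<oplus>\<^bsub>unitization A\<^esub> z \<otimes>\<^bsub>unitization A\<^esub> y"
      apply (simp add: expand c distrib_left)
      by (rule coeffs_eq, (rule coeffs_rules | (simp add: c algebra_simps; fail))+)
  next
    fix x y c assume x: "x \<in> carrier (unitization A)" and y: "y \<in> carrier (unitization A)"
    have c: "fst x \<in> carrier A" "fst y \<in> carrier A" using x y by auto
    show "c \<odot>\<^bsub>unitization A\<^esub> x \<otimes>\<^bsub>unitization A\<^esub> y = c \<odot>\<^bsub>unitization A\<^esub> (x \<otimes>\<^bsub>unitization A\<^esub> y)"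
      apply (simp add: expand c)
      by (rule coeffs_eq, (rule coeffs_rules | (simp add: c algebra_simps; fail))+)
    show "x \<otimes>\<^bsub>unitization A\<^esub> (c \<odot>\<^bsub>unitization A\<^esub> y) = c \<odot>\<^bsub>unitization A\<^esub> (x \<otimes>\<^bsub>unitization A\<^esub> y)"
      apply (simp add: expand c)
      by (rule coeffs_eq, (rule coeffs_rules | (simp add: c algebra_simps; fail))+)
    show "star (unitization A) (x \<otimes>\<^bsub>unitization A\<^esub> y) = star (unitization A) y \<otimes>\<^bsub>unitization A\<^esub> star (unitization A) x"
      apply (simp add: expand c)
      by (rule coeffs_eq, (rule coeffs_rules | (simp add: c algebra_simps; fail))+)
    show "nrm (unitization A) (x \<oplus>\<^bsub>unitization A\<^esub> y) \<le> nrm (unitization A) x + nrm (unitization A) y"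
      using lmult_nrm_add[OF c(1,2)] norm_triangle_ineq[of "snd x" "snd y"] unfolding unitization_simps snd_conv
      by (intro max.boundedI) (rule order_trans, assumption, rule add_mono; simp)+
    have "cmod (snd x) * cmod (snd y) \<le> max (cmod (snd x)) (lmult_nrm A x) * max (cmod (snd y)) (lmult_nrm A y)"
      by (intro mult_mono) (auto simp: le_max_iff_disj)
    moreover have "lmult_nrm A x * lmult_nrm A y \<le> max (cmod (snd x)) (lmult_nrm A x) * max (cmod (snd y)) (lmult_nrm A y)"
      by (intro mult_mono) (auto simp: lmult_nrm_nonneg c le_max_iff_disj)
    ultimately show "nrm (unitization A) (x \<otimes>\<^bsub>unitization A\<^esub> y) \<le> nrm (unitization A) x * nrm (unitization A) y"
      using lmult_nrm_mult[OF c] by (simp add: norm_mult)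
  next
    fix x c assume x: "x \<in> carrier (unitization A)"
    then have c: "fst x \<in> carrier A" by auto
    show "nrm (unitization A) x = 0 \<longleftrightarrow> x = \<zero>\<^bsub>unitization A\<^esub>"
    proof
      assume n: "nrm (unitization A) x = 0"
      then have a: "snd x = 0" by (simp add: max_def split: if_splits)
      then have "lmult_nrm A (fst x, 0) = 0" using n lmult_nrm_nonneg[OF c]
        by (metis max_def norm_zero prod.collapse unitization_simps(8))
      then show "x = \<zero>\<^bsub>unitization A\<^esub>"
        using a c by (simp add: lmult_nrm_embed nrm_eq_0 prod_eq_iff)
    qed (simp add: lmult_nrm_embed)
    show "nrm (unitization A) (c \<odot>\<^bsub>unitization A\<^esub> x) = cmod c * nrm (unitization A) x"
      by (simp add: lmult_nrm_smult c norm_mult max_mult_distrib_left)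
    have "lmult_nrm A (star (unitization A) x \<otimes>\<^bsub>unitization A\<^esub> x) = (lmult_nrm A x)\<^sup>2"
      using lmult_nrm_star_mult[OF c] lmult_nrm_mult[of "star (unitization A) x" x] lmult_nrm_star[OF c] c
      by (simp add: power2_eq_square)
    moreover have "max (p\<^sup>2) (q\<^sup>2) = (max p q)\<^sup>2" if "0 \<le> p" "0 \<le> q" for p q :: real
      using that by (simp add: max_def power_mono)
    ultimately show "nrm (unitization A) (star (unitization A) x \<otimes>\<^bsub>unitization A\<^esub> x) = (nrm (unitization A) x)\<^sup>2"
      using lmult_nrm_nonneg[OF c] by (simp add: norm_mult power2_eq_square)
  next
    fix u :: "nat \<Rightarrow> 'a \<times> complex"
    assume "\<And>n. u n \<in> carrier (unitization A)"
      "\<forall>e>0. \<exists>N. \<forall>m\<ge>N. \<forall>n\<ge>N. nrm (unitization A) (u m \<ominus>\<^bsub>unitization A\<^esub> u n) < e"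
    then show "\<exists>x\<in>carrier (unitization A). (\<lambda>n. nrm (unitization A) (u n \<ominus>\<^bsub>unitization A\<^esub> x)) \<longlonglongrightarrow> 0"
      by (rule unitization_complete)
  qed (auto simp: expand smult_add_r le_max_iff_disj)
qed

end

section \<open>Square roots of 1 - h by iteration\<close>

primrec sqrt_bound :: "nat \<Rightarrow> real" where
  "sqrt_bound 0 = 0"
| "sqrt_bound (Suc n) = (1 + (sqrt_bound n)\<^sup>2) / 2"

lemma sqrt_bound_01: "0 \<le> sqrt_bound n \<and> sqrt_bound n \<le> 1"
proof (induction n)
  case (Suc n)
  then have "(sqrt_bound n)\<^sup>2 \<le> 1" by (simp add: power_le_one)
  then show ?case by simp
qed simp

lemma sqrt_bound_Suc: "sqrt_bound n \<le> sqrt_bound (Suc n)"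
  using zero_le_power2[of "sqrt_bound n - 1"] by (simp add: power2_diff)

text \<open>The limit 1 is a double root of the equation g = (1 + g^2) / 2, so the convergence is
  not geometric. Monotonicity and boundedness give it without a rate.\<close>

lemma sqrt_bound_Cauchy: "Cauchy sqrt_bound"
proof (rule convergent_Cauchy, rule Bseq_mono_convergent)
  show "Bseq sqrt_bound" by (rule BseqI'[of _ 1]) (use sqrt_bound_01 in auto)
  show "\<forall>m n. m \<le> n \<longrightarrow> sqrt_bound m \<le> sqrt_bound n"
    using lift_Suc_mono_le[of sqrt_bound] sqrt_bound_Suc by blast
qed

context unital_cstar_algebra
begin

definition self_adj :: "'a \<Rightarrow> bool" where
  "self_adj h \<longleftrightarrow> h \<in> carrier A \<and> star A h = h"

text \<open>Positivity is witnessed by a self-adjoint root instead of a spectrum. For self-adjoint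
  contractions it amounts to \<open>nrm A (\<one> \<ominus> h) \<le> 1\<close>, by
  \<open>pos_imp_nrm\<close> and \<open>posI\<close>; that condition is convex and survives
  sums.\<close>

definition pos :: "'a \<Rightarrow> bool" where
  "pos h \<longleftrightarrow> (\<exists>u. self_adj u \<and> h = u \<otimes> u)"

lemma self_adj_closed [simp]: "self_adj h \<Longrightarrow> h \<in> carrier A"
  by (simp add: self_adj_def)

lemma star_one [simp]: "star A \<one> = \<one>"
proof -
  have "star A (star A \<one> \<otimes> \<one>) = star A \<one> \<otimes> star A (star A \<one>)" by (rule star_mult) simp_all
  then show ?thesis by (simp add: star_star)
qed

lemma self_adj_one [simp]: "self_adj \<one>" by (simp add: self_adj_def)

lemma self_adj_zero [simp]: "self_adj \<zero>" by (simp add: self_adj_def)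

lemma self_adj_add [simp]: "\<lbrakk>self_adj x; self_adj y\<rbrakk> \<Longrightarrow> self_adj (x \<oplus> y)"
  by (simp add: self_adj_def star_add)

lemma self_adj_minus [simp]: "\<lbrakk>self_adj x; self_adj y\<rbrakk> \<Longrightarrow> self_adj (x \<ominus> y)"
  by (simp add: self_adj_def star_minus)

lemma self_adj_smult [simp]: "self_adj x \<Longrightarrow> self_adj (complex_of_real r \<odot> x)"
  by (simp add: self_adj_def star_smult)

lemma self_adj_mult: "\<lbrakk>self_adj x; self_adj y; x \<otimes> y = y \<otimes> x\<rbrakk> \<Longrightarrow> self_adj (x \<otimes> y)"
  by (simp add: self_adj_def star_mult)

lemma self_adj_square [simp]: "self_adj x \<Longrightarrow> self_adj (x \<otimes> x)"
  by (simp add: self_adj_mult)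

lemma self_adj_star_mult [simp]: "x \<in> carrier A \<Longrightarrow> self_adj (star A x \<otimes> x)"
  by (simp add: self_adj_def star_mult star_star)

lemma self_adj_mult_star [simp]: "x \<in> carrier A \<Longrightarrow> self_adj (x \<otimes> star A x)"
  by (simp add: self_adj_def star_mult star_star)

lemma self_adj_conv: assumes "conv u x" "\<And>n. self_adj (u n)" shows "self_adj x"
proof -
  have "(\<lambda>n. star A (u n)) = u" using assms(2) by (simp add: self_adj_def)
  then have "conv u (star A x)" using conv_star[OF assms(1)] by simp
  then have "star A x = x" using assms(1) by (rule conv_unique)
  then show ?thesis using assms(1) by (simp add: self_adj_def conv_def)
qed

lemma nrm_self_adj_square: "self_adj x \<Longrightarrow> nrm A (x \<otimes> x) = (nrm A x)\<^sup>2"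
  using cstar_identity[of x] by (simp add: self_adj_def)

lemma nrm_one: "nrm A \<one> \<le> 1"
proof -
  have "nrm A \<one> = 0 \<or> nrm A \<one> = 1" using nrm_self_adj_square[of \<one>] by (simp add: power2_eq_square)
  then show ?thesis by linarith
qed

primrec sqrt_iter :: "'a \<Rightarrow> nat \<Rightarrow> 'a" where
  "sqrt_iter h 0 = \<zero>"
| "sqrt_iter h (Suc n) = (1 / 2) \<odot> (h \<oplus> sqrt_iter h n \<otimes> sqrt_iter h n)"

text \<open>
  The root of \<open>1 - h\<close> is \<open>1 - g\<close>, where \<open>g = (h + g\<^sup>2) / 2\<close> is found by iteration. Convergence up to
  the boundary \<open>nrm A h = 1\<close> follows by comparison with the iteration for the number \<open>1\<close>.
\<close>

lemma sqrt_one_minus: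
  assumes h: "self_adj h" and le: "nrm A h \<le> 1"
  obtains s where "self_adj s" "s \<otimes> s = \<one> \<ominus> h" "nrm A (\<one> \<ominus> s) \<le> 1"
    "\<And>x. \<lbrakk>x \<in> carrier A; x \<otimes> h = h \<otimes> x\<rbrakk> \<Longrightarrow> x \<otimes> s = s \<otimes> x"
proof -
  define g where "g = sqrt_iter h"
  have g0: "g 0 = \<zero>" and gS: "g (Suc n) = (1 / 2) \<odot> (h \<oplus> g n \<otimes> g n)" for n
    by (simp_all add: g_def)
  have hc: "h \<in> carrier A" using h by simp
  have sa: "self_adj (g n)" for n
    by (induction n) (use h in \<open>simp_all add: g0 gS self_adj_smult[of _ "1 / 2", simplified]\<close>)
  then have gc [simp]: "g n \<in> carrier A" for n by simp
  have comm: "x \<otimes> g n = g n \<otimes> x" if "x \<in> carrier A" "x \<otimes> h = h \<otimes> x" for x n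
  proof (induction n)
    case (Suc n)
    have "x \<otimes> (g n \<otimes> g n) = (g n \<otimes> g n) \<otimes> x"
      using Suc that by (metis gc mult_assoc)
    then show ?case using that hc by (simp add: gS expand)
  qed (use that in \<open>simp add: g0\<close>)
  have comm_g: "g m \<otimes> g n = g n \<otimes> g m" for m n
    by (rule comm[OF gc comm[OF hc refl, symmetric]])
  have bound: "nrm A (g n) \<le> sqrt_bound n" for n
  proof (induction n)
    case (Suc n)
    have "nrm A (h \<oplus> g n \<otimes> g n) \<le> nrm A h + nrm A (g n \<otimes> g n)"
      using hc by (intro nrm_triangle) auto
    also have "\<dots> \<le> 1 + (sqrt_bound n)\<^sup>2"
      using le Suc nrm_self_adj_square[OF sa] by (simp add: add_mono power_mono nrm_nonneg)
    finally show ?case using hc by (simp add: gS nrm_smult norm_divide)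
  qed (simp add: g0)
  have step: "nrm A (g (Suc n) \<ominus> g n) \<le> sqrt_bound (Suc n) - sqrt_bound n" for n
  proof (induction n)
    case 0
    then show ?case using le hc by (simp add: g0 gS minus_smult nrm_smult norm_divide)
  next
    case (Suc n)
    \<comment> \<open>The difference of two squares factors because the iterates commute. Its
      factors are dominated by the corresponding difference and sum of the scalar iteration, so the
      step bound reproduces itself.\<close>
    have e: "g (Suc (Suc n)) \<ominus> g (Suc n) = (1 / 2) \<odot> ((g (Suc n) \<ominus> g n) \<otimes> (g (Suc n) \<oplus> g n))"
      apply (subst gS[of "Suc n"], subst (3) gS[of n])
      apply (simp add: expand hc comm_g[of "Suc n" n] del: sqrt_iter.simps)
      by (rule coeffs_eq, (rule coeffs_rules | (simp add: hc algebra_simps; fail))+)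
    have "nrm A (g (Suc (Suc n)) \<ominus> g (Suc n))
        \<le> 1 / 2 * (nrm A (g (Suc n) \<ominus> g n) * nrm A (g (Suc n) \<oplus> g n))"
      unfolding e by (simp add: nrm_smult norm_divide nrm_mult)
    also have "\<dots> \<le> 1 / 2 * ((sqrt_bound (Suc n) - sqrt_bound n) * (sqrt_bound (Suc n) + sqrt_bound n))"
      using Suc bound[of n] bound[of "Suc n"] nrm_triangle[of "g (Suc n)" "g n"]
        order_trans[OF sqrt_bound_01[THEN conjunct1] sqrt_bound_Suc]
      by (intro mult_left_mono mult_mono) (auto simp: nrm_nonneg sqrt_bound_Suc simp del: sqrt_bound.simps)
    also have "\<dots> = sqrt_bound (Suc (Suc n)) - sqrt_bound (Suc n)"
      by (simp add: power2_eq_square field_simps)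
    finally show ?case .
  qed
  have dist: "nrm A (g (n + j) \<ominus> g n) \<le> sqrt_bound (n + j) - sqrt_bound n" for n j
  proof (induction j)
    case (Suc j)
    then show ?case
      using step[of "n + j"] nrm_dist_triangle[of "g (Suc (n + j))" "g (n + j)" "g n"]
      by (simp del: sqrt_bound.simps)
  qed simp
  have dist': "nrm A (g m \<ominus> g n) \<le> \<bar>sqrt_bound m - sqrt_bound n\<bar>" for m n
  proof (cases "n \<le> m")
    case True
    then show ?thesis using dist[of n "m - n"] by simp
  next
    case False
    then show ?thesis using dist[of m "n - m"] nrm_minus_commute[of "g m" "g n"] by simp
  qed
  have "\<forall>e>0. \<exists>N. \<forall>m\<ge>N. \<forall>n\<ge>N. nrm A (g m \<ominus> g n) < e"
    using sqrt_bound_Cauchy dist' unfolding Cauchy_iff real_norm_def by (meson le_less_trans)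
  then obtain l where "l \<in> carrier A" "(\<lambda>n. nrm A (g n \<ominus> l)) \<longlonglongrightarrow> 0"
    using nrm_complete[of g] by auto
  then have l: "conv g l" and lc: "l \<in> carrier A" by (auto simp: conv_def)
  have lsa: "self_adj l" using self_adj_conv l sa by blast
  have "conv (\<lambda>n. g (Suc n)) l" using l unfolding conv_def by (auto intro: LIMSEQ_Suc)
  moreover have "conv (\<lambda>n. g (Suc n)) ((1 / 2) \<odot> (h \<oplus> l \<otimes> l))"
    unfolding gS by (intro conv_smult conv_add conv_mult l conv_const hc)
  ultimately have eq: "l = (1 / 2) \<odot> (h \<oplus> l \<otimes> l)" by (rule conv_unique)
  have "2 \<odot> l = h \<oplus> l \<otimes> l" using lc hc by (subst eq) simp
  moreover have "l \<otimes> l = (h \<oplus> l \<otimes> l) \<ominus> h"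
    by (rule coeffs_eq, (rule coeffs_rules | (simp add: lc hc algebra_simps; fail))+)
  ultimately have "l \<otimes> l = 2 \<odot> l \<ominus> h" by simp
  then have square: "(\<one> \<ominus> l) \<otimes> (\<one> \<ominus> l) = \<one> \<ominus> h"
    apply (simp add: expand lc hc)
    by (rule coeffs_eq, (rule coeffs_rules | (simp add: lc hc algebra_simps; fail))+)
  \<comment> \<open>This bound makes the root itself admissible for \<open>sqrt_near_one\<close>, so
    that a root of a root can be taken later.\<close>
  have close: "nrm A (\<one> \<ominus> (\<one> \<ominus> l)) \<le> 1"
  proof -
    have "\<one> \<ominus> (\<one> \<ominus> l) = l"
      by (rule coeffs_eq, (rule coeffs_rules | (simp add: lc algebra_simps; fail))+)
    moreover have "nrm A l \<le> 1"
    proof (rule LIMSEQ_le_const2[OF conv_nrm[OF l]], intro exI allI impI)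
      show "nrm A (g n) \<le> 1" for n using bound[of n] sqrt_bound_01[of n] by linarith
    qed
    ultimately show ?thesis by simp
  qed
  have "x \<otimes> (\<one> \<ominus> l) = (\<one> \<ominus> l) \<otimes> x" if x: "x \<in> carrier A" "x \<otimes> h = h \<otimes> x" for x
  proof -
    have "conv (\<lambda>n. x \<otimes> g n) (x \<otimes> l)" by (intro conv_mult conv_const l x)
    moreover have "conv (\<lambda>n. x \<otimes> g n) (l \<otimes> x)" unfolding comm[OF x] by (intro conv_mult conv_const l x)
    ultimately have "x \<otimes> l = l \<otimes> x" by (rule conv_unique)
    then show ?thesis using x lc by (simp add: expand)
  qed
  then show ?thesis
    by (intro that[OF self_adj_minus[OF self_adj_one lsa] square close])
qed

text \<open>\<open>u + \<i> v\<close> is unitary.\<close>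

lemma nrm_le_one_of_squares:
  assumes u: "self_adj u" and v: "self_adj v" and uv: "u \<otimes> v = v \<otimes> u"
    and one: "u \<otimes> u \<oplus> v \<otimes> v = \<one>"
  shows "nrm A u \<le> 1"
proof -
  have c: "u \<in> carrier A" "v \<in> carrier A" and s: "star A u = u" "star A v = v"
    using u v by (auto simp: self_adj_def)
  define w where "w = u \<oplus> \<i> \<odot> v"
  have w: "w \<in> carrier A" using c by (simp add: w_def)
  have "star A w \<otimes> w = u \<otimes> u \<oplus> v \<otimes> v"
    apply (simp add: w_def expand c s uv)
    by (rule coeffs_eq, (rule coeffs_rules | (simp add: c algebra_simps; fail))+)
  then have "(nrm A w)\<^sup>2 \<le> 1" using one cstar_identity[OF w] nrm_one by simp
  then have n: "nrm A w \<le> 1" using power2_le_imp_le[of "nrm A w" 1] by simp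
  have "u = (1 / 2) \<odot> (w \<oplus> star A w)"
    apply (simp add: w_def expand c s)
    by (rule coeffs_eq, (rule coeffs_rules | (simp add: c algebra_simps; fail))+)
  then have "nrm A u = nrm A ((1 / 2) \<odot> (w \<oplus> star A w))" by (rule arg_cong[of _ _ "nrm A"])
  also have "\<dots> = 1 / 2 * nrm A (w \<oplus> star A w)" using w by (simp add: nrm_smult norm_divide)
  also have "\<dots> \<le> 1 / 2 * (1 + 1)"
    using nrm_triangle[of w "star A w"] w n by simp
  finally show ?thesis by simp
qed

section \<open>The cone of positive elements and monotonicity of the norm\<close>

lemma pos_closed [simp]: "pos h \<Longrightarrow> h \<in> carrier A"
  by (auto simp: pos_def)

lemma pos_self_adj: "pos h \<Longrightarrow> self_adj h"
  by (auto simp: pos_def)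

lemma pos_square: "self_adj u \<Longrightarrow> pos (u \<otimes> u)"
  by (auto simp: pos_def)

lemma pos_zero [simp]: "pos \<zero>"
  using pos_square[of \<zero>] by simp

lemma one_minus_one_minus: "h \<in> carrier A \<Longrightarrow> \<one> \<ominus> (\<one> \<ominus> h) = h"
  by (rule coeffs_eq, (rule coeffs_rules | (simp add: algebra_simps; fail))+)

text \<open>The root u of h commutes with h and therefore with the root s of 1 - h supplied by the
  iteration. Thus s and u are commuting self-adjoint elements whose squares sum to one, and s is a
  contraction.\<close>

lemma pos_imp_nrm:
  assumes "pos h" "nrm A h \<le> 1" shows "nrm A (\<one> \<ominus> h) \<le> 1"
proof -
  obtain u where u: "self_adj u" "h = u \<otimes> u" using assms by (auto simp: pos_def)
  then have uc: "u \<in> carrier A" by simp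
  obtain s where s: "self_adj s" "s \<otimes> s = \<one> \<ominus> h"
    "\<And>x. \<lbrakk>x \<in> carrier A; x \<otimes> h = h \<otimes> x\<rbrakk> \<Longrightarrow> x \<otimes> s = s \<otimes> x"
    using sqrt_one_minus[of h] assms pos_self_adj by metis
  have "u \<otimes> h = h \<otimes> u" using uc by (simp add: u(2) mult_assoc)
  then have us: "u \<otimes> s = s \<otimes> u" by (rule s(3)[OF uc])
  have "s \<otimes> s \<oplus> u \<otimes> u = \<one>"
    unfolding s(2) u(2) using uc by (simp add: minus_add_cancel)
  then have "nrm A s \<le> 1" by (rule nrm_le_one_of_squares[OF s(1) u(1) us[symmetric]])
  then show ?thesis
    using nrm_self_adj_square[OF s(1)] nrm_nonneg[of s] s(1) by (simp add: s(2) power_le_one)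
qed

lemma posI: assumes "self_adj h" "nrm A (\<one> \<ominus> h) \<le> 1" shows "pos h"
proof -
  obtain s where "self_adj s" "s \<otimes> s = \<one> \<ominus> (\<one> \<ominus> h)"
    using sqrt_one_minus[of "\<one> \<ominus> h"] assms by (metis self_adj_minus self_adj_one)
  then show ?thesis using assms pos_square[of s] by (simp add: one_minus_one_minus)
qed

lemma pos_smult: assumes "pos h" "0 \<le> r" shows "pos (complex_of_real r \<odot> h)"
proof -
  obtain u where u: "self_adj u" "h = u \<otimes> u" using assms by (auto simp: pos_def)
  have "complex_of_real r \<odot> h = (complex_of_real (sqrt r) \<odot> u) \<otimes> (complex_of_real (sqrt r) \<odot> u)"
    using u assms by (simp add: expand of_real_mult[symmetric] del: of_real_mult)
  then show ?thesis using u by (simp add: pos_square)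
qed

lemma pos_smult_iff: "\<lbrakk>h \<in> carrier A; 0 < r\<rbrakk> \<Longrightarrow> pos (complex_of_real r \<odot> h) \<longleftrightarrow> pos h"
  using pos_smult[of "complex_of_real r \<odot> h" "1 / r"] pos_smult[of h r] by auto

text \<open>After scaling by a common bound r of both norms, half the sum is a midpoint of two
  positive contractions. The distance to 1 is convex, so the midpoint satisfies the criterion of
  \<open>posI\<close>.\<close>

lemma pos_add: assumes a: "pos a" and b: "pos b" shows "pos (a \<oplus> b)"
proof -
  define r where "r = nrm A a + nrm A b + 1"
  have ac: "a \<in> carrier A" "b \<in> carrier A" using a b by auto
  have r: "r > 0" "nrm A a \<le> r" "nrm A b \<le> r"
    using nrm_nonneg[OF ac(1)] nrm_nonneg[OF ac(2)] by (auto simp: r_def)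
  have n: "nrm A (\<one> \<ominus> complex_of_real (1 / r) \<odot> x) \<le> 1" if "pos x" "nrm A x \<le> r" for x
    using that r by (intro pos_imp_nrm pos_smult) (auto simp: nrm_smult norm_divide)
  define t where "t = complex_of_real (1 / (2 * r)) \<odot> (a \<oplus> b)"
  have "\<one> \<ominus> t = (1 / 2) \<odot> ((\<one> \<ominus> complex_of_real (1 / r) \<odot> a) \<oplus> (\<one> \<ominus> complex_of_real (1 / r) \<odot> b))"
    unfolding t_def using r(1)
    by - (rule coeffs_eq, (rule coeffs_rules | (simp add: ac; fail))+, simp add: field_simps)
  then have "nrm A (\<one> \<ominus> t) = 1 / 2 * nrm A ((\<one> \<ominus> complex_of_real (1 / r) \<odot> a) \<oplus> (\<one> \<ominus> complex_of_real (1 / r) \<odot> b))"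
    using ac by (simp add: nrm_smult norm_divide)
  also have "\<dots> \<le> 1 / 2 * (1 + 1)"
    using n[OF a r(2)] n[OF b r(3)] ac
    by (intro mult_left_mono order_trans[OF nrm_triangle] add_mono) auto
  finally have "pos t" using a b by (intro posI) (auto simp: t_def pos_self_adj simp del: of_real_divide)
  then show ?thesis using ac r unfolding t_def by (subst (asm) pos_smult_iff) auto
qed

text \<open>Since 1 - a = (1 - c) + (c - a) is positive, it has a root v that completes the root u
  of a to u^2 + v^2 = 1. This bounds u, provided that u and v commute.\<close>

lemma nrm_mono_aux:
  assumes a: "pos a" and ca: "pos (c \<ominus> a)" and c: "self_adj c" "nrm A c \<le> 1"
  shows "nrm A a \<le> 1"
proof -
  obtain u where u: "self_adj u" "a = u \<otimes> u" using a by (auto simp: pos_def)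
  have cc: "c \<in> carrier A" "a \<in> carrier A" "u \<in> carrier A" using c a u by auto
  obtain s where s: "self_adj s" "s \<otimes> s = \<one> \<ominus> c" using sqrt_one_minus[OF c] by metis
  have "\<one> \<ominus> a = (\<one> \<ominus> c) \<oplus> (c \<ominus> a)"
    by (rule coeffs_eq, (rule coeffs_rules | (simp add: cc algebra_simps; fail))+)
  then have p: "pos (\<one> \<ominus> a)" using pos_add[OF pos_square[OF s(1)] ca] s by simp
  \<comment> \<open>The root hidden in \<open>p\<close> need not commute with u. After scaling 1 - a
    to a contraction the iteration yields a root t that commutes with everything commuting with a; v
    is t scaled back.\<close>
  define r where "r = nrm A (\<one> \<ominus> a) + 1"
  have r: "r > 0" "nrm A (\<one> \<ominus> a) \<le> r" using nrm_nonneg[of "\<one> \<ominus> a"] cc by (auto simp: r_def)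
  define h where "h = \<one> \<ominus> complex_of_real (1 / r) \<odot> (\<one> \<ominus> a)"
  have h: "self_adj h"
    unfolding h_def by (intro self_adj_minus self_adj_smult self_adj_one pos_self_adj p)
  have h1: "nrm A h \<le> 1"
    unfolding h_def using p r cc by (intro pos_imp_nrm pos_smult) (auto simp: nrm_smult norm_divide)
  obtain t where t: "self_adj t" "t \<otimes> t = \<one> \<ominus> h"
    "\<And>x. \<lbrakk>x \<in> carrier A; x \<otimes> h = h \<otimes> x\<rbrakk> \<Longrightarrow> x \<otimes> t = t \<otimes> x"
    using sqrt_one_minus[OF h h1] by metis
  have tc: "t \<in> carrier A" using t by simp
  have "u \<otimes> h = h \<otimes> u" using cc by (simp add: h_def expand u(2))
  then have ut: "u \<otimes> t = t \<otimes> u" using t(3) cc by simp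
  define v where "v = complex_of_real (sqrt r) \<odot> t"
  have "v \<otimes> v = complex_of_real r \<odot> (\<one> \<ominus> h)"
    using tc r by (simp add: v_def expand t(2)[symmetric] of_real_mult[symmetric] del: of_real_mult)
  also have "\<dots> = \<one> \<ominus> a"
    using cc r by (simp add: h_def one_minus_one_minus)
  finally have "v \<otimes> v = \<one> \<ominus> a" .
  moreover have "a \<oplus> (\<one> \<ominus> a) = \<one>"
    by (rule coeffs_eq, (rule coeffs_rules | (simp add: cc; fail))+)
  ultimately have "u \<otimes> u \<oplus> v \<otimes> v = \<one>" by (simp add: u(2))
  moreover have "self_adj v" using t by (simp add: v_def)
  moreover have "u \<otimes> v = v \<otimes> u" using cc tc by (simp add: v_def expand ut)
  ultimately have "nrm A u \<le> 1" using nrm_le_one_of_squares[OF u(1)] by blast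
  then show ?thesis
    using nrm_self_adj_square[OF u(1)] nrm_nonneg[of u] cc by (simp add: u(2) power_le_one)
qed

lemma nrm_mono:
  assumes a: "pos a" and ca: "pos (c \<ominus> a)" and c: "c \<in> carrier A"
  shows "nrm A a \<le> nrm A c"
proof (rule field_le_epsilon)
  fix e :: real assume "e > 0"
  \<comment> \<open>The summand \<open>e\<close> keeps the divisor positive even for c = 0.\<close>
  define r where "r = nrm A c + e"
  have r: "r > 0" "nrm A c \<le> r" using nrm_nonneg[OF c] \<open>e > 0\<close> by (simp_all add: r_def)
  define q where "q = complex_of_real (1 / r)"
  have q: "cmod q = 1 / r" using r by (simp add: q_def norm_divide)
  have ac: "a \<in> carrier A" using a by simp
  have "self_adj ((c \<ominus> a) \<oplus> a)" by (intro self_adj_add pos_self_adj a ca)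
  then have sc: "self_adj c" using minus_add_cancel[OF c ac] by simp
  have "q \<odot> c \<ominus> q \<odot> a = q \<odot> (c \<ominus> a)"
    by (rule coeffs_eq, (rule coeffs_rules | (simp add: ac c algebra_simps; fail))+)
  then have 1: "pos (q \<odot> c \<ominus> q \<odot> a)" "pos (q \<odot> a)" "self_adj (q \<odot> c)"
    unfolding q_def using pos_smult[OF ca, of "1 / r"] pos_smult[OF a, of "1 / r"] self_adj_smult[OF sc, of "1 / r"] r(1)
    by simp_all
  have "nrm A (q \<odot> c) \<le> 1" using r c by (simp add: nrm_smult q)
  then have "nrm A (q \<odot> a) \<le> 1" using nrm_mono_aux 1 by blast
  then show "nrm A a \<le> nrm A c + e"
    using r(1) ac by (simp add: nrm_smult q r_def)
qed

section \<open>Positivity of x^* x\<close>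

lemma sqrt_near_one:
  assumes c: "self_adj c" and n: "nrm A (\<one> \<ominus> c) \<le> 1"
  obtains k where "self_adj k" "k \<otimes> k = c" "nrm A (\<one> \<ominus> k) \<le> 1"
    "\<And>x. \<lbrakk>x \<in> carrier A; x \<otimes> c = c \<otimes> x\<rbrakk> \<Longrightarrow> x \<otimes> k = k \<otimes> x"
proof -
  have cc: "c \<in> carrier A" using c by simp
  obtain s where s: "self_adj s" "s \<otimes> s = \<one> \<ominus> (\<one> \<ominus> c)" "nrm A (\<one> \<ominus> s) \<le> 1"
    "\<And>x. \<lbrakk>x \<in> carrier A; x \<otimes> (\<one> \<ominus> c) = (\<one> \<ominus> c) \<otimes> x\<rbrakk> \<Longrightarrow> x \<otimes> s = s \<otimes> x"
    using sqrt_one_minus[OF self_adj_minus[OF self_adj_one c] n] by metis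
  have "x \<otimes> s = s \<otimes> x" if "x \<in> carrier A" "x \<otimes> c = c \<otimes> x" for x
    by (rule s(4)) (use that cc in \<open>simp_all add: mult_minus_l mult_minus_r\<close>)
  moreover have "s \<otimes> s = c" using s(2) cc by (simp add: one_minus_one_minus)
  ultimately show ?thesis using s(1,3) that by blast
qed

lemma scale_to_ball:
  assumes "x \<in> carrier A"
  obtains r where "r > 0" "nrm A (complex_of_real r \<odot> x) \<le> 1"
proof -
  have "0 < 1 / (nrm A x + 1)" using nrm_nonneg[OF assms] by simp
  moreover have "nrm A (complex_of_real (1 / (nrm A x + 1)) \<odot> x) \<le> 1"
    using nrm_nonneg[OF assms] assms by (simp add: nrm_smult norm_divide del: of_real_add of_real_divide)
  ultimately show ?thesis using that by blast
qed

text \<open>With p the real part and q the negated imaginary part of y, the two products y y^* and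
  y^* y sum to 2 p^2 + 2 q^2. This exchanges the order of the factors at the cost of a visibly
  positive term.\<close>

lemma re_im:
  assumes y: "y \<in> carrier A"
  obtains p q where "self_adj p" "self_adj q"
    "y \<otimes> star A y = (2 \<odot> (p \<otimes> p) \<oplus> 2 \<odot> (q \<otimes> q)) \<ominus> star A y \<otimes> y"
proof -
  define p where "p = (1 / 2) \<odot> (y \<oplus> star A y)"
  define q where "q = (\<i> / 2) \<odot> (y \<ominus> star A y)"
  have c: "star A y \<in> carrier A" using y by simp
  have "star A p = p"
    unfolding p_def
    apply (simp add: expand y c)
    by (rule coeffs_eq, (rule coeffs_rules | (simp add: y c algebra_simps; fail))+)
  then have "self_adj p" using y by (simp add: self_adj_def p_def)
  moreover have "star A q = q"
    unfolding q_def
    apply (simp add: expand y c)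
    by (rule coeffs_eq, (rule coeffs_rules | (simp add: y c algebra_simps; fail))+)
  then have "self_adj q" using y by (simp add: self_adj_def q_def)
  moreover have "y \<otimes> star A y = (2 \<odot> (p \<otimes> p) \<oplus> 2 \<odot> (q \<otimes> q)) \<ominus> star A y \<otimes> y"
    unfolding p_def q_def
    apply (simp add: expand y c)
    by (rule coeffs_eq, (rule coeffs_rules | (simp add: y c algebra_simps; fail))+)
  ultimately show ?thesis using that by blast
qed

text \<open>Write b for v^2, so that y^* y = - b. Then a = y y^* is positive by
  \<open>re_im\<close>, and w = (1 - a) y is a contraction. But w^* w = - (b + 2 b^2 + b^3) has at
  least the norm of 2 b^2, which is 2. This computation stands in for comparing the spectra of the
  two products.\<close>

lemma star_mult_not_negative:
  assumes y: "y \<in> carrier A" and v: "self_adj v" and eq: "star A y \<otimes> y = \<ominus> (v \<otimes> v)"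
    and n: "nrm A y = 1"
  shows False
proof -
  define b where "b = v \<otimes> v"
  define a where "a = y \<otimes> star A y"
  define p where "p = star A y \<otimes> y"
  have sy: "star A y \<in> carrier A" using y by simp
  have vc: "v \<in> carrier A" using v by simp
  have c: "a \<in> carrier A" "b \<in> carrier A" "p \<in> carrier A" using y vc by (simp_all add: a_def b_def p_def)
  have pb: "p = \<ominus> b" using eq by (simp add: p_def b_def)
  have bpos: "pos b" unfolding b_def by (rule pos_square[OF v])
  obtain s t where st: "self_adj s" "self_adj t" "a = (2 \<odot> (s \<otimes> s) \<oplus> 2 \<odot> (t \<otimes> t)) \<ominus> p"
    using re_im[OF y] unfolding a_def p_def by metis
  have two: "pos (2 \<odot> (x \<otimes> x))" if "self_adj x" for x
    using pos_smult[OF pos_square[OF that], of 2] by simp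
  have "a = 2 \<odot> (s \<otimes> s) \<oplus> 2 \<odot> (t \<otimes> t) \<oplus> b"
    unfolding st(3) pb
    by (rule coeffs_eq, (rule coeffs_rules | (simp add: c self_adj_closed[OF st(1)] self_adj_closed[OF st(2)] algebra_simps; fail))+)
  then have "pos a" using pos_add[OF pos_add[OF two[OF st(1)] two[OF st(2)]] bpos] by simp
  moreover have "nrm A a = 1" using cstar_identity[OF sy] y n by (simp add: a_def star_star)
  ultimately have a1: "nrm A (\<one> \<ominus> a) \<le> 1" by (intro pos_imp_nrm) simp_all
  define w where "w = (\<one> \<ominus> a) \<otimes> y"
  have w: "w \<in> carrier A" using c y by (simp add: w_def)
  have "nrm A w \<le> nrm A (\<one> \<ominus> a) * nrm A y" unfolding w_def using c y by (intro nrm_mult) auto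
  then have "nrm A w \<le> 1" using a1 n by simp
  then have w1: "nrm A (star A w \<otimes> w) \<le> 1"
    using cstar_identity[OF w] nrm_nonneg[OF w] by (simp add: power_le_one)
  have "star A w \<otimes> w = p \<ominus> 2 \<odot> (p \<otimes> p) \<oplus> p \<otimes> (p \<otimes> p)"
    unfolding w_def a_def p_def
    apply (simp add: expand y sy)
    by (rule coeffs_eq, (rule coeffs_rules | (simp add: y sy algebra_simps; fail))+)
  also have "\<dots> = \<ominus> (b \<oplus> 2 \<odot> (b \<otimes> b) \<oplus> b \<otimes> (b \<otimes> b))"
    unfolding pb
    apply (simp add: expand c)
    by (rule coeffs_eq, (rule coeffs_rules | (simp add: c algebra_simps; fail))+)
  finally have le: "nrm A (b \<oplus> 2 \<odot> (b \<otimes> b) \<oplus> b \<otimes> (b \<otimes> b)) \<le> 1"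
    using w1 c by (simp add: nrm_uminus)
  have "star A (v \<otimes> b) = v \<otimes> b"
    unfolding b_def using v by (simp add: expand self_adj_def)
  then have "self_adj (v \<otimes> b)" using vc c by (simp add: self_adj_def)
  moreover have "(v \<otimes> b) \<otimes> (v \<otimes> b) = b \<otimes> (b \<otimes> b)" unfolding b_def using vc by (simp add: mult_assoc)
  ultimately have "pos (b \<otimes> (b \<otimes> b))" using pos_square by metis
  then have "pos (b \<oplus> b \<otimes> (b \<otimes> b))" by (rule pos_add[OF bpos])
  moreover have "b \<oplus> 2 \<odot> (b \<otimes> b) \<oplus> b \<otimes> (b \<otimes> b) \<ominus> 2 \<odot> (b \<otimes> b) = b \<oplus> b \<otimes> (b \<otimes> b)"
    by (rule coeffs_eq, (rule coeffs_rules | (simp add: c algebra_simps; fail))+)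
  ultimately have "nrm A (2 \<odot> (b \<otimes> b)) \<le> nrm A (b \<oplus> 2 \<odot> (b \<otimes> b) \<oplus> b \<otimes> (b \<otimes> b))"
    using two[OF pos_self_adj[OF bpos]] c by (intro nrm_mono) simp_all
  moreover have "nrm A b = 1"
    using cstar_identity[OF y] n eq vc by (simp add: b_def nrm_uminus)
  ultimately show False
    using le c nrm_self_adj_square[OF pos_self_adj[OF bpos]] by (simp add: nrm_smult)
qed

lemma star_mult_negative_imp_zero:
  assumes y: "y \<in> carrier A" and v: "self_adj v" and eq: "star A y \<otimes> y = \<ominus> (v \<otimes> v)"
  shows "y = \<zero>"
proof (rule ccontr)
  assume "y \<noteq> \<zero>"
  then have n: "nrm A y > 0" using nrm_eq_0[OF y] nrm_nonneg[OF y] by linarith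
  define q where "q = complex_of_real (1 / nrm A y)"
  have q: "cmod q = 1 / nrm A y" "cnj q = q" using n by (simp_all add: q_def norm_divide)
  have vc: "v \<in> carrier A" using v by simp
  have "star A (q \<odot> y) \<otimes> (q \<odot> y) = (q * q) \<odot> (star A y \<otimes> y)"
    using y q by (simp add: expand)
  also have "\<dots> = \<ominus> ((q \<odot> v) \<otimes> (q \<odot> v))"
    unfolding eq using vc by (simp add: expand a_inv_smult)
  finally show False
    by (rule star_mult_not_negative[rotated 2])
      (use y v n q in \<open>auto simp: nrm_smult q_def simp del: of_real_divide\<close>)
qed

text \<open>Here k is the absolute value of h = x^* x, r is a root of k, and m = k - h is twice the
  negative part of h. Since h m = - k m, the product of x m with its adjoint is the negative of (r
  m)^2, which forces x m = 0. Then r m and m vanish in turn, leaving h = k = r^2.\<close>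

lemma pos_star_mult_aux:
  assumes x: "x \<in> carrier A" and n: "nrm A x \<le> 1"
  shows "pos (star A x \<otimes> x)"
proof -
  define h where "h = star A x \<otimes> x"
  have h: "self_adj h" unfolding h_def using x by simp
  have hc: "h \<in> carrier A" using h by simp
  have hn: "nrm A h \<le> 1" unfolding h_def using cstar_identity[OF x] n nrm_nonneg[OF x] by (simp add: power_le_one)
  have "nrm A (h \<otimes> h) \<le> 1" using nrm_self_adj_square[OF h] hn nrm_nonneg[OF hc] by (simp add: power_le_one)
  then have "nrm A (\<one> \<ominus> h \<otimes> h) \<le> 1" by (intro pos_imp_nrm pos_square h)
  then obtain k where k: "self_adj k" "k \<otimes> k = h \<otimes> h" "nrm A (\<one> \<ominus> k) \<le> 1"
    "\<And>x. \<lbrakk>x \<in> carrier A; x \<otimes> (h \<otimes> h) = (h \<otimes> h) \<otimes> x\<rbrakk> \<Longrightarrow> x \<otimes> k = k \<otimes> x"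
    using sqrt_near_one[OF self_adj_square[OF h]] by metis
  have kc: "k \<in> carrier A" using k by simp
  have hk: "h \<otimes> k = k \<otimes> h" by (rule k(4)) (use hc in \<open>simp_all add: mult_assoc\<close>)
  obtain r where r: "self_adj r" "r \<otimes> r = k"
    "\<And>x. \<lbrakk>x \<in> carrier A; x \<otimes> k = k \<otimes> x\<rbrakk> \<Longrightarrow> x \<otimes> r = r \<otimes> x"
    using sqrt_near_one[OF k(1,3)] by metis
  have rc: "r \<in> carrier A" using r by simp
  have hr: "h \<otimes> r = r \<otimes> h" by (rule r(3)[OF hc hk])
  have kr: "k \<otimes> r = r \<otimes> k" unfolding r(2)[symmetric] using rc by (simp add: mult_assoc)
  define m where "m = k \<ominus> h"
  have m: "self_adj m" unfolding m_def by (intro self_adj_minus k h)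
  have mc: "m \<in> carrier A" using m by simp
  have mr: "m \<otimes> r = r \<otimes> m" unfolding m_def using kc hc rc by (simp add: mult_minus_l mult_minus_r hr kr)
  have hm: "h \<otimes> m = \<ominus> (k \<otimes> m)"
    unfolding m_def
    apply (simp add: mult_minus_r kc hc)
    by (rule coeffs_eq, (rule coeffs_rules | (simp add: kc hc hk k(2) algebra_simps; fail))+)
  have mm: "m \<otimes> m = 2 \<odot> (r \<otimes> (r \<otimes> m))"
  proof -
    have "m \<otimes> m = k \<otimes> m \<ominus> h \<otimes> m" using kc hc mc by (subst (1) m_def) (simp add: mult_minus_l)
    also have "\<dots> = 2 \<odot> (k \<otimes> m)"
      unfolding hm by (rule coeffs_eq, (rule coeffs_rules | (simp add: kc mc algebra_simps; fail))+)
    finally show ?thesis using rc mc by (simp add: r(2)[symmetric] mult_assoc)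
  qed
  have rm: "self_adj (r \<otimes> m)" by (rule self_adj_mult[OF r(1) m mr[symmetric]])
  have "star A (x \<otimes> m) \<otimes> (x \<otimes> m) = m \<otimes> (h \<otimes> m)"
    using x mc m by (simp add: h_def star_mult mult_assoc self_adj_def)
  also have "\<dots> = \<ominus> (m \<otimes> (r \<otimes> (r \<otimes> m)))"
    unfolding hm using rc mc kc by (simp add: r(2)[symmetric] mult_uminus_r mult_assoc)
  also have "m \<otimes> (r \<otimes> (r \<otimes> m)) = (r \<otimes> m) \<otimes> (r \<otimes> m)"
    using rc mc mr by (simp add: mult_assoc[symmetric])
  finally have neg: "star A (x \<otimes> m) \<otimes> (x \<otimes> m) = \<ominus> ((r \<otimes> m) \<otimes> (r \<otimes> m))" .
  then have "x \<otimes> m = \<zero>" using star_mult_negative_imp_zero[OF _ rm] x mc by simp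
  then have "\<ominus> ((r \<otimes> m) \<otimes> (r \<otimes> m)) = \<zero>" using neg by simp
  then have "nrm A ((r \<otimes> m) \<otimes> (r \<otimes> m)) = 0" using rc mc nrm_uminus[of "(r \<otimes> m) \<otimes> (r \<otimes> m)"] by simp
  then have "nrm A (r \<otimes> m) = 0" using nrm_self_adj_square[OF rm] by simp
  then have "r \<otimes> m = \<zero>" using nrm_eq_0[of "r \<otimes> m"] rc mc by simp
  then have "nrm A (m \<otimes> m) = 0" unfolding mm using rc by simp
  then have "m = \<zero>" using nrm_self_adj_square[OF m] nrm_eq_0[OF mc] by simp
  then have "k = h" unfolding m_def using minus_eq_zero_iff[OF kc hc] by simp
  then show ?thesis using pos_square[OF r(1)] r(2) by (simp add: h_def)
qed

lemma pos_star_mult: assumes x: "x \<in> carrier A" shows "pos (star A x \<otimes> x)"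
proof -
  obtain r where r: "r > 0" "nrm A (complex_of_real r \<odot> x) \<le> 1" using scale_to_ball[OF x] by blast
  have "pos (star A (complex_of_real r \<odot> x) \<otimes> (complex_of_real r \<odot> x))"
    using x r by (intro pos_star_mult_aux) auto
  also have "star A (complex_of_real r \<odot> x) \<otimes> (complex_of_real r \<odot> x) = complex_of_real (r * r) \<odot> (star A x \<otimes> x)"
    using x by (simp add: expand)
  finally show ?thesis using r x pos_smult_iff[of "star A x \<otimes> x" "r * r"] by simp
qed

text \<open>With \<open>d = e e\<^sup>* - e\<^sup>*\<close> one finds \<open>d\<^sup>* d = - (s e\<^sup>*)\<^sup>* (s e\<^sup>*)\<close>, where \<open>s\<^sup>2 = 1 - e\<^sup>* e\<close>.\<close>

lemma contractive_idempotent: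
  assumes e: "e \<in> carrier A" and ee: "e \<otimes> e = e" and n: "nrm A e \<le> 1"
  shows "star A e = e"
proof -
  define f where "f = star A e"
  have f: "f \<in> carrier A" "f \<otimes> f = f" "star A f = e" "star A e = f"
    using e ee by (simp_all add: f_def star_mult[symmetric] star_star)
  have "nrm A (f \<otimes> e) \<le> 1"
    unfolding f_def using cstar_identity[OF e] n nrm_nonneg[OF e] by (simp add: power_le_one)
  then obtain s where s: "self_adj s" "s \<otimes> s = \<one> \<ominus> f \<otimes> e"
    using sqrt_one_minus[of "f \<otimes> e"] e unfolding f_def by (metis self_adj_star_mult)
  have sc: "s \<in> carrier A" "star A s = s" using s by (auto simp: self_adj_def)
  define d where "d = e \<otimes> f \<ominus> f"
  have d: "d \<in> carrier A" using e f by (simp add: d_def)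
  have fx: "f \<otimes> (f \<otimes> x) = f \<otimes> x" and ex: "e \<otimes> (e \<otimes> x) = e \<otimes> x" if "x \<in> carrier A" for x
    using that e f ee by (simp_all add: mult_assoc[symmetric])
  have 1: "star A d \<otimes> d = e \<otimes> (f \<otimes> (e \<otimes> f)) \<ominus> e \<otimes> f"
    unfolding d_def
    apply (simp add: expand e f fx ex ee)
    by (rule coeffs_eq, (rule coeffs_rules | (simp add: e f algebra_simps; fail))+)
  have "star A (s \<otimes> f) \<otimes> (s \<otimes> f) = e \<otimes> ((s \<otimes> s) \<otimes> f)"
    using e f sc by (simp add: star_mult mult_assoc)
  also have "\<dots> = e \<otimes> f \<ominus> e \<otimes> (f \<otimes> (e \<otimes> f))"
    unfolding s(2) using e f by (simp add: expand)
  finally have 2: "star A (s \<otimes> f) \<otimes> (s \<otimes> f) = \<zero> \<ominus> star A d \<otimes> d"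
    unfolding 1
    by (elim ssubst) (rule coeffs_eq, (rule coeffs_rules | (simp add: e f algebra_simps; fail))+)
  have "pos (\<zero> \<ominus> star A d \<otimes> d)"
    using pos_star_mult[of "s \<otimes> f"] sc f unfolding 2 by simp
  then have "nrm A (star A d \<otimes> d) \<le> nrm A \<zero>"
    using pos_star_mult[OF d] by (intro nrm_mono) simp_all
  then have "nrm A d = 0" using cstar_identity[OF d] by simp
  then have "e \<otimes> f = f" using nrm_eq_0[OF d] minus_eq_zero_iff[of "e \<otimes> f" f] e f by (simp add: d_def)
  moreover have "star A (e \<otimes> f) = e \<otimes> f" using e f by (simp add: star_mult)
  ultimately show ?thesis using f by metis
qed

text \<open>Only the root u of a multiple of a has to commute with b. The root v of b need not
  commute with u, because u b u is the product of v u with its adjoint and so already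
  positive.\<close>

lemma pos_mult:
  assumes a: "pos a" and b: "pos b" and ab: "a \<otimes> b = b \<otimes> a"
  shows "pos (a \<otimes> b)"
proof -
  have c: "a \<in> carrier A" "b \<in> carrier A" using a b by auto
  obtain r where r: "r > 0" "nrm A (complex_of_real r \<odot> a) \<le> 1" using scale_to_ball[OF c(1)] by blast
  have ra: "pos (complex_of_real r \<odot> a)" using pos_smult[OF a] r by simp
  obtain u where u: "self_adj u" "u \<otimes> u = complex_of_real r \<odot> a"
    "\<And>x. \<lbrakk>x \<in> carrier A; x \<otimes> (complex_of_real r \<odot> a) = (complex_of_real r \<odot> a) \<otimes> x\<rbrakk> \<Longrightarrow> x \<otimes> u = u \<otimes> x"
    using sqrt_near_one[OF pos_self_adj[OF ra] pos_imp_nrm[OF ra r(2)]] by metis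
  obtain v where v: "self_adj v" "b = v \<otimes> v" using b by (auto simp: pos_def)
  have uc: "u \<in> carrier A" "v \<in> carrier A" "star A u = u" "star A v = v"
    using u(1) v(1) by (simp_all add: self_adj_def)
  have bu: "b \<otimes> u = u \<otimes> b" by (rule u(3)) (use c in \<open>simp_all add: smult_mult_l smult_mult_r ab\<close>)
  have "complex_of_real r \<odot> (a \<otimes> b) = u \<otimes> (u \<otimes> b)" using c uc by (simp add: smult_mult_l[symmetric] u(2)[symmetric] mult_assoc)
  also have "\<dots> = u \<otimes> (b \<otimes> u)" by (simp only: bu)
  also have "\<dots> = star A (v \<otimes> u) \<otimes> (v \<otimes> u)" unfolding v(2) using uc by (simp add: star_mult mult_assoc)
  finally have "pos (complex_of_real r \<odot> (a \<otimes> b))" using pos_star_mult[of "v \<otimes> u"] uc by simp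
  then show ?thesis using pos_smult_iff[of "a \<otimes> b" r] c r by simp
qed

section \<open>Powers of a positive contraction and approximate eigenvectors\<close>

primrec pw :: "'a \<Rightarrow> nat \<Rightarrow> 'a" where
  "pw z 0 = \<one>"
| "pw z (Suc n) = z \<otimes> pw z n"

lemma pw_closed [simp]: "z \<in> carrier A \<Longrightarrow> pw z n \<in> carrier A"
  by (induction n) auto

lemma pw_add: "z \<in> carrier A \<Longrightarrow> pw z (m + n) = pw z m \<otimes> pw z n"
  by (induction m) (auto simp: mult_assoc)

lemma pw_comm: "z \<in> carrier A \<Longrightarrow> pw z n \<otimes> z = z \<otimes> pw z n"
  by (induction n) (auto simp: mult_assoc)

lemma pos_pw: "pos z \<Longrightarrow> pos (pw z n)"
proof (induction n)
  case 0
  show ?case using pos_square[OF self_adj_one] by simp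
next
  case (Suc n)
  then show ?case using pos_mult[of z "pw z n"] by (simp add: pw_comm)
qed

lemma nrm_pw_le: "\<lbrakk>z \<in> carrier A; nrm A z \<le> 1\<rbrakk> \<Longrightarrow> nrm A (pw z n) \<le> 1"
proof (induction n)
  case (Suc n)
  have "nrm A (z \<otimes> pw z n) \<le> nrm A z * nrm A (pw z n)" using Suc by (intro nrm_mult) auto
  also have "\<dots> \<le> 1 * 1" using Suc by (intro mult_mono) (auto simp: nrm_nonneg)
  finally show ?case by simp
qed (simp add: nrm_one)

text \<open>For self-adjoint elements the C*-identity doubles exponents, which settles powers of
  two. Any other power is a factor of one of these, and its cofactor is a contraction.\<close>

lemma nrm_pw:
  assumes z: "pos z" "nrm A z = 1" shows "nrm A (pw z n) = 1"
proof -
  have zc: "z \<in> carrier A" using z by simp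
  have 2: "nrm A (pw z (2 ^ m)) = 1" for m
  proof (induction m)
    case 0
    then show ?case using z by simp
  next
    case (Suc m)
    then show ?case using nrm_self_adj_square[OF pos_self_adj[OF pos_pw[OF z(1)]], of "2 ^ m"] zc
      by (simp add: mult_2 pw_add)
  qed
  have "pw z (2 ^ n) = pw z (2 ^ n - n) \<otimes> pw z n"
    using pw_add[OF zc, of "2 ^ n - n" n] less_exp[of n] by simp
  then have "1 \<le> nrm A (pw z (2 ^ n - n)) * nrm A (pw z n)"
    using nrm_mult[of "pw z (2 ^ n - n)" "pw z n"] 2[of n] zc by simp
  also have "\<dots> \<le> 1 * nrm A (pw z n)"
    using zc z by (intro mult_right_mono nrm_pw_le) (auto simp: nrm_nonneg)
  finally show ?thesis using nrm_pw_le[of z n] zc z by simp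
qed

text \<open>The element 1 - z^(n+1) is 1 - z times the sum of z^0, ..., z^n, and each of these
  powers dominates z^n. In the induction the left side grows by (n+1) (1 - z)^2 z^n.\<close>

lemma pos_one_minus_pw:
  assumes z: "pos z" "nrm A z \<le> 1"
  shows "pos (\<one> \<ominus> pw z (Suc n) \<ominus> of_nat (Suc n) \<odot> ((\<one> \<ominus> z) \<otimes> pw z n))"
proof (induction n)
  case 0
  then show ?case using z by simp
next
  case (Suc n)
  have zc: "z \<in> carrier A" using z by simp
  define q where "q = pw z n"
  have q: "q \<in> carrier A" "q \<otimes> z = z \<otimes> q" "pos q" using zc z by (simp_all add: q_def pw_comm pos_pw)
  have "self_adj (\<one> \<ominus> z)" by (intro self_adj_minus self_adj_one pos_self_adj z)
  then have "pos ((\<one> \<ominus> z) \<otimes> (\<one> \<ominus> z))" by (rule pos_square)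
  then have "pos (((\<one> \<ominus> z) \<otimes> (\<one> \<ominus> z)) \<otimes> q)"
  proof (rule pos_mult[OF _ q(3)])
    have "q \<otimes> (z \<otimes> z) = z \<otimes> (z \<otimes> q)"
      using q zc by (simp add: mult_assoc[symmetric]) (simp add: mult_assoc q)
    then show "((\<one> \<ominus> z) \<otimes> (\<one> \<ominus> z)) \<otimes> q = q \<otimes> ((\<one> \<ominus> z) \<otimes> (\<one> \<ominus> z))"
      by (simp add: expand q zc)
  qed
  then have "pos (complex_of_real (real (Suc n)) \<odot> (((\<one> \<ominus> z) \<otimes> (\<one> \<ominus> z)) \<otimes> q))"
    by (rule pos_smult) simp
  then have "pos ((\<one> \<ominus> pw z (Suc n) \<ominus> of_nat (Suc n) \<odot> ((\<one> \<ominus> z) \<otimes> pw z n))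
      \<oplus> of_nat (Suc n) \<odot> (((\<one> \<ominus> z) \<otimes> (\<one> \<ominus> z)) \<otimes> q))"
    using pos_add[OF Suc.IH] by simp
  moreover have "(\<one> \<ominus> pw z (Suc n) \<ominus> of_nat (Suc n) \<odot> ((\<one> \<ominus> z) \<otimes> pw z n))
      \<oplus> of_nat (Suc n) \<odot> (((\<one> \<ominus> z) \<otimes> (\<one> \<ominus> z)) \<otimes> q)
      = \<one> \<ominus> pw z (Suc (Suc n)) \<ominus> of_nat (Suc (Suc n)) \<odot> ((\<one> \<ominus> z) \<otimes> pw z (Suc n))"
    apply (simp add: q_def[symmetric] expand q(1) zc del: of_nat_Suc)
    by (rule coeffs_eq, (rule coeffs_rules | (simp add: q(1) zc algebra_simps; fail))+)
  ultimately show ?case by simp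
qed

text \<open>A high power of z serves as y. It has norm one, while (m+1) (1 - z) z^m is positive and
  below 1, so that (1 - z) z^m has norm at most 1 / (m+1). The power replaces a unit vector at which
  z attains its norm.\<close>

lemma approximate_eigenvector:
  assumes z: "pos z" "nrm A z = 1" and e: "e > 0"
  obtains y where "y \<in> carrier A" "nrm A y = 1" "nrm A ((\<one> \<ominus> z) \<otimes> y) < e"
proof -
  have zc: "z \<in> carrier A" using z by simp
  obtain n where n: "1 / real (Suc n) < e" using e nat_approx_posE by metis
  define m where "m = Suc n"
  define t where "t = complex_of_real (real (Suc m)) \<odot> ((\<one> \<ominus> z) \<otimes> pw z m)"
  have tc: "t \<in> carrier A" using zc by (simp add: t_def)
  obtain s where s: "self_adj s" "s \<otimes> s = \<one> \<ominus> z"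
    using sqrt_one_minus[OF pos_self_adj[OF z(1)]] z by (metis order_refl)
  have "pos (\<one> \<ominus> z)" using pos_square[OF s(1)] s(2) by simp
  then have "pos ((\<one> \<ominus> z) \<otimes> pw z m)"
    using zc z by (intro pos_mult pos_pw) (simp_all add: mult_minus_l mult_minus_r pw_comm)
  then have t: "pos t" unfolding t_def by (rule pos_smult) simp
  have "pos ((\<one> \<ominus> pw z (Suc m) \<ominus> t) \<oplus> pw z (Suc m))"
    using pos_one_minus_pw[OF z(1), of m] z by (intro pos_add pos_pw) (simp_all add: t_def)
  also have "(\<one> \<ominus> pw z (Suc m) \<ominus> t) \<oplus> pw z (Suc m) = \<one> \<ominus> t"
    by (rule coeffs_eq, (rule coeffs_rules | (simp add: tc zc algebra_simps; fail))+)
  finally have "nrm A t \<le> 1" using nrm_mono[OF t _ one_closed] nrm_one by simp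
  then have "real (Suc m) * nrm A ((\<one> \<ominus> z) \<otimes> pw z m) \<le> 1"
    unfolding t_def using zc by (simp add: nrm_smult del: of_nat_Suc)
  then have "nrm A ((\<one> \<ominus> z) \<otimes> pw z m) \<le> 1 / real (Suc m)" by (simp add: field_simps)
  also have "\<dots> \<le> 1 / real (Suc n)" by (simp add: m_def frac_le)
  finally have "nrm A ((\<one> \<ominus> z) \<otimes> pw z m) < e" using n by simp
  then show ?thesis using that[of "pw z m"] nrm_pw[OF z] zc by simp
qed

end

section \<open>Norm closures, closed subalgebras and the norm of a one by one matrix\<close>

context cstar_algebra
begin

lemma nrm_unitization_embed: "x \<in> carrier A \<Longrightarrow> nrm (unitization A) (x, 0) = nrm A x"
  by (simp add: lmult_nrm_embed nrm_nonneg)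

lemma contractive_idempotent_star:
  assumes e: "e \<in> carrier A" "e \<otimes> e = e" and n: "nrm A e \<le> 1"
  shows "star A e = e"
proof -
  interpret U: unital_cstar_algebra "unitization A" by (rule unital_unitization)
  have "star (unitization A) (e, 0) = (e, 0)"
    by (rule U.contractive_idempotent)
      (use e n in \<open>simp_all add: nrm_unitization_embed del: unitization_simps(8)\<close>)
  then show ?thesis by simp
qed

lemma closure_subset: "cstar_closure A S \<subseteq> carrier A"
  by (auto simp: cstar_closure_def)

lemma subset_closure: "S \<subseteq> carrier A \<Longrightarrow> S \<subseteq> cstar_closure A S"
  unfolding cstar_closure_def by (auto intro!: bexI)

lemma closureD:
  "\<lbrakk>x \<in> cstar_closure A S; e > 0\<rbrakk> \<Longrightarrow> \<exists>y\<in>S. nrm A (x \<ominus> y) < e"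
  by (auto simp: cstar_closure_def)

lemma closure_mono: "S \<subseteq> T \<Longrightarrow> cstar_closure A S \<subseteq> cstar_closure A T"
  unfolding cstar_closure_def by blast

lemma closure_closure: assumes "S \<subseteq> carrier A" shows "cstar_closure A (cstar_closure A S) = cstar_closure A S"
proof
  show "cstar_closure A (cstar_closure A S) \<subseteq> cstar_closure A S"
  proof
    fix x assume x: "x \<in> cstar_closure A (cstar_closure A S)"
    then have xc: "x \<in> carrier A" using closure_subset by auto
    have "\<exists>y\<in>S. nrm A (x \<ominus> y) < e" if "e > 0" for e
    proof -
      obtain z where z: "z \<in> cstar_closure A S" "nrm A (x \<ominus> z) < e / 2"
        using closureD[OF x, of "e / 2"] \<open>e > 0\<close> by auto
      obtain y where y: "y \<in> S" "nrm A (z \<ominus> y) < e / 2"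
        using closureD[OF z(1), of "e / 2"] \<open>e > 0\<close> by auto
      have "nrm A (x \<ominus> y) \<le> nrm A (x \<ominus> z) + nrm A (z \<ominus> y)"
        using xc z(1) y(1) assms closure_subset by (intro nrm_dist_triangle) auto
      then show ?thesis using y z by (intro bexI[of _ y]) auto
    qed
    then show "x \<in> cstar_closure A S" using xc by (simp add: cstar_closure_def)
  qed
  show "cstar_closure A S \<subseteq> cstar_closure A (cstar_closure A S)"
    by (intro subset_closure closure_subset)
qed

lemma closure_seq:
  assumes "x \<in> cstar_closure A S" "S \<subseteq> carrier A"
  obtains u where "\<And>n. u n \<in> S" "conv u x"
proof -
  have "\<exists>y\<in>S. nrm A (x \<ominus> y) < 1 / real (Suc n)" for n
    by (rule closureD[OF assms(1)]) simp
  then obtain u where u: "\<And>n. u n \<in> S" "\<And>n. nrm A (x \<ominus> u n) < 1 / real (Suc n)" by metis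
  have xc: "x \<in> carrier A" using assms(1) closure_subset by blast
  have uc: "u n \<in> carrier A" for n using u(1) assms(2) by blast
  have "conv u x"
  proof (rule conv_bound[OF uc xc])
    show "nrm A (u n \<ominus> x) \<le> 1 / real (Suc n)" for n
      using u(2)[of n] nrm_minus_commute[OF xc uc, of n] by simp
    show "(\<lambda>n. 1 / real (Suc n)) \<longlonglongrightarrow> 0"
      using LIMSEQ_inverse_real_of_nat by (simp add: inverse_eq_divide)
  qed
  then show ?thesis using u(1) that by blast
qed

lemma conv_closure:
  assumes "conv u x" "\<And>n. u n \<in> S" shows "x \<in> cstar_closure A S"
proof -
  have "\<exists>y\<in>S. nrm A (x \<ominus> y) < e" if "e > 0" for e
  proof -
    have "(\<lambda>n. nrm A (u n \<ominus> x)) \<longlonglongrightarrow> 0" using assms(1) by (simp add: conv_def)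
    then have "eventually (\<lambda>n. nrm A (u n \<ominus> x) < e) sequentially" using \<open>e > 0\<close> by (rule order_tendstoD)
    then obtain n where "nrm A (u n \<ominus> x) < e" by (auto simp: eventually_sequentially)
    then show ?thesis using assms nrm_minus_commute[of x "u n"] by (intro bexI[of _ "u n"]) (auto simp: conv_def)
  qed
  then show ?thesis using assms(1) by (simp add: cstar_closure_def conv_def)
qed

lemma operator_algebra_closure:
  assumes S: "S \<subseteq> carrier A" "\<zero> \<in> S"
    and add: "\<And>x y. \<lbrakk>x \<in> S; y \<in> S\<rbrakk> \<Longrightarrow> x \<oplus> y \<in> S"
    and mult: "\<And>x y. \<lbrakk>x \<in> S; y \<in> S\<rbrakk> \<Longrightarrow> x \<otimes> y \<in> S"
    and smult: "\<And>c x. x \<in> S \<Longrightarrow> c \<odot> x \<in> S"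
  shows "operator_algebra A (cstar_closure A S)"
  unfolding operator_algebra_def
proof (intro conjI ballI allI)
  show "\<zero> \<in> cstar_closure A S" using S subset_closure by blast
  show "cstar_closure A (cstar_closure A S) = cstar_closure A S" by (rule closure_closure[OF S(1)])
  fix x assume x: "x \<in> cstar_closure A S"
  obtain u where u: "\<And>n. u n \<in> S" "conv u x" using closure_seq[OF x S(1)] by blast
  show "c \<odot> x \<in> cstar_closure A S" for c
    by (rule conv_closure[OF conv_smult[OF u(2)]]) (rule smult[OF u(1)])
  fix y assume y: "y \<in> cstar_closure A S"
  obtain v where v: "\<And>n. v n \<in> S" "conv v y" using closure_seq[OF y S(1)] by blast
  show "x \<oplus> y \<in> cstar_closure A S"
    by (rule conv_closure[OF conv_add[OF u(2) v(2)]]) (rule add[OF u(1) v(1)])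
  show "x \<otimes> y \<in> cstar_closure A S"
    by (rule conv_closure[OF conv_mult[OF u(2) v(2)]]) (rule mult[OF u(1) v(1)])
qed (rule closure_subset)

lemma star_closure:
  assumes "S \<subseteq> carrier A" "\<And>x. x \<in> S \<Longrightarrow> star A x \<in> S" "x \<in> cstar_closure A S"
  shows "star A x \<in> cstar_closure A S"
proof -
  obtain u where u: "\<And>n. u n \<in> S" "conv u x" using closure_seq[OF assms(3,1)] by blast
  show ?thesis by (rule conv_closure[OF conv_star[OF u(2)]]) (rule assms(2)[OF u(1)])
qed

text \<open>The supremum runs over the norms of x y with y in the unit ball and is attained at the
  normalised adjoint of x.\<close>

lemma mat_nrm_1:
  assumes x: "x \<in> carrier A" shows "mat_nrm A 1 (\<lambda>i j. x) = nrm A x"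
proof -
  have fs: "(\<Oplus>i\<in>{..<1}. h i) = h 0" if "h 0 \<in> carrier A" for h :: "nat \<Rightarrow> 'a"
  proof -
    have "{..<1::nat} = insert 0 {}" by auto
    then show ?thesis using M.finsum_insert[of "{}" 0 h] that by simp
  qed
  define S where "S = {sqrt (nrm A (col_inner A 1 (mat_apply A 1 (\<lambda>i j. x) \<eta>) (mat_apply A 1 (\<lambda>i j. x) \<eta>))) |\<eta>.
            (\<forall>j<1. \<eta> j \<in> carrier A) \<and> nrm A (col_inner A 1 \<eta> \<eta>) \<le> 1}"
  have inn: "nrm A (col_inner A 1 \<eta> \<eta>) = (nrm A (\<eta> 0))\<^sup>2" if "\<eta> 0 \<in> carrier A" for \<eta>
    unfolding col_inner_def using that by (subst fs) (simp_all add: cstar_identity)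
  have ap: "sqrt (nrm A (col_inner A 1 (mat_apply A 1 (\<lambda>i j. x) \<eta>) (mat_apply A 1 (\<lambda>i j. x) \<eta>))) = nrm A (x \<otimes> \<eta> 0)"
    if "\<eta> 0 \<in> carrier A" for \<eta>
  proof -
    have "mat_apply A 1 (\<lambda>i j. x) \<eta> 0 = x \<otimes> \<eta> 0"
      unfolding mat_apply_def using x that by (subst fs) simp_all
    then show ?thesis using x that by (subst inn) (simp_all add: nrm_nonneg)
  qed
  have S: "t \<in> S \<longleftrightarrow> (\<exists>y\<in>carrier A. nrm A y \<le> 1 \<and> t = nrm A (x \<otimes> y))" for t
  proof
    assume "t \<in> S"
    then obtain \<eta> where t: "t = sqrt (nrm A (col_inner A 1 (mat_apply A 1 (\<lambda>i j. x) \<eta>) (mat_apply A 1 (\<lambda>i j. x) \<eta>)))"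
      "\<forall>j<1. \<eta> j \<in> carrier A" "nrm A (col_inner A 1 \<eta> \<eta>) \<le> 1"
      unfolding S_def by (elim CollectE exE conjE)
    have c: "\<eta> 0 \<in> carrier A" using t(2) by simp
    have "(nrm A (\<eta> 0))\<^sup>2 \<le> 1" using t(3) inn[of \<eta>, OF c] by simp
    then have "nrm A (\<eta> 0) \<le> 1" using power2_le_imp_le[of "nrm A (\<eta> 0)" 1] by simp
    then show "\<exists>y\<in>carrier A. nrm A y \<le> 1 \<and> t = nrm A (x \<otimes> y)"
      unfolding t(1) ap[of \<eta>, OF c] by (intro bexI[of _ "\<eta> 0"] conjI refl c)
  next
    assume "\<exists>y\<in>carrier A. nrm A y \<le> 1 \<and> t = nrm A (x \<otimes> y)"
    then obtain y where y: "y \<in> carrier A" "nrm A y \<le> 1" "t = nrm A (x \<otimes> y)"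
      by (elim bexE conjE)
    have "(nrm A y)\<^sup>2 \<le> 1" using y nrm_nonneg[of y] by (simp add: power_le_one)
    then show "t \<in> S"
      unfolding S_def y(3) ap[of "\<lambda>_. y", OF y(1), symmetric] using y(1) inn[of "\<lambda>_. y", OF y(1)]
      by (intro CollectI exI[of _ "\<lambda>_. y"] conjI allI impI) (simp_all only: refl)
  qed
  have le: "t \<le> nrm A x" if "t \<in> S" for t
  proof -
    from that obtain y where y: "y \<in> carrier A" "nrm A y \<le> 1" "t = nrm A (x \<otimes> y)"
      unfolding S by (elim bexE conjE)
    have "nrm A x * nrm A y \<le> nrm A x * 1" using nrm_nonneg[OF x] y by (intro mult_left_mono)
    then show ?thesis using nrm_mult[OF x y(1)] y(3) by simp
  qed
  have zS: "0 \<in> S" unfolding S using x by (intro bexI[of _ \<zero>]) simp_all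
  have bdd: "bdd_above S" using le by (rule bdd_aboveI)
  have "Sup S \<le> nrm A x" using zS le by (intro cSup_least) auto
  moreover have "nrm A x \<le> Sup S"
  proof (cases "nrm A x = 0")
    case True
    then show ?thesis using cSup_upper[OF zS bdd] by simp
  next
    case False
    then have n: "nrm A x > 0" using nrm_nonneg[OF x] by simp
    define q where "q = complex_of_real (1 / nrm A x)"
    have q: "cmod q = 1 / nrm A x" using n by (simp add: q_def norm_divide)
    have "nrm A (x \<otimes> (q \<odot> star A x)) = cmod q * nrm A (x \<otimes> star A x)"
      using x by (simp add: smult_mult_r nrm_smult)
    also have "\<dots> = nrm A x"
      using cstar_identity[of "star A x"] x n by (simp add: star_star q power2_eq_square)
    finally have "nrm A x \<in> S"
      unfolding S using x n by (intro bexI[of _ "q \<odot> star A x"]) (simp_all add: nrm_smult q)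
    then show ?thesis using bdd by (rule cSup_upper)
  qed
  ultimately show ?thesis unfolding mat_nrm_def S_def by (rule antisym)
qed

end

section \<open>Homomorphisms between C*-algebras\<close>

lemma completely_isometric_nrm:
  assumes "cstar_algebra A" "cstar_algebra B" "completely_isometric A S B f" "alg_hom A S B f" "S \<subseteq> carrier A" "x \<in> S"
  shows "nrm B (f x) = nrm A x"
proof -
  have "mat_nrm B 1 (\<lambda>i j. f x) = mat_nrm A 1 (\<lambda>i j. x)"
    using assms(3)[unfolded completely_isometric_def, rule_format, of 1 "\<lambda>_ _. x"] assms(6) by simp
  moreover have "f x \<in> carrier B" "x \<in> carrier A" using assms(4,5,6) by (auto simp: alg_hom_def)
  ultimately show ?thesis
    using cstar_algebra.mat_nrm_1[OF assms(1), of x] cstar_algebra.mat_nrm_1[OF assms(2), of "f x"] by simp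
qed

lemma star_hom_simps:
  assumes "star_hom A B f"
  shows "x \<in> carrier A \<Longrightarrow> f x \<in> carrier B"
    "\<lbrakk>x \<in> carrier A; y \<in> carrier A\<rbrakk> \<Longrightarrow> f (x \<oplus>\<^bsub>A\<^esub> y) = f x \<oplus>\<^bsub>B\<^esub> f y"
    "\<lbrakk>x \<in> carrier A; y \<in> carrier A\<rbrakk> \<Longrightarrow> f (x \<otimes>\<^bsub>A\<^esub> y) = f x \<otimes>\<^bsub>B\<^esub> f y"
    "x \<in> carrier A \<Longrightarrow> f (c \<odot>\<^bsub>A\<^esub> x) = c \<odot>\<^bsub>B\<^esub> f x"
    "x \<in> carrier A \<Longrightarrow> f (star A x) = star B (f x)"
  using assms unfolding star_hom_def alg_hom_def by blast+

lemma alg_hom_simps: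
  assumes "alg_hom A S B f"
  shows "x \<in> S \<Longrightarrow> f x \<in> carrier B"
    "\<lbrakk>x \<in> S; y \<in> S\<rbrakk> \<Longrightarrow> f (x \<oplus>\<^bsub>A\<^esub> y) = f x \<oplus>\<^bsub>B\<^esub> f y"
    "\<lbrakk>x \<in> S; y \<in> S\<rbrakk> \<Longrightarrow> f (x \<otimes>\<^bsub>A\<^esub> y) = f x \<otimes>\<^bsub>B\<^esub> f y"
    "x \<in> S \<Longrightarrow> f (c \<odot>\<^bsub>A\<^esub> x) = c \<odot>\<^bsub>B\<^esub> f x"
  using assms unfolding alg_hom_def by blast+

lemma alg_hom_minus:
  assumes A: "cstar_algebra A" and B: "cstar_algebra B" and f: "alg_hom A S B f" and S: "S \<subseteq> carrier A"
    and sm: "\<And>c x. x \<in> S \<Longrightarrow> c \<odot>\<^bsub>A\<^esub> x \<in> S" and x: "x \<in> S" "y \<in> S"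
  shows "f (x \<ominus>\<^bsub>A\<^esub> y) = f x \<ominus>\<^bsub>B\<^esub> f y"
proof -
  interpret A: cstar_algebra A by fact
  interpret B: cstar_algebra B by fact
  have c: "x \<in> carrier A" "y \<in> carrier A" using S x by auto
  show ?thesis
    using c x sm alg_hom_simps[OF f] by (simp add: A.minus_smult B.minus_smult)
qed

lemma star_hom_minus:
  assumes "cstar_algebra A" "cstar_algebra B" "star_hom A B f" "x \<in> carrier A" "y \<in> carrier A"
  shows "f (x \<ominus>\<^bsub>A\<^esub> y) = f x \<ominus>\<^bsub>B\<^esub> f y"
proof -
  interpret A: cstar_algebra A by fact
  show ?thesis
    using assms(3) by (intro alg_hom_minus[OF assms(1,2), of "carrier A"]) (use assms in \<open>auto simp: star_hom_def\<close>)
qed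

text \<open>A self-adjoint contraction \<open>h\<close> is completed to \<open>h\<^sup>2 + s\<^sup>2 = 1\<close>, which any homomorphism preserves.\<close>

lemma unital_star_hom_contractive:
  assumes A: "unital_cstar_algebra A" and B: "unital_cstar_algebra B" and f: "star_hom A B f" and one: "f \<one>\<^bsub>A\<^esub> = \<one>\<^bsub>B\<^esub>"
    and h: "h \<in> carrier A" "star A h = h" and n: "nrm A h \<le> 1"
  shows "nrm B (f h) \<le> 1"
proof -
  interpret A: unital_cstar_algebra A by fact
  interpret B: unital_cstar_algebra B by fact
  note f_simps = star_hom_simps[OF f]
  have hs: "A.self_adj h" using h by (simp add: A.self_adj_def)
  have hh: "nrm A (h \<otimes>\<^bsub>A\<^esub> h) \<le> 1"
    using A.nrm_self_adj_square[OF hs] n A.nrm_nonneg[OF h(1)] by (simp add: power_le_one)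
  obtain s where s: "A.self_adj s" "s \<otimes>\<^bsub>A\<^esub> s = \<one>\<^bsub>A\<^esub> \<ominus>\<^bsub>A\<^esub> h \<otimes>\<^bsub>A\<^esub> h"
    "\<And>x. \<lbrakk>x \<in> carrier A; x \<otimes>\<^bsub>A\<^esub> (h \<otimes>\<^bsub>A\<^esub> h) = (h \<otimes>\<^bsub>A\<^esub> h) \<otimes>\<^bsub>A\<^esub> x\<rbrakk> \<Longrightarrow> x \<otimes>\<^bsub>A\<^esub> s = s \<otimes>\<^bsub>A\<^esub> x"
    using A.sqrt_one_minus[OF A.self_adj_square[OF hs] hh] by metis
  have sc: "s \<in> carrier A" "star A s = s" using s by (auto simp: A.self_adj_def)
  have "h \<otimes>\<^bsub>A\<^esub> s = s \<otimes>\<^bsub>A\<^esub> h" by (rule s(3)) (use h in \<open>simp_all add: A.mult_assoc\<close>)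
  then have comm: "f h \<otimes>\<^bsub>B\<^esub> f s = f s \<otimes>\<^bsub>B\<^esub> f h"
    using f_simps(3)[OF h(1) sc(1)] f_simps(3)[OF sc(1) h(1)] by simp
  have "s \<otimes>\<^bsub>A\<^esub> s \<oplus>\<^bsub>A\<^esub> h \<otimes>\<^bsub>A\<^esub> h = \<one>\<^bsub>A\<^esub>"
    unfolding s(2) using h by (simp add: A.minus_add_cancel)
  then have "f (s \<otimes>\<^bsub>A\<^esub> s \<oplus>\<^bsub>A\<^esub> h \<otimes>\<^bsub>A\<^esub> h) = \<one>\<^bsub>B\<^esub>" using one by simp
  then have sum: "f h \<otimes>\<^bsub>B\<^esub> f h \<oplus>\<^bsub>B\<^esub> f s \<otimes>\<^bsub>B\<^esub> f s = \<one>\<^bsub>B\<^esub>"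
    using h sc f_simps by (simp add: B.M.a_comm)
  have "B.self_adj (f h)" "B.self_adj (f s)"
    using f_simps(1,5)[OF h(1)] f_simps(1,5)[OF sc(1)] h(2) sc(2) by (simp_all add: B.self_adj_def)
  then show ?thesis using comm sum by (rule B.nrm_le_one_of_squares)
qed

text \<open>Passing to unitizations makes the homomorphism unital. There it is applied to x^* x
  divided by the square of the norm of x, a self-adjoint element of norm one, and the C*-identity
  leads back to x.\<close>

lemma star_hom_contractive:
  assumes A: "cstar_algebra A" and B: "cstar_algebra B" and f: "star_hom A B f" and x: "x \<in> carrier A"
  shows "nrm B (f x) \<le> nrm A x"
proof -
  interpret A: cstar_algebra A by fact
  interpret B: cstar_algebra B by fact
  note f_simps = star_hom_simps[OF f]
  define g where "g = (\<lambda>T :: 'a \<times> complex. (f (fst T), snd T))"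
  have f0: "f \<zero>\<^bsub>A\<^esub> = \<zero>\<^bsub>B\<^esub>" using f_simps(4)[of "\<zero>\<^bsub>A\<^esub>" 0] f_simps(1)[of "\<zero>\<^bsub>A\<^esub>"] by simp
  have g: "star_hom (unitization A) (unitization B) g"
    unfolding star_hom_def alg_hom_def g_def
    by (auto simp: f_simps simp del: unitization_simps(8))
  show ?thesis
  proof (cases "x = \<zero>\<^bsub>A\<^esub>")
    case False
    then have n: "nrm A x > 0" using A.nrm_eq_0[OF x] A.nrm_nonneg[OF x] by linarith
    define h where "h = complex_of_real (1 / (nrm A x)\<^sup>2) \<odot>\<^bsub>A\<^esub> (star A x \<otimes>\<^bsub>A\<^esub> x)"
    have h: "h \<in> carrier A" "star A h = h" using x by (simp_all add: h_def A.star_smult A.star_mult A.star_star)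
    have "nrm A h = 1" unfolding h_def using x n A.cstar_identity[OF x]
      by (simp add: A.nrm_smult norm_divide norm_power)
    then have "nrm (unitization B) (g (h, 0)) \<le> 1"
      by (intro unital_star_hom_contractive[OF A.unital_unitization B.unital_unitization g])
        (use h in \<open>simp_all add: g_def f0 A.nrm_unitization_embed del: unitization_simps(8)\<close>)
    then have "nrm B (f h) \<le> 1"
      using f_simps(1)[OF h(1)] by (simp add: g_def B.nrm_unitization_embed del: unitization_simps(8))
    also have "f h = complex_of_real (1 / (nrm A x)\<^sup>2) \<odot>\<^bsub>B\<^esub> (star B (f x) \<otimes>\<^bsub>B\<^esub> f x)"
      unfolding h_def using x f_simps by simp
    finally have "(nrm B (f x))\<^sup>2 \<le> (nrm A x)\<^sup>2"
      using n f_simps(1)[OF x] B.cstar_identity[OF f_simps(1)[OF x]]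
      by (simp add: B.nrm_smult norm_divide norm_power)
    then show ?thesis by (rule power2_le_imp_le) (rule less_imp_le[OF n])
  qed (simp add: f0)
qed

section \<open>Rooted trees and their ampliations\<close>

definition reach :: "nat pair_pre_digraph \<Rightarrow> nat \<Rightarrow> nat \<Rightarrow> bool" where
  "reach G j i \<longleftrightarrow> j \<rightarrow>\<^sup>*\<^bsub>with_proj G\<^esub> i"

lemma reach_iff:
  assumes "parcs G \<subseteq> pverts G \<times> pverts G"
  shows "reach G j i \<longleftrightarrow> j \<in> pverts G \<and> (j, i) \<in> (parcs G)\<^sup>*"
proof -
  interpret wf_digraph "with_proj G" by unfold_locales (use assms in auto)
  have "(j, i) \<in> (parcs G)\<^sup>* \<Longrightarrow> j \<in> pverts G \<Longrightarrow> i \<in> pverts G"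
    by (induction rule: rtrancl_induct) (use assms in auto)
  then show ?thesis unfolding reach_def reachable_conv by auto
qed

text \<open>These are the features of an out-tree that pass to ampliations by induction; uniqueness
  of directed paths is replaced by uniqueness of predecessors together with acyclicity.\<close>

locale rooted_tree =
  fixes G :: "nat pair_pre_digraph" and c :: nat and p :: nat
  assumes verts: "pverts G = {..<c}"
    and arcs: "parcs G \<subseteq> {..<c} \<times> {..<c}"
    and acyc: "acyclic (parcs G)"
    and pred: "\<lbrakk>(a, v) \<in> parcs G; (b, v) \<in> parcs G\<rbrakk> \<Longrightarrow> a = b"
    and root: "p < c" "i < c \<Longrightarrow> (p, i) \<in> (parcs G)\<^sup>*"
begin

lemma reach_iff': "reach G j i \<longleftrightarrow> j < c \<and> (j, i) \<in> (parcs G)\<^sup>*"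
  using reach_iff[of G j i] arcs verts by simp

lemma reach_less: "reach G j i \<Longrightarrow> j < c \<and> i < c"
proof -
  assume "reach G j i"
  then have "(j, i) \<in> (parcs G)\<^sup>*" "j < c" by (auto simp: reach_iff')
  then show ?thesis by (induction rule: rtrancl_induct) (use arcs in auto)
qed

lemma reach_refl: "i < c \<Longrightarrow> reach G i i"
  by (simp add: reach_iff')

lemma reach_trans: "\<lbrakk>reach G i j; reach G j l\<rbrakk> \<Longrightarrow> reach G i l"
  by (auto simp: reach_iff' intro: rtrancl_trans)

lemma reach_antisym: "\<lbrakk>reach G i j; reach G j i\<rbrakk> \<Longrightarrow> i = j"
  using acyclic_impl_antisym_rtrancl[OF acyc] by (auto simp: reach_iff' antisym_def)

lemma reach_root: "i < c \<Longrightarrow> reach G p i"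
  using root by (simp add: reach_iff')

text \<open>Two vertices above a third lie on the same backward walk, as predecessors are unique.
  This comparability is the source of the semi-Dirichlet property.\<close>

lemma reach_comparable:
  assumes "reach G j i" "reach G l i" shows "reach G j l \<or> reach G l j"
proof -
  have "(j, i) \<in> (parcs G)\<^sup>* \<Longrightarrow> (l, i) \<in> (parcs G)\<^sup>* \<Longrightarrow> (j, l) \<in> (parcs G)\<^sup>* \<or> (l, j) \<in> (parcs G)\<^sup>*"
  proof (induction rule: rtrancl_induct)
    case (step y z)
    from step.prems consider "l = z" | y' where "(l, y') \<in> (parcs G)\<^sup>*" "(y', z) \<in> parcs G"
      by (auto elim: rtranclE)
    then show ?case
    proof cases
      case 1
      then show ?thesis using step.hyps by (auto intro: rtrancl_into_rtrancl)
    next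
      case 2
      then have "y' = y" using step.hyps pred by blast
      then show ?thesis using 2 step.IH by blast
    qed
  qed auto
  then show ?thesis using assms by (auto simp: reach_iff')
qed

text \<open>Reachability in the ampliation is lexicographic: by blocks as in G, and by position
  inside one block. The relation \<open>?S\<close> is transitive and antisymmetric and every arc
  increases it strictly, which gives acyclicity and one direction; explicit walks give the
  other.\<close>

lemma rooted_tree_ampliation:
  assumes m: "0 < m"
  shows "rooted_tree (ampliation G m) (c * m) (p * m)"
    and "reach (ampliation G m) u v \<longleftrightarrow>
      reach G (u div m) (v div m) \<and> (u div m = v div m \<longrightarrow> u mod m \<le> v mod m)" (is "_ \<longleftrightarrow> ?S u v")
proof -
  let ?P = "parcs (ampliation G m)"
  have lt: "i * m + s < c * m" if "i < c" "s < m" for i s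
  proof -
    have "i * m + s < (i + 1) * m" using that by simp
    also have "\<dots> \<le> c * m" using that by (intro mult_right_mono) auto
    finally show ?thesis .
  qed
  have dm: "(i * m + s) div m = i" "(i * m + s) mod m = s" if "s < m" for i s
    using that by simp_all
  have V: "pverts (ampliation G m) = {..<c * m}"
  proof
    show "pverts (ampliation G m) \<subseteq> {..<c * m}" using lt by (auto simp: ampliation_def verts)
    show "{..<c * m} \<subseteq> pverts (ampliation G m)"
    proof
      fix u assume "u \<in> {..<c * m}"
      then have "u div m < c" "u mod m < m" "u = (u div m) * m + u mod m"
        using m by (auto simp: less_mult_imp_div_less)
      then show "u \<in> pverts (ampliation G m)" unfolding ampliation_def verts
        by simp (intro exI[of _ "u div m"] exI[of _ "u mod m"], simp)
    qed
  qed
  have P: "?P = {(i * m + s, i * m + (s + 1)) |i s. i < c \<and> s + 1 < m} \<union>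
              {(j * m + (m - 1), i * m) |j i. (j, i) \<in> parcs G}"
    by (simp add: ampliation_def verts)
  have arcs': "?P \<subseteq> {..<c * m} \<times> {..<c * m}"
  proof (rule subsetI)
    fix e assume "e \<in> ?P"
    then consider i s where "e = (i * m + s, i * m + (s + 1))" "i < c" "s + 1 < m"
      | j i where "e = (j * m + (m - 1), i * m)" "(j, i) \<in> parcs G"
      unfolding P by blast
    then show "e \<in> {..<c * m} \<times> {..<c * m}"
    proof cases
      case 1
      then show ?thesis using lt[of i s] lt[of i "s + 1"] by simp
    next
      case 2
      then have "j < c" "i < c" using arcs by auto
      then show ?thesis using 2 lt[of j "m - 1"] lt[of i 0] m by simp
    qed
  qed
  have strict: "?S u v \<and> u \<noteq> v" if uv: "(u, v) \<in> ?P" for u v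
  proof -
    from uv consider i s where "u = i * m + s" "v = i * m + (s + 1)" "i < c" "s + 1 < m"
      | j i where "u = j * m + (m - 1)" "v = i * m" "(j, i) \<in> parcs G"
      unfolding P by blast
    then show ?thesis
    proof cases
      case 1
      have "u div m = i" "u mod m = s" "v div m = i" "v mod m = s + 1"
        unfolding 1(1,2) using 1(4) by (simp_all only: dm)
      then show ?thesis using reach_refl[OF 1(3)] by auto
    next
      case 2
      then have "i \<noteq> j" using acyc by (auto simp: acyclic_def)
      moreover have "reach G j i" using 2 arcs by (auto simp: reach_iff')
      moreover have "u div m = j" "v div m = i"
        unfolding 2(1,2) using dm(1)[of "m - 1" j] dm(1)[of 0 i] m by simp_all
      ultimately show ?thesis by auto
    qed
  qed
  \<comment> \<open>If the outer blocks agree, antisymmetry of reachability puts the middle vertex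
    into the same block, and positions can be compared.\<close>
  have S_trans: "?S u w" if "?S u v" "?S v w" for u v w
    using that reach_trans[of "u div m" "v div m" "w div m"] reach_antisym[of "u div m" "v div m"]
    by auto
  have S_antisym: "u = v" if "?S u v" "?S v u" for u v
  proof -
    have "u div m = v div m" using that reach_antisym by blast
    moreover from this have "u mod m = v mod m" using that by auto
    ultimately show ?thesis by (metis div_mult_mod_eq)
  qed
  have S_if: "?S u v \<and> u \<noteq> v" if "(u, v) \<in> ?P\<^sup>+" for u v
    using that
  proof (induction rule: trancl_induct)
    case (step y z)
    then show ?case using strict[of y z] S_trans[of u y z] S_antisym[of u y] by metis
  qed (rule strict)
  have acyc': "acyclic ?P" using S_if unfolding acyclic_def by blast
  have within: "(i * m + s, i * m + (s + d)) \<in> ?P\<^sup>*" if "i < c" "s + d < m" for i s d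
    using that
  proof (induction d)
    case (Suc d)
    have "(i * m + (s + d), i * m + (s + d + 1)) \<in> ?P" unfolding P using Suc by auto
    then show ?case using Suc by (auto intro: rtrancl_into_rtrancl)
  qed auto
  have within': "(i * m + s, i * m + t) \<in> ?P\<^sup>*" if "i < c" "s \<le> t" "t < m" for i s t
    using within[of i s "t - s"] that by simp
  have across: "(j * m + (m - 1), i * m) \<in> ?P\<^sup>*" if "(j, i) \<in> (parcs G)\<^sup>+" "j < c" for i j
    using that
  proof (induction rule: trancl_induct)
    case (base y)
    then have "(j * m + (m - 1), y * m) \<in> ?P" unfolding P by auto
    then show ?case by auto
  next
    case (step y z)
    have "(y * m + (m - 1), z * m) \<in> ?P" unfolding P using step by auto
    moreover have "(y * m, y * m + (m - 1)) \<in> ?P\<^sup>*" using within'[of y 0 "m - 1"] step arcs m by auto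
    moreover have "(j * m + (m - 1), y * m) \<in> ?P\<^sup>*" by (rule step.IH[OF step.prems])
    ultimately show ?case by (auto intro: rtrancl_trans rtrancl_into_rtrancl)
  qed
  \<comment> \<open>Between different blocks the walk runs from u to the end of its block, from
    there to the start of the block of v, and then on to v.\<close>
  have S_imp: "(u, v) \<in> ?P\<^sup>*" if S: "?S u v" for u v
  proof -
    have c: "u div m < c" "v div m < c" using S reach_less by auto
    show ?thesis
    proof (cases "u div m = v div m")
      case True
      then have "(u div m * m + u mod m, u div m * m + v mod m) \<in> ?P\<^sup>*"
        using within'[of "u div m" "u mod m" "v mod m"] S c m by auto
      then show ?thesis using True by (metis div_mult_mod_eq)
    next
      case False
      then have "(u div m, v div m) \<in> (parcs G)\<^sup>+"
        using S by (auto simp: reach_iff' rtrancl_eq_or_trancl)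
      then have "(u div m * m + (m - 1), v div m * m) \<in> ?P\<^sup>*" using across c by blast
      moreover have "(u div m * m + u mod m, u div m * m + (m - 1)) \<in> ?P\<^sup>*"
        using c m mod_less_divisor[OF m, of u] by (intro within') linarith+
      ultimately have "(u div m * m + u mod m, v div m * m + 0) \<in> ?P\<^sup>*"
        by (simp only: add_0_right)
      moreover have "(v div m * m + 0, v div m * m + v mod m) \<in> ?P\<^sup>*"
        using c m by (intro within') simp_all
      ultimately have "(u div m * m + u mod m, v div m * m + v mod m) \<in> ?P\<^sup>*"
        by (rule rtrancl_trans)
      then show ?thesis by simp
    qed
  qed
  have S_less: "u < c * m" if "?S u v" for u v
    using that reach_less[of "u div m" "v div m"] m by (simp add: div_less_iff_less_mult)
  show char: "reach (ampliation G m) u v \<longleftrightarrow> ?S u v" for u v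
  proof -
    have "reach (ampliation G m) u v \<longleftrightarrow> u < c * m \<and> (u, v) \<in> ?P\<^sup>*"
      using reach_iff[of "ampliation G m" u v] arcs' V by simp
    also have "\<dots> \<longleftrightarrow> ?S u v"
    proof
      assume a: "u < c * m \<and> (u, v) \<in> ?P\<^sup>*"
      then show "?S u v"
        using S_if[of u v] reach_refl[of "u div m"]
        by (cases "u = v") (auto simp: rtrancl_eq_or_trancl less_mult_imp_div_less)
    next
      assume "?S u v"
      then show "u < c * m \<and> (u, v) \<in> ?P\<^sup>*" using S_imp S_less by blast
    qed
    finally show ?thesis .
  qed
  show "rooted_tree (ampliation G m) (c * m) (p * m)"
  proof
    show "pverts (ampliation G m) = {..<c * m}" by (rule V)
    show "?P \<subseteq> {..<c * m} \<times> {..<c * m}" by (rule arcs')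
    show "acyclic ?P" by (rule acyc')
    show "p * m < c * m" using root m by simp
    show "(p * m, i) \<in> ?P\<^sup>*" if "i < c * m" for i
      using S_imp[of "p * m" i] reach_root[of "i div m"] that m by (simp add: less_mult_imp_div_less)
    fix a b v assume a: "(a, v) \<in> ?P" and b: "(b, v) \<in> ?P"
    show "a = b"
    \<comment> \<open>The first vertex of a block is entered only from the last vertex of the parent
      block, and any other vertex only from the one before it.\<close>
    proof (cases "v mod m = 0")
      case True
      have "\<exists>j. x = j * m + (m - 1) \<and> (j, v div m) \<in> parcs G" if x: "(x, v) \<in> ?P" for x
      proof -
        from x consider i s where "x = i * m + s" "v = i * m + (s + 1)" "i < c" "s + 1 < m"
          | j i where "x = j * m + (m - 1)" "v = i * m" "(j, i) \<in> parcs G"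
          unfolding P by blast
        then show ?thesis using True m by cases auto
      qed
      then show ?thesis using a b pred by metis
    next
      case False
      have "Suc x = v" if x: "(x, v) \<in> ?P" for x
        using x False unfolding P by auto
      then show ?thesis using a b by (metis nat.inject)
    qed
  qed
qed

end

section \<open>From out-trees to rooted trees, and trees with total reachability\<close>

lemma out_tree_acyclic:
  assumes "out_tree G" shows "acyclic (parcs G)"
proof (rule ccontr)
  assume "\<not> acyclic (parcs G)"
  then obtain u where u: "(u, u) \<in> (parcs G)\<^sup>+" by (auto simp: acyclic_def)
  interpret pair_fin_digraph G using assms by (simp add: out_tree_def)
  obtain w where w: "(u, w) \<in> parcs G" "(w, u) \<in> (parcs G)\<^sup>*" using u by (auto dest: tranclD)
  have "w \<in> pverts G" using w(1) by (rule in_arcsD2)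
  then have "w \<rightarrow>\<^sup>*\<^bsub>with_proj G\<^esub> u" using reachable_conv'[of w u] w(2) by simp
  then obtain q where "awalk w q u" by (auto simp: reachable_awalk)
  then have "awalk u ((u, w) # q) u" using w(1) in_arcsD1[OF w(1)] by (simp add: awalk_Cons_iff)
  then have "closed_w ((u, w) # q)" unfolding closed_w_def by auto
  then obtain c where "cycle c" using closed_w_imp_cycle by blast
  then obtain v where c: "awalk v c v" "distinct (tl (pawalk_verts v c))" "distinct c" "c \<noteq> []"
    unfolding cycle_conv by auto
  \<comment> \<open>With every edge traversed forwards, the directed cycle becomes an undirected one
    that uses no edge twice.\<close>
  let ?c = "map (\<lambda>e. (e, True)) c"
  have verts: "pre_digraph.awalk_verts (underlying G) x (map (\<lambda>e. (e, True)) d) = pawalk_verts x d" for x d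
    by (induction d arbitrary: x) (simp_all add: pre_digraph.awalk_verts.simps underlying_def)
  have cas: "pre_digraph.cas (underlying G) x (map (\<lambda>e. (e, True)) d) y = pcas x d y" for x y d
    by (induction d arbitrary: x) (simp_all add: pre_digraph.cas.simps underlying_def)
  have "pre_digraph.awalk (underlying G) v ?c v"
    using c(1) unfolding pre_digraph.awalk_def cas awalk_def by (auto simp: underlying_def)
  then have "pre_digraph.cycle (underlying G) ?c"
    unfolding pre_digraph.cycle_def verts using c by auto
  moreover have "distinct (map fst ?c)" using c(3) by (simp add: comp_def)
  ultimately show False using assms unfolding out_tree_def undirected_acyclic_def by blast
qed

lemma rooted_tree_out_tree:
  assumes "out_tree G" "pverts G = {..<c}"
  obtains p where "rooted_tree G c p"
proof -
  interpret pair_fin_digraph G using assms by (simp add: out_tree_def)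
  obtain p where p: "p \<in> pverts G" "\<forall>q\<in>pverts G. q \<noteq> p \<longrightarrow> (\<exists>!w. apath p w q)"
    using assms(1) unfolding out_tree_def by blast
  have "rooted_tree G c p"
  proof
    show "parcs G \<subseteq> {..<c} \<times> {..<c}" using in_arcsD1 in_arcsD2 assms(2) by auto
    show "acyclic (parcs G)" using assms(1) by (rule out_tree_acyclic)
    show "p < c" using p assms by simp
    show "(p, i) \<in> (parcs G)\<^sup>*" if "i < c" for i
    proof (cases "i = p")
      case False
      then have "\<exists>!w. apath p w i" using p(2)[rule_format, of i] that assms(2) by simp
      then obtain w where "apath p w i" by (elim ex1E)
      then have "p \<rightarrow>\<^sup>*\<^bsub>with_proj G\<^esub> i" by (auto simp: reachable_apath)
      then show ?thesis using reachable_conv'[OF p(1)] by simp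
    qed simp
    fix a b v assume ab: "(a, v) \<in> parcs G" "(b, v) \<in> parcs G"
    have "in_degree (with_proj G) v \<le> 1" using assms(1) in_arcsD2[OF ab(1)] unfolding out_tree_def by blast
    then have "card {e \<in> parcs G. snd e = v} \<le> 1" by (simp add: in_degree_def in_arcs_def)
    moreover have "finite {e \<in> parcs G. snd e = v}" by simp
    ultimately have "\<forall>e\<in>{e \<in> parcs G. snd e = v}. \<forall>e'\<in>{e \<in> parcs G. snd e = v}. e = e'"
      by (simp only: card_le_Suc0_iff_eq One_nat_def)
    then have "(a, v) = (b, v)" using ab by force
    then show "a = b" by simp
  qed (rule assms(2))
  then show ?thesis by (rule that)
qed

text \<open>Totality gives a vertex v reachable from all vertices. The path from the root to v
  already contains everything, because following predecessors back from v never leaves it. The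
  contrapositive supplies the pair of incomparable vertices.\<close>

lemma (in rooted_tree) single_directed_path_if_total:
  assumes wf: "pair_fin_digraph G"
    and total: "\<And>i j. \<lbrakk>i < c; j < c\<rbrakk> \<Longrightarrow> reach G i j \<or> reach G j i"
  shows "single_directed_path G"
proof -
  interpret pair_fin_digraph G by (rule wf)
  have "F \<noteq> {} \<Longrightarrow> F \<subseteq> {..<c} \<Longrightarrow> \<exists>v\<in>F. \<forall>u\<in>F. reach G u v" if "finite F" for F
    using that
  proof (induction F rule: finite_ne_induct)
    case (singleton x)
    then show ?case using reach_refl by auto
  next
    case (insert x F)
    then obtain v where v: "v \<in> F" "\<forall>u\<in>F. reach G u v" by auto
    then consider "reach G x v" | "reach G v x" using total[of x v] insert by auto
    then show ?case
    proof cases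
      case 1
      then show ?thesis using v by auto
    next
      case 2
      then have "\<forall>u\<in>insert x F. reach G u x" using v reach_trans reach_refl insert.prems by blast
      then show ?thesis by auto
    qed
  qed
  from this[of "{..<c}"] obtain v where "v \<in> {..<c}" "\<forall>u\<in>{..<c}. reach G u v" using root(1) by auto
  then have v: "v < c" "\<And>u. u < c \<Longrightarrow> reach G u v" by auto
  have "p \<rightarrow>\<^sup>*\<^bsub>with_proj G\<^esub> v" using v(2)[OF root(1)] by (simp add: reach_def)
  then obtain w where w: "apath p w v" by (auto simp: reachable_apath)
  then have aw: "awalk p w v" by (simp add: apath_def)
  have wP: "set w \<subseteq> parcs G" using aw by (auto simp: awalk_def)
  have no_root: "(a, p) \<notin> parcs G" for a
  proof
    assume a: "(a, p) \<in> parcs G"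
    then have "(p, a) \<in> (parcs G)\<^sup>*" using root(2)[of a] arcs by auto
    then have "(p, p) \<in> (parcs G)\<^sup>+" using a by (rule rtrancl_into_trancl1)
    then show False using acyc by (simp add: acyclic_def)
  qed
  have enter: "y = x \<or> (\<exists>e\<in>set d. snd e = y)" if "pcas x d z" "y \<in> set (pawalk_verts x d)" for x y z d
    using that by (induction d arbitrary: x) auto
  have cas: "pcas p w v" using aw by (simp add: awalk_def)
  have fst_in: "e \<in> set d \<Longrightarrow> fst e \<in> set (pawalk_verts x d)" for e d x
    by (induction d arbitrary: x) auto
  have end_in: "pcas x d z \<Longrightarrow> z \<in> set (pawalk_verts x d)" for x d z
    by (induction d arbitrary: x) auto
  \<comment> \<open>Backward induction on a walk to v: the path enters y through some arc, and by
    uniqueness of predecessors that arc starts at x.\<close>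
  have on_path: "q \<in> set (pawalk_verts p w)" if "(q, v) \<in> (parcs G)\<^sup>*" for q
    using that
  proof (induction rule: converse_rtrancl_induct)
    case base
    then show ?case using end_in[OF cas] .
  next
    case (step x y)
    then have "y \<noteq> p" using no_root by blast
    then obtain e where e: "e \<in> set w" "snd e = y" using enter[OF cas step.IH] by auto
    then have "(fst e, y) \<in> parcs G" using wP by auto
    then have "fst e = x" using step.hyps pred by blast
    then show ?case using fst_in[OF e(1)] by metis
  qed
  have "set (pawalk_verts p w) = pverts G"
  proof
    show "set (pawalk_verts p w) \<subseteq> pverts G" using awalk_verts_in_verts aw by auto
    show "pverts G \<subseteq> set (pawalk_verts p w)" using v(2) on_path verts by (auto simp: reach_iff')
  qed
  moreover have "set w = parcs G"
  proof
    show "parcs G \<subseteq> set w"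
    proof
      fix e assume e: "e \<in> parcs G"
      obtain a b where ab: "e = (a, b)" by fastforce
      have "b < c" using e ab arcs by auto
      then have "b \<in> set (pawalk_verts p w)" using v(2) on_path by (auto simp: reach_iff')
      moreover have "b \<noteq> p" using no_root e ab by blast
      ultimately obtain e' where e': "e' \<in> set w" "snd e' = b" using enter[OF cas] by blast
      then have "(fst e', b) \<in> parcs G" using wP by auto
      then have "fst e' = a" using e ab pred by blast
      then show "e \<in> set w" using e' ab by (metis prod.collapse)
    qed
  qed (rule wP)
  ultimately show ?thesis unfolding single_directed_path_def using w by auto
qed

section \<open>Matrix algebras and their operator norm\<close>

lemma mat_adjoint_index:
  "\<lbrakk>A \<in> carrier_mat c c; i < c; j < c\<rbrakk> \<Longrightarrow> mat_adjoint A $$ (i, j) = cnj (A $$ (j, i))"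
  by (simp add: mat_adjoint_def mat_of_rows_def)

lemma mat_adjoint_mat:
  "mat_adjoint (mat c c \<alpha>) = mat c c (\<lambda>(i, j). cnj (\<alpha> (j, i)))"
  by (rule eq_matI) (simp_all add: mat_adjoint_index[of _ c], simp_all add: mat_adjoint_def)

lemma mat_mult_mat:
  "mat c c \<alpha> * mat c c \<beta> = mat c c (\<lambda>(i, j). \<Sum>l<c. \<alpha> (i, l) * \<beta> (l, j) :: complex)"
  by (rule eq_matI) (auto simp: scalar_prod_def atLeast0LessThan)

lemma mat_cstar_simps [simp]:
  "carrier (mat_cstar c) = carrier_mat c c" "x \<otimes>\<^bsub>mat_cstar c\<^esub> y = x * y" "\<zero>\<^bsub>mat_cstar c\<^esub> = 0\<^sub>m c c"
  "x \<oplus>\<^bsub>mat_cstar c\<^esub> y = x + y" "a \<odot>\<^bsub>mat_cstar c\<^esub> x = a \<cdot>\<^sub>m x" "star (mat_cstar c) = mat_adjoint"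
  "nrm (mat_cstar c) = mat_opnorm"
  by (simp_all add: mat_cstar_def)

lemma mat_opnorm_le:
  assumes "0 \<le> C" "\<And>\<beta>. sqrt (\<Sum>i<c. (cmod (\<Sum>j<c. \<alpha> (i, j) * \<beta> j))\<^sup>2) \<le> C * sqrt (\<Sum>j<c. (cmod (\<beta> j))\<^sup>2)"
  shows "mat_opnorm (mat c c \<alpha>) \<le> C"
  unfolding mat_opnorm_def
proof (rule cSup_least)
  show "{vec_l2norm (mat c c \<alpha> *\<^sub>v v) |v. v \<in> carrier_vec (dim_col (mat c c \<alpha>)) \<and> vec_l2norm v \<le> 1} \<noteq> {}"
    by (auto intro!: exI[of _ "0\<^sub>v c"] simp: vec_l2norm_def)
  fix t assume "t \<in> {vec_l2norm (mat c c \<alpha> *\<^sub>v v) |v. v \<in> carrier_vec (dim_col (mat c c \<alpha>)) \<and> vec_l2norm v \<le> 1}"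
  then obtain v where v: "v \<in> carrier_vec c" "vec_l2norm v \<le> 1" "t = vec_l2norm (mat c c \<alpha> *\<^sub>v v)" by auto
  have d: "dim_vec v = c" using v by auto
  have "t = sqrt (\<Sum>i<c. (cmod (\<Sum>j<c. \<alpha> (i, j) * v $ j))\<^sup>2)"
    unfolding v(3) vec_l2norm_def using d
    by (simp add: mult_mat_vec_def scalar_prod_def atLeast0LessThan)
  also have "\<dots> \<le> C * vec_l2norm v" unfolding vec_l2norm_def d by (rule assms(2))
  also have "\<dots> \<le> C * 1" using v assms by (intro mult_left_mono)
  finally show "t \<le> C" by simp
qed

text \<open>A nonzero norm is enough: by the C*-identity the norm of a projection equals its own
  square, from which \<open>u_diag_nrm\<close> obtains the value one.\<close>

lemma mat_opnorm_unit:
  assumes "i < c" shows "mat_opnorm (mat c c (\<lambda>q. if q = (i, i) then 1 else 0)) \<noteq> 0"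
proof -
  let ?M = "mat c c (\<lambda>q. if q = (i, i) then 1 else (0::complex))"
  let ?S = "{vec_l2norm (?M *\<^sub>v v) |v. v \<in> carrier_vec (dim_col ?M) \<and> vec_l2norm v \<le> 1}"
  have Mv: "?M *\<^sub>v v = vec c (\<lambda>a. if a = i then v $ i else 0)" if "v \<in> carrier_vec c" for v
    using that assms
    by (intro eq_vecI) (auto simp: scalar_prod_def if_distrib[of "\<lambda>x. x * _"] atLeast0LessThan sum.delta cong: if_cong)
  have n: "vec_l2norm (?M *\<^sub>v v) = cmod (v $ i)" if "v \<in> carrier_vec c" for v
    unfolding Mv[OF that] vec_l2norm_def using assms
    by (simp add: if_distrib[of cmod] if_distrib[of "\<lambda>x. x\<^sup>2"] sum.delta cong: if_cong)
  have le: "t \<le> 1" if "t \<in> ?S" for t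
  proof -
    from that obtain v where v: "t = vec_l2norm (?M *\<^sub>v v)" "v \<in> carrier_vec (dim_col ?M)" "vec_l2norm v \<le> 1"
      by (elim CollectE exE conjE)
    have vc: "v \<in> carrier_vec c" using v(2) by simp
    have t: "t = cmod (v $ i)" unfolding v(1) by (rule n[OF vc])
    have "(cmod (v $ i))\<^sup>2 \<le> (\<Sum>j<dim_vec v. (cmod (v $ j))\<^sup>2)"
      using vc assms by (intro member_le_sum) auto
    then have "cmod (v $ i) \<le> vec_l2norm v" unfolding vec_l2norm_def by (rule real_le_rsqrt)
    then show ?thesis using v t by simp
  qed
  have "vec_l2norm (unit_vec c i) = 1"
    using assms by (simp add: vec_l2norm_def unit_vec_def if_distrib[of cmod] if_distrib[of "\<lambda>x. x\<^sup>2"] sum.delta cong: if_cong)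
  moreover have "vec_l2norm (?M *\<^sub>v unit_vec c i) = 1" using n[of "unit_vec c i"] assms by simp
  ultimately have "1 \<in> ?S" by (intro CollectI exI[of _ "unit_vec c i"]) simp
  then have "1 \<le> Sup ?S" using le by (intro cSup_upper bdd_aboveI)
  then show ?thesis unfolding mat_opnorm_def by linarith
qed

section \<open>Tree-refinement algebras\<close>

locale tree_refinement = cstar_algebra E for E :: "'e cstar" (structure) +
  fixes G :: "nat pair_pre_digraph" and k :: "nat \<Rightarrow> nat" and \<iota> :: "nat \<Rightarrow> complex mat \<Rightarrow> 'e"
  assumes out_tree: "out_tree G" and verts: "pverts G = {..<k 0}"
    and k_pos: "0 < k n" and k_dvd: "k n dvd k (Suc n)"
    and limit: "is_refinement_limit k E \<iota>"
begin

definition ratio :: "nat \<Rightarrow> nat" where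
  "ratio n = k (Suc n) div k n"

lemma k_Suc: "k (Suc n) = k n * ratio n"
  using k_dvd[of n] by (simp add: ratio_def)

lemma ratio_pos: "0 < ratio n"
  using k_pos[of "Suc n"] k_Suc[of n] by (simp add: zero_less_mult_iff)

text \<open>The indices stand in matrix order, so that \<open>R n i j\<close> allows the unit in row
  i and column j. In this order every vertex is related to the root, as stated in
  \<open>R_rt\<close>.\<close>

definition R :: "nat \<Rightarrow> nat \<Rightarrow> nat \<Rightarrow> bool" where
  "R n i j = reach (refined_tree G k n) j i"

lemma rooted_tree: "\<exists>p. rooted_tree (refined_tree G k n) (k n) p"
proof (induction n)
  case 0
  then show ?case using rooted_tree_out_tree[OF out_tree verts] by auto
next
  case (Suc n)
  then obtain p where "rooted_tree (refined_tree G k n) (k n) p" by blast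
  then have "rooted_tree (ampliation (refined_tree G k n) (ratio n)) (k n * ratio n) (p * ratio n)"
    by (rule rooted_tree.rooted_tree_ampliation(1)[OF _ ratio_pos])
  then show ?case unfolding k_Suc by (auto simp: ratio_def)
qed

definition rt :: "nat \<Rightarrow> nat" where
  "rt n = (SOME p. rooted_tree (refined_tree G k n) (k n) p)"

lemma rooted_tree_rt: "rooted_tree (refined_tree G k n) (k n) (rt n)"
  unfolding rt_def using someI_ex[OF rooted_tree] .

lemma R_less: "R n i j \<Longrightarrow> i < k n \<and> j < k n"
  using rooted_tree.reach_less[OF rooted_tree_rt] by (auto simp: R_def)

lemma R_refl: "i < k n \<Longrightarrow> R n i i"
  using rooted_tree.reach_refl[OF rooted_tree_rt] by (auto simp: R_def)

lemma R_trans: "\<lbrakk>R n i j; R n j l\<rbrakk> \<Longrightarrow> R n i l"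
  unfolding R_def using rooted_tree.reach_trans[OF rooted_tree_rt] by blast

lemma R_antisym: "\<lbrakk>R n i j; R n j i\<rbrakk> \<Longrightarrow> i = j"
  unfolding R_def using rooted_tree.reach_antisym[OF rooted_tree_rt] by blast

lemma rt_less: "rt n < k n"
  using rooted_tree.root(1)[OF rooted_tree_rt] .

lemma R_rt: "i < k n \<Longrightarrow> R n i (rt n)"
  unfolding R_def using rooted_tree.reach_root[OF rooted_tree_rt] by blast

lemma R_comparable: "\<lbrakk>R n i j; R n i l\<rbrakk> \<Longrightarrow> R n j l \<or> R n l j"
  unfolding R_def using rooted_tree.reach_comparable[OF rooted_tree_rt] by blast

lemma R_Suc:
  "R (Suc n) v u \<longleftrightarrow> R n (v div ratio n) (u div ratio n) \<and> (v div ratio n = u div ratio n \<longrightarrow> u mod ratio n \<le> v mod ratio n)"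
  unfolding R_def using rooted_tree.rooted_tree_ampliation(2)[OF rooted_tree_rt ratio_pos]
  by (auto simp: ratio_def[symmetric])

text \<open>Values of \<alpha> outside the index range are ignored. Total coefficient functions can
  thus be added and multiplied without carrying matrix dimensions.\<close>

definition lin :: "nat \<Rightarrow> (nat \<times> nat \<Rightarrow> complex) \<Rightarrow> 'e" where
  "lin n \<alpha> = \<iota> n (mat (k n) (k n) \<alpha>)"

lemma hom: "star_hom (mat_cstar (k n)) E (\<iota> n)"
  using limit by (simp add: is_refinement_limit_def cstar_inductive_limit_def)

lemma lin_closed [simp]: "lin n \<alpha> \<in> carrier E"
  unfolding lin_def by (rule star_hom_simps(1)[OF hom]) simp

lemma lin_cong: "(\<And>i j. \<lbrakk>i < k n; j < k n\<rbrakk> \<Longrightarrow> \<alpha> (i, j) = \<beta> (i, j)) \<Longrightarrow> lin n \<alpha> = lin n \<beta>"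
  unfolding lin_def by (rule arg_cong[of _ _ "\<iota> n"], rule eq_matI) auto

lemma lin_add: "lin n \<alpha> \<oplus> lin n \<beta> = lin n (\<lambda>q. \<alpha> q + \<beta> q)"
proof -
  have "mat (k n) (k n) \<alpha> + mat (k n) (k n) \<beta> = mat (k n) (k n) (\<lambda>q. \<alpha> q + \<beta> q)"
    by (rule eq_matI) auto
  then show ?thesis
    unfolding lin_def using star_hom_simps(2)[OF hom, of "mat (k n) (k n) \<alpha>" n "mat (k n) (k n) \<beta>"] by simp
qed

lemma lin_smult: "c \<odot> lin n \<alpha> = lin n (\<lambda>q. c * \<alpha> q)"
proof -
  have "c \<cdot>\<^sub>m mat (k n) (k n) \<alpha> = mat (k n) (k n) (\<lambda>q. c * \<alpha> q)"
    by (rule eq_matI) auto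
  then show ?thesis
    unfolding lin_def using star_hom_simps(4)[OF hom, of "mat (k n) (k n) \<alpha>" n c] by simp
qed

lemma lin_mult: "lin n \<alpha> \<otimes> lin n \<beta> = lin n (\<lambda>(i, j). \<Sum>l<k n. \<alpha> (i, l) * \<beta> (l, j))"
  unfolding lin_def using star_hom_simps(3)[OF hom, of "mat (k n) (k n) \<alpha>" n "mat (k n) (k n) \<beta>"]
  by (simp add: mat_mult_mat)

lemma lin_star: "star E (lin n \<alpha>) = lin n (\<lambda>(i, j). cnj (\<alpha> (j, i)))"
  unfolding lin_def using star_hom_simps(5)[OF hom, of "mat (k n) (k n) \<alpha>" n]
  by (simp add: mat_adjoint_mat)

lemma lin_zero: "lin n (\<lambda>_. 0) = \<zero>"
  using lin_smult[of 0 n "\<lambda>_. 0"] by simp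

lemma nrm_lin: "nrm E (lin n \<alpha>) = mat_opnorm (mat (k n) (k n) \<alpha>)"
proof -
  have "\<forall>x\<in>carrier (mat_cstar (k n)). nrm E (\<iota> n x) = nrm (mat_cstar (k n)) x"
    using limit by (simp add: is_refinement_limit_def cstar_inductive_limit_def)
  then show ?thesis by (simp add: lin_def)
qed

lemma lin_refine:
  "lin n \<alpha> = lin (Suc n) (\<lambda>(i, j). if i mod ratio n = j mod ratio n then \<alpha> (i div ratio n, j div ratio n) else 0)"
proof -
  have "\<forall>x\<in>carrier (mat_cstar (k n)). \<iota> (Suc n) (refinement (k (Suc n) div k n) x) = \<iota> n x"
    using limit by (simp add: is_refinement_limit_def cstar_inductive_limit_def)
  then have "lin n \<alpha> = \<iota> (Suc n) (refinement (ratio n) (mat (k n) (k n) \<alpha>))" by (simp add: lin_def ratio_def)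
  also have "refinement (ratio n) (mat (k n) (k n) \<alpha>) = mat (k (Suc n)) (k (Suc n))
      (\<lambda>(i, j). if i mod ratio n = j mod ratio n then \<alpha> (i div ratio n, j div ratio n) else 0)"
    by (rule eq_matI) (auto simp: refinement_def k_Suc less_mult_imp_div_less)
  finally show ?thesis by (simp add: lin_def)
qed

section \<open>Matrix units in the limit algebra\<close>

definition u :: "nat \<Rightarrow> nat \<Rightarrow> nat \<Rightarrow> 'e" where
  "u n i j = lin n (\<lambda>q. if q = (i, j) then 1 else 0)"

lemma u_closed [simp]: "u n i j \<in> carrier E"
  by (simp add: u_def)

lemma u_star: "star E (u n i j) = u n j i"
  unfolding u_def lin_star by (rule lin_cong) auto

text \<open>Only the inner index must be in range, because an outer index out of range makes both
  sides zero.\<close>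

lemma u_mult: "j < k n \<Longrightarrow> u n i j \<otimes> u n l q = (if j = l then u n i q else \<zero>)"
  unfolding u_def lin_mult lin_zero[of n, symmetric]
  by (auto intro!: lin_cong simp: if_distrib[of "\<lambda>x. x * _"] sum.delta cong: if_cong)

lemma u_lin_u:
  "\<lbrakk>i < k n; j < k n\<rbrakk> \<Longrightarrow> u n a i \<otimes> (lin n \<alpha> \<otimes> u n j b) = \<alpha> (i, j) \<odot> u n a b"
  unfolding u_def lin_mult lin_smult
  by (auto intro!: lin_cong simp: if_distrib[of "\<lambda>x. x * _"] if_distrib[of "\<lambda>x. _ * x"] sum.delta cong: if_cong)

lemma lin_sum:
  assumes "finite F" "F \<subseteq> {..<k n} \<times> {..<k n}"
  shows "lin n (\<lambda>q. if q \<in> F then \<alpha> q else 0) = (\<Oplus>q\<in>F. \<alpha> q \<odot> u n (fst q) (snd q))"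
  using assms
proof (induction F rule: finite_induct)
  case (insert x F)
  have "lin n (\<lambda>q. if q \<in> insert x F then \<alpha> q else 0)
      = lin n (\<lambda>q. \<alpha> x * (if q = x then 1 else 0) + (if q \<in> F then \<alpha> q else 0))"
    using insert.hyps by (intro lin_cong) auto
  also have "\<dots> = \<alpha> x \<odot> u n (fst x) (snd x) \<oplus> lin n (\<lambda>q. if q \<in> F then \<alpha> q else 0)"
    by (simp add: u_def lin_smult lin_add)
  also have "\<dots> = \<alpha> x \<odot> u n (fst x) (snd x) \<oplus> (\<Oplus>q\<in>F. \<alpha> q \<odot> u n (fst q) (snd q))"
    using insert by simp
  finally show ?case using insert.hyps by simp
qed (simp add: lin_zero)

lemma lin_eq_sum: "lin n \<alpha> = (\<Oplus>q\<in>{..<k n} \<times> {..<k n}. \<alpha> q \<odot> u n (fst q) (snd q))"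
  using lin_sum[of "{..<k n} \<times> {..<k n}" n \<alpha>] lin_cong[of n \<alpha> "\<lambda>q. if q \<in> {..<k n} \<times> {..<k n} then \<alpha> q else 0"]
  by simp

lemma u_diag_nrm: assumes "i < k n" shows "nrm E (u n i i) = 1"
proof -
  have "nrm E (u n i i) \<noteq> 0" unfolding u_def nrm_lin by (rule mat_opnorm_unit[OF assms])
  moreover have "nrm E (u n i i) = (nrm E (u n i i))\<^sup>2"
    using cstar_identity[of "u n i i"] assms by (simp add: u_star u_mult)
  ultimately show ?thesis by (simp add: power2_eq_square)
qed

lemma u_nrm: assumes "i < k n" "j < k n" shows "nrm E (u n i j) = 1"
proof -
  have "(nrm E (u n i j))\<^sup>2 = 1"
    using cstar_identity[of "u n i j"] assms by (simp add: u_star u_mult u_diag_nrm)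
  then show ?thesis using nrm_nonneg[of "u n i j"] by (simp add: power2_eq_1_iff)
qed

lemma u_refine:
  assumes "i < k n" "j < k n"
  shows "u n i j = (\<Oplus>q\<in>(\<lambda>s. (i * ratio n + s, j * ratio n + s)) ` {..<ratio n}. u (Suc n) (fst q) (snd q))"
proof -
  let ?F = "(\<lambda>s. (i * ratio n + s, j * ratio n + s)) ` {..<ratio n}"
  have lt: "a * ratio n + s < k (Suc n)" if "a < k n" "s < ratio n" for a s
  proof -
    have "a * ratio n + s < (a + 1) * ratio n" using that by simp
    also have "\<dots> \<le> k n * ratio n" using that by (intro mult_right_mono) auto
    finally show ?thesis by (simp add: k_Suc)
  qed
  have mem: "(a, b) \<in> ?F \<longleftrightarrow> a mod ratio n = b mod ratio n \<and> a div ratio n = i \<and> b div ratio n = j" for a b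
  proof
    assume "a mod ratio n = b mod ratio n \<and> a div ratio n = i \<and> b div ratio n = j"
    then have "(a, b) = (i * ratio n + a mod ratio n, j * ratio n + a mod ratio n)"
      using div_mult_mod_eq[of a "ratio n"] div_mult_mod_eq[of b "ratio n"] by simp
    then show "(a, b) \<in> ?F" using ratio_pos[of n] by (intro image_eqI[of _ _ "a mod ratio n"]) auto
  qed auto
  have "u n i j = lin (Suc n) (\<lambda>q. if q \<in> ?F then 1 else 0)"
    unfolding u_def by (subst lin_refine, rule lin_cong) (simp only: mem, auto)
  also have "\<dots> = (\<Oplus>q\<in>?F. 1 \<odot> u (Suc n) (fst q) (snd q))"
    using lt assms by (intro lin_sum) auto
  finally show ?thesis by simp
qed

lemma nrm_lin_le:
  assumes "0 \<le> C" "\<And>\<beta>. sqrt (\<Sum>i<k n. (cmod (\<Sum>j<k n. \<alpha> (i, j) * \<beta> j))\<^sup>2) \<le> C * sqrt (\<Sum>j<k n. (cmod (\<beta> j))\<^sup>2)"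
  shows "nrm E (lin n \<alpha>) \<le> C"
  unfolding nrm_lin using assms by (rule mat_opnorm_le)

section \<open>The levels of the tree-refinement algebra and their closure\<close>

definition level :: "nat \<Rightarrow> 'e set" where
  "level n = {lin n \<alpha> |\<alpha>. \<forall>i j. \<alpha> (i, j) \<noteq> 0 \<longrightarrow> R n i j}"

definition alg :: "'e set" where
  "alg = tree_refinement_algebra G k E \<iota>"

lemma alg_eq: "alg = cstar_closure E (\<Union>n. level n)"
proof -
  have "\<iota> n ` quiver_algebra (refined_tree G k n) (k n) = level n" for n
  proof
    show "\<iota> n ` quiver_algebra (refined_tree G k n) (k n) \<subseteq> level n"
    proof
      fix x assume "x \<in> \<iota> n ` quiver_algebra (refined_tree G k n) (k n)"
      then obtain a where "x = \<iota> n (mat (k n) (k n) (\<lambda>(i, j). if R n i j then a i j else 0))"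
        unfolding quiver_algebra_def R_def reach_def by auto
      then show "x \<in> level n" unfolding level_def lin_def
        by (intro CollectI exI[of _ "\<lambda>(i, j). if R n i j then a i j else 0"]) auto
    qed
    show "level n \<subseteq> \<iota> n ` quiver_algebra (refined_tree G k n) (k n)"
    proof
      fix x assume "x \<in> level n"
      then obtain \<alpha> where a: "x = lin n \<alpha>" "\<forall>i j. \<alpha> (i, j) \<noteq> 0 \<longrightarrow> R n i j" unfolding level_def by auto
      have "x = lin n (\<lambda>(i, j). if R n i j then \<alpha> (i, j) else 0)"
        unfolding a(1) using a(2) by (intro lin_cong) auto
      then show "x \<in> \<iota> n ` quiver_algebra (refined_tree G k n) (k n)"
        unfolding lin_def quiver_algebra_def R_def reach_def
        by (intro image_eqI[OF _ rangeI[of _ "\<lambda>i j. \<alpha> (i, j)"]])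
    qed
  qed
  then show ?thesis by (simp add: alg_def tree_refinement_algebra_def)
qed

lemma dense: "cstar_closure E (\<Union>n. range (lin n)) = carrier E"
proof -
  have "\<iota> n ` carrier_mat (k n) (k n) = range (lin n)" for n
  proof -
    have "M = mat (k n) (k n) (\<lambda>q. M $$ q)" if "M \<in> carrier_mat (k n) (k n)" for M
      using that by (intro eq_matI) auto
    then have "\<iota> n M = lin n (\<lambda>q. M $$ q)" if "M \<in> carrier_mat (k n) (k n)" for M
      using that unfolding lin_def by (intro arg_cong[of _ _ "\<iota> n"])
    moreover have "mat (k n) (k n) \<alpha> \<in> carrier_mat (k n) (k n)" for \<alpha> :: "nat \<times> nat \<Rightarrow> complex" by simp
    ultimately show ?thesis unfolding lin_def image_def by blast
  qed
  moreover have "cstar_closure E (\<Union>n. \<iota> n ` carrier (mat_cstar (k n))) = carrier E"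
    using limit by (simp only: is_refinement_limit_def cstar_inductive_limit_def)
  ultimately show ?thesis by simp
qed

text \<open>Refinement pairs equal positions in two blocks, and for these the lexicographic order of
  the ampliation reduces to the order of the blocks.\<close>

lemma level_Suc: "level n \<subseteq> level (Suc n)"
proof
  fix x assume "x \<in> level n"
  then obtain \<alpha> where a: "x = lin n \<alpha>" "\<forall>i j. \<alpha> (i, j) \<noteq> 0 \<longrightarrow> R n i j" unfolding level_def by auto
  show "x \<in> level (Suc n)"
    unfolding level_def a(1) lin_refine[of n]
    using a(2) by (intro CollectI exI conjI refl) (auto simp: R_Suc split: if_splits)
qed

lemma level_mono: "m \<le> n \<Longrightarrow> level m \<subseteq> level n"
  using lift_Suc_mono_le[of level] level_Suc by blast

lemma level_carrier: "level n \<subseteq> carrier E"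
  by (auto simp: level_def)

lemma level_alg: "level n \<subseteq> alg"
  unfolding alg_eq using subset_closure[of "\<Union>n. level n"] level_carrier by blast

lemma alg_carrier: "alg \<subseteq> carrier E"
  unfolding alg_eq by (rule closure_subset)

lemma u_level: "R n i j \<Longrightarrow> u n i j \<in> level n"
  unfolding level_def u_def by (intro CollectI exI conjI refl) (auto split: if_splits)

lemma level_add: "\<lbrakk>x \<in> level n; y \<in> level n\<rbrakk> \<Longrightarrow> x \<oplus> y \<in> level n"
proof -
  assume "x \<in> level n" "y \<in> level n"
  then obtain \<alpha> \<beta> where a: "x = lin n \<alpha>" "\<forall>i j. \<alpha> (i, j) \<noteq> 0 \<longrightarrow> R n i j"
    and b: "y = lin n \<beta>" "\<forall>i j. \<beta> (i, j) \<noteq> 0 \<longrightarrow> R n i j"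
    unfolding level_def by auto
  have "R n i j" if "\<alpha> (i, j) + \<beta> (i, j) \<noteq> 0" for i j
  proof -
    have "\<alpha> (i, j) \<noteq> 0 \<or> \<beta> (i, j) \<noteq> 0" using that by auto
    then show ?thesis using a(2) b(2) by blast
  qed
  then show ?thesis unfolding level_def a(1) b(1) lin_add
    by (intro CollectI exI[of _ "\<lambda>q. \<alpha> q + \<beta> q"] conjI refl allI impI)
qed

lemma level_smult: "x \<in> level n \<Longrightarrow> c \<odot> x \<in> level n"
  unfolding level_def by (force simp: lin_smult)

lemma level_mult: "\<lbrakk>x \<in> level n; y \<in> level n\<rbrakk> \<Longrightarrow> x \<otimes> y \<in> level n"
proof -
  assume "x \<in> level n" "y \<in> level n"
  then obtain \<alpha> \<beta> where a: "x = lin n \<alpha>" "\<forall>i j. \<alpha> (i, j) \<noteq> 0 \<longrightarrow> R n i j" and b: "y = lin n \<beta>" "\<forall>i j. \<beta> (i, j) \<noteq> 0 \<longrightarrow> R n i j"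
    unfolding level_def by auto
  have "R n i j" if g: "(\<Sum>l<k n. \<alpha> (i, l) * \<beta> (l, j)) \<noteq> 0" for i j
  proof -
    obtain l where "\<alpha> (i, l) * \<beta> (l, j) \<noteq> 0" using sum.not_neutral_contains_not_neutral[OF g] by blast
    then have "R n i l" "R n l j" using a(2) b(2) by auto
    then show ?thesis by (rule R_trans)
  qed
  then show ?thesis unfolding level_def a(1) b(1) lin_mult
    by (intro CollectI exI[of _ "\<lambda>(i, j). \<Sum>l<k n. \<alpha> (i, l) * \<beta> (l, j)"] conjI refl allI impI) simp
qed

lemma operator_algebra_alg: "operator_algebra E alg"
  unfolding alg_eq
proof (rule operator_algebra_closure)
  have *: "\<exists>n. x \<in> level n \<and> y \<in> level n" if "x \<in> (\<Union>n. level n)" "y \<in> (\<Union>n. level n)" for x y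
  proof -
    obtain m n where "x \<in> level m" "y \<in> level n" using \<open>x \<in> _\<close> \<open>y \<in> _\<close> by auto
    then show ?thesis using level_mono[of m "max m n"] level_mono[of n "max m n"] by (intro exI[of _ "max m n"]) auto
  qed
  show "(\<Union>n. level n) \<subseteq> carrier E" using level_carrier by blast
  have "lin 0 (\<lambda>_. 0) \<in> level 0" unfolding level_def by blast
  then show "\<zero> \<in> (\<Union>n. level n)" unfolding lin_zero by blast
  show "x \<oplus> y \<in> (\<Union>n. level n)" if "x \<in> (\<Union>n. level n)" "y \<in> (\<Union>n. level n)" for x y
    using *[OF that] level_add by blast
  show "x \<otimes> y \<in> (\<Union>n. level n)" if "x \<in> (\<Union>n. level n)" "y \<in> (\<Union>n. level n)" for x y
    using *[OF that] level_mult by blast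
  show "c \<odot> x \<in> (\<Union>n. level n)" if "x \<in> (\<Union>n. level n)" for x c
    using that level_smult by blast
qed

end

section \<open>Extending a contractive relation to norm closures\<close>

context cstar_algebra
begin

lemma conv_Cauchy:
  assumes "conv u x" "e > 0" shows "\<exists>N. \<forall>m\<ge>N. \<forall>n\<ge>N. nrm A (u m \<ominus> u n) < e"
proof -
  have c: "u n \<in> carrier A" "x \<in> carrier A" for n using assms(1) by (auto simp: conv_def)
  have "(\<lambda>n. nrm A (u n \<ominus> x)) \<longlonglongrightarrow> 0" using assms(1) by (simp add: conv_def)
  then have "eventually (\<lambda>n. nrm A (u n \<ominus> x) < e / 2) sequentially" using assms(2) by (intro order_tendstoD) auto
  then obtain N where N: "\<And>n. n \<ge> N \<Longrightarrow> nrm A (u n \<ominus> x) < e / 2" by (auto simp: eventually_sequentially)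
  have "nrm A (u m \<ominus> u n) < e" if "m \<ge> N" "n \<ge> N" for m n
    using nrm_dist_triangle[OF c(1) c(2) c(1), of m n] N[OF that(1)] N[OF that(2)]
      nrm_minus_commute[OF c(2) c(1), of n] by simp
  then show ?thesis by blast
qed

lemma finsum_mem:
  assumes "finite F" "\<zero> \<in> S" "\<And>x y. \<lbrakk>x \<in> S; y \<in> S\<rbrakk> \<Longrightarrow> x \<oplus> y \<in> S" "S \<subseteq> carrier A" "h ` F \<subseteq> S"
  shows "(\<Oplus>q\<in>F. h q) \<in> S"
  using assms(1,5)
proof (induction F rule: finite_induct)
  case (insert x F)
  have "h \<in> insert x F \<rightarrow> carrier A" using insert.prems assms(4) by auto
  then have "(\<Oplus>q\<in>insert x F. h q) = h x \<oplus> (\<Oplus>q\<in>F. h q)"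
    using insert.hyps by (intro M.finsum_insert) auto
  then show ?case using insert assms(3) by simp
qed (simp add: assms)

end

text \<open>A relation is used because one element of B can arise from many *-polynomials. Applied
  to differences, the norm bound makes the relation single-valued and lets it pass to
  limits.\<close>

locale star_graph = B: cstar_algebra B + E: cstar_algebra E for B :: "'b cstar" and E :: "'e cstar" +
  fixes \<Gamma> :: "('b \<times> 'e) set"
  assumes graph_carrier: "\<Gamma> \<subseteq> carrier B \<times> carrier E"
    and graph_add: "\<lbrakk>(b, x) \<in> \<Gamma>; (c, y) \<in> \<Gamma>\<rbrakk> \<Longrightarrow> (b \<oplus>\<^bsub>B\<^esub> c, x \<oplus>\<^bsub>E\<^esub> y) \<in> \<Gamma>"
    and graph_mult: "\<lbrakk>(b, x) \<in> \<Gamma>; (c, y) \<in> \<Gamma>\<rbrakk> \<Longrightarrow> (b \<otimes>\<^bsub>B\<^esub> c, x \<otimes>\<^bsub>E\<^esub> y) \<in> \<Gamma>"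
    and graph_smult: "(b, x) \<in> \<Gamma> \<Longrightarrow> (a \<odot>\<^bsub>B\<^esub> b, a \<odot>\<^bsub>E\<^esub> x) \<in> \<Gamma>"
    and graph_star: "(b, x) \<in> \<Gamma> \<Longrightarrow> (star B b, star E x) \<in> \<Gamma>"
    and graph_bound: "(b, x) \<in> \<Gamma> \<Longrightarrow> nrm E x \<le> nrm B b"
begin

definition lim :: "'b \<Rightarrow> 'e \<Rightarrow> bool" where
  "lim b x \<longleftrightarrow> (\<exists>c y. (\<forall>n::nat. (c n, y n) \<in> \<Gamma>) \<and> B.conv c b \<and> E.conv y x)"

lemma limI: "\<lbrakk>\<And>n::nat. (c n, y n) \<in> \<Gamma>; B.conv c b; E.conv y x\<rbrakk> \<Longrightarrow> lim b x"
  unfolding lim_def by blast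

lemma limE:
  assumes "lim b x"
  obtains c y where "\<And>n::nat. (c n, y n) \<in> \<Gamma>" "B.conv c b" "E.conv y x"
  using assms unfolding lim_def by blast

lemma lim_carrier: "lim b x \<Longrightarrow> b \<in> carrier B \<and> x \<in> carrier E"
  unfolding lim_def B.conv_def E.conv_def by blast

lemma lim_add: assumes "lim b x" "lim c y" shows "lim (b \<oplus>\<^bsub>B\<^esub> c) (x \<oplus>\<^bsub>E\<^esub> y)"
proof -
  obtain b' x' where 1: "\<And>n::nat. (b' n, x' n) \<in> \<Gamma>" "B.conv b' b" "E.conv x' x" using limE[OF assms(1)] by blast
  obtain c' y' where 2: "\<And>n::nat. (c' n, y' n) \<in> \<Gamma>" "B.conv c' c" "E.conv y' y" using limE[OF assms(2)] by blast
  show ?thesis by (rule limI[OF graph_add[OF 1(1) 2(1)] B.conv_add[OF 1(2) 2(2)] E.conv_add[OF 1(3) 2(3)]])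
qed

lemma lim_mult: assumes "lim b x" "lim c y" shows "lim (b \<otimes>\<^bsub>B\<^esub> c) (x \<otimes>\<^bsub>E\<^esub> y)"
proof -
  obtain b' x' where 1: "\<And>n::nat. (b' n, x' n) \<in> \<Gamma>" "B.conv b' b" "E.conv x' x" using limE[OF assms(1)] by blast
  obtain c' y' where 2: "\<And>n::nat. (c' n, y' n) \<in> \<Gamma>" "B.conv c' c" "E.conv y' y" using limE[OF assms(2)] by blast
  show ?thesis by (rule limI[OF graph_mult[OF 1(1) 2(1)] B.conv_mult[OF 1(2) 2(2)] E.conv_mult[OF 1(3) 2(3)]])
qed

lemma lim_smult: assumes "lim b x" shows "lim (a \<odot>\<^bsub>B\<^esub> b) (a \<odot>\<^bsub>E\<^esub> x)"
proof -
  obtain b' x' where 1: "\<And>n::nat. (b' n, x' n) \<in> \<Gamma>" "B.conv b' b" "E.conv x' x" using limE[OF assms(1)] by blast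
  show ?thesis by (rule limI[OF graph_smult[OF 1(1)] B.conv_smult[OF 1(2)] E.conv_smult[OF 1(3)]])
qed

lemma lim_star: assumes "lim b x" shows "lim (star B b) (star E x)"
proof -
  obtain b' x' where 1: "\<And>n::nat. (b' n, x' n) \<in> \<Gamma>" "B.conv b' b" "E.conv x' x" using limE[OF assms(1)] by blast
  show ?thesis by (rule limI[OF graph_star[OF 1(1)] B.conv_star[OF 1(2)] E.conv_star[OF 1(3)]])
qed

lemma graph_minus:
  assumes "(b, x) \<in> \<Gamma>" "(c, y) \<in> \<Gamma>" shows "(b \<ominus>\<^bsub>B\<^esub> c, x \<ominus>\<^bsub>E\<^esub> y) \<in> \<Gamma>"
proof -
  have "b \<in> carrier B" "c \<in> carrier B" "x \<in> carrier E" "y \<in> carrier E" using assms graph_carrier by auto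
  then show ?thesis
    using graph_add[OF assms(1) graph_smult[OF assms(2), of "- 1"]] by (simp add: B.minus_smult E.minus_smult)
qed

lemma lim_bound: assumes "lim b x" shows "nrm E x \<le> nrm B b"
proof -
  obtain b' x' where 1: "\<And>n::nat. (b' n, x' n) \<in> \<Gamma>" "B.conv b' b" "E.conv x' x" using limE[OF assms(1)] by blast
  show ?thesis by (rule LIMSEQ_le[OF E.conv_nrm[OF 1(3)] B.conv_nrm[OF 1(2)]]) (use graph_bound[OF 1(1)] in blast)
qed

lemma lim_unique: assumes "lim b x" "lim b y" shows "x = y"
proof -
  have c: "b \<in> carrier B" "x \<in> carrier E" "y \<in> carrier E" using assms lim_carrier by auto
  have "lim (b \<oplus>\<^bsub>B\<^esub> (- 1) \<odot>\<^bsub>B\<^esub> b) (x \<oplus>\<^bsub>E\<^esub> (- 1) \<odot>\<^bsub>E\<^esub> y)"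
    by (intro lim_add lim_smult assms)
  then have "nrm E (x \<ominus>\<^bsub>E\<^esub> y) \<le> 0"
    using lim_bound c by (fastforce simp: B.minus_smult[symmetric] E.minus_smult[symmetric])
  then have "nrm E (x \<ominus>\<^bsub>E\<^esub> y) = 0" using E.nrm_nonneg[of "x \<ominus>\<^bsub>E\<^esub> y"] c by simp
  then show ?thesis using c by (simp add: E.nrm_eq_0 E.minus_eq_zero_iff)
qed

text \<open>If arguments converge in B, their values are Cauchy in E by the bound on differences,
  and E is complete.\<close>

lemma lim_total:
  assumes b: "b \<in> cstar_closure B (fst ` \<Gamma>)" shows "\<exists>x. lim b x"
proof -
  have sub: "fst ` \<Gamma> \<subseteq> carrier B" using graph_carrier by auto
  obtain c where c: "\<And>n. c n \<in> fst ` \<Gamma>" "B.conv c b" using B.closure_seq[OF b sub] by blast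
  have "\<exists>y. (c n, y) \<in> \<Gamma>" for n using c(1)[of n] by auto
  then obtain y where y: "\<And>n. (c n, y n) \<in> \<Gamma>" by metis
  have "\<forall>e>0. \<exists>N. \<forall>m\<ge>N. \<forall>n\<ge>N. nrm E (y m \<ominus>\<^bsub>E\<^esub> y n) < e"
  proof (intro allI impI)
    fix e :: real assume "e > 0"
    then obtain N where N: "\<forall>m\<ge>N. \<forall>n\<ge>N. nrm B (c m \<ominus>\<^bsub>B\<^esub> c n) < e" using B.conv_Cauchy[OF c(2)] by blast
    have "nrm E (y m \<ominus>\<^bsub>E\<^esub> y n) \<le> nrm B (c m \<ominus>\<^bsub>B\<^esub> c n)" for m n
      by (rule graph_bound[OF graph_minus[OF y y]])
    then show "\<exists>N. \<forall>m\<ge>N. \<forall>n\<ge>N. nrm E (y m \<ominus>\<^bsub>E\<^esub> y n) < e" using N by (meson le_less_trans)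
  qed
  moreover have yc: "y n \<in> carrier E" for n using y[of n] graph_carrier by auto
  ultimately obtain x where "x \<in> carrier E" "(\<lambda>n. nrm E (y n \<ominus>\<^bsub>E\<^esub> x)) \<longlonglongrightarrow> 0"
    using E.nrm_complete[of y] by blast
  then have "E.conv y x" using yc by (simp add: E.conv_def)
  then show ?thesis using limI[OF y c(2)] by blast
qed

lemma extension:
  assumes dense: "carrier B \<subseteq> cstar_closure B (fst ` \<Gamma>)"
  shows "\<exists>\<pi>. star_hom B E \<pi> \<and> (\<forall>b x. lim b x \<longrightarrow> \<pi> b = x)"
proof -
  define \<pi> where "\<pi> b = (SOME x. lim b x)" for b
  have l: "lim b (\<pi> b)" if "b \<in> carrier B" for b
    unfolding \<pi>_def by (rule someI_ex[OF lim_total[OF subsetD[OF dense that]]])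
  have eq: "\<pi> b = x" if "lim b x" for b x
    using lim_unique[OF l that] lim_carrier[OF that] by blast
  have "star_hom B E \<pi>"
    unfolding star_hom_def alg_hom_def
  proof (intro conjI ballI allI)
    show "\<pi> ` carrier B \<subseteq> carrier E" using l lim_carrier by blast
    fix b assume b: "b \<in> carrier B"
    show "\<pi> (star B b) = star E (\<pi> b)" by (rule eq[OF lim_star[OF l[OF b]]])
    show "\<pi> (a \<odot>\<^bsub>B\<^esub> b) = a \<odot>\<^bsub>E\<^esub> \<pi> b" for a by (rule eq[OF lim_smult[OF l[OF b]]])
    fix c assume c: "c \<in> carrier B"
    show "\<pi> (b \<oplus>\<^bsub>B\<^esub> c) = \<pi> b \<oplus>\<^bsub>E\<^esub> \<pi> c" by (rule eq[OF lim_add[OF l[OF b] l[OF c]]])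
    show "\<pi> (b \<otimes>\<^bsub>B\<^esub> c) = \<pi> b \<otimes>\<^bsub>E\<^esub> \<pi> c" by (rule eq[OF lim_mult[OF l[OF b] l[OF c]]])
  qed
  then show ?thesis using eq by blast
qed

end

section \<open>The semi-Dirichlet inclusion and the failure of the Dirichlet property\<close>

context tree_refinement
begin

text \<open>A nonzero entry (j, l) of x^* y requires a common row i with R n i j and R n i l. Hence
  j and l are comparable, and the entry belongs to the algebra or to its adjoint.\<close>

lemma level_star_mult:
  assumes "x \<in> level n" "y \<in> level n"
  shows "star E x \<otimes> y \<in> plus_adjoint E (level n)"
proof -
  obtain \<alpha> where a: "x = lin n \<alpha>" "\<And>i j. \<alpha> (i, j) \<noteq> 0 \<Longrightarrow> R n i j" using assms(1) unfolding level_def by auto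
  obtain \<beta> where b: "y = lin n \<beta>" "\<And>i j. \<beta> (i, j) \<noteq> 0 \<Longrightarrow> R n i j" using assms(2) unfolding level_def by auto
  define \<gamma> where "\<gamma> j l = (\<Sum>i<k n. cnj (\<alpha> (i, j)) * \<beta> (i, l))" for j l
  have comp: "R n j l \<or> R n l j" if g: "\<gamma> j l \<noteq> 0" for j l
  proof -
    obtain i where "cnj (\<alpha> (i, j)) * \<beta> (i, l) \<noteq> 0"
      using sum.not_neutral_contains_not_neutral[OF g[unfolded \<gamma>_def]] by blast
    then have "R n i j" "R n i l" using a(2) b(2) by auto
    then show ?thesis by (rule R_comparable)
  qed
  \<comment> \<open>Entries with R n j l, the diagonal among them, go to \<open>?a\<close>. The
    others go to \<open>?b\<close>, transposed and conjugated because \<open>?b\<close> enters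
    through its adjoint.\<close>
  let ?a = "\<lambda>(j, l). if R n j l then \<gamma> j l else 0"
  let ?b = "\<lambda>(l, j). if R n j l then 0 else cnj (\<gamma> j l)"
  have "star E x \<otimes> y = lin n (\<lambda>(j, l). \<gamma> j l)"
    unfolding a(1) b(1) lin_star lin_mult \<gamma>_def by (rule lin_cong) simp
  also have "\<dots> = lin n ?a \<oplus> star E (lin n ?b)"
    unfolding lin_star lin_add by (rule lin_cong) auto
  finally have "star E x \<otimes> y = lin n ?a \<oplus> star E (lin n ?b)" .
  moreover have "lin n ?a \<in> level n"
    unfolding level_def by (intro CollectI exI[of _ ?a] conjI refl allI impI) (auto split: if_splits)
  moreover have "lin n ?b \<in> level n"
    unfolding level_def using comp
    by (intro CollectI exI[of _ ?b] conjI refl allI impI) (force split: if_splits)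
  ultimately show ?thesis unfolding plus_adjoint_def by blast
qed

lemma level_common:
  assumes "x \<in> (\<Union>n. level n)" "y \<in> (\<Union>n. level n)" shows "\<exists>n. x \<in> level n \<and> y \<in> level n"
proof -
  obtain m n where "x \<in> level m" "y \<in> level n" using assms by auto
  then show ?thesis using level_mono[of m "max m n"] level_mono[of n "max m n"] by (intro exI[of _ "max m n"]) auto
qed

lemma union_level_carrier: "(\<Union>n. level n) \<subseteq> carrier E"
  using level_carrier by blast

lemma alg_star_mult:
  assumes "x \<in> alg" "y \<in> alg"
  shows "star E x \<otimes> y \<in> cstar_closure E (plus_adjoint E alg)"
proof -
  obtain v where v: "\<And>n. v n \<in> (\<Union>n. level n)" "conv v x"
    using closure_seq[OF assms(1)[unfolded alg_eq] union_level_carrier] by blast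
  obtain w where w: "\<And>n. w n \<in> (\<Union>n. level n)" "conv w y"
    using closure_seq[OF assms(2)[unfolded alg_eq] union_level_carrier] by blast
  show ?thesis
  proof (rule conv_closure[OF conv_mult[OF conv_star[OF v(2)] w(2)]])
    fix n
    obtain m where "v n \<in> level m" "w n \<in> level m" using level_common[OF v(1) w(1)] by blast
    then have "star E (v n) \<otimes> w n \<in> plus_adjoint E (level m)" by (rule level_star_mult)
    then show "star E (v n) \<otimes> w n \<in> plus_adjoint E alg"
      unfolding plus_adjoint_def using level_alg by blast
  qed
qed

lemma alg_closed:
  "\<zero> \<in> alg" "\<lbrakk>x \<in> alg; y \<in> alg\<rbrakk> \<Longrightarrow> x \<oplus> y \<in> alg" "\<lbrakk>x \<in> alg; y \<in> alg\<rbrakk> \<Longrightarrow> x \<otimes> y \<in> alg" "x \<in> alg \<Longrightarrow> c \<odot> x \<in> alg"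
  using operator_algebra_alg unfolding operator_algebra_def by auto

lemma u_alg: "R n a b \<Longrightarrow> u n a b \<in> alg"
  using u_level level_alg by blast

lemma alg_hom_zero:
  assumes "cstar_algebra B" "alg_hom E alg B i" shows "i \<zero> = \<zero>\<^bsub>B\<^esub>"
proof -
  interpret B: cstar_algebra B by fact
  show ?thesis
    using alg_hom_simps(4)[OF assms(2) alg_closed(1), of 0] alg_hom_simps(1)[OF assms(2) alg_closed(1)] by simp
qed

lemma alg_hom_finsum:
  assumes B: "cstar_algebra B" and i: "alg_hom E alg B i" and "finite F" "h ` F \<subseteq> alg"
  shows "i (\<Oplus>a\<in>F. h a) = (\<Oplus>\<^bsub>B\<^esub>a\<in>F. i (h a))"
proof -
  interpret B: cstar_algebra B by fact
  note i_simps = alg_hom_simps[OF i]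
  show ?thesis
    using assms(3,4)
  proof (induction F rule: finite_induct)
    case (insert x F)
    have s: "(\<Oplus>a\<in>F. h a) \<in> alg"
      by (rule finsum_mem) (use insert alg_closed alg_carrier in auto)
    have "(\<Oplus>a\<in>insert x F. h a) = h x \<oplus> (\<Oplus>a\<in>F. h a)"
      using insert alg_carrier by (intro M.finsum_insert) auto
    then have "i (\<Oplus>a\<in>insert x F. h a) = i (h x) \<oplus>\<^bsub>B\<^esub> (\<Oplus>\<^bsub>B\<^esub>a\<in>F. i (h a))"
      using insert i_simps(2)[OF _ s] by simp
    also have "\<dots> = (\<Oplus>\<^bsub>B\<^esub>a\<in>insert x F. i (h a))"
      using insert i_simps(1) by (intro B.M.finsum_insert[symmetric]) auto
    finally show ?case .
  qed (simp add: alg_hom_zero[OF B i])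
qed

text \<open>The column of units at the root lies in the algebra, and every matrix unit is the
  product of one entry of this column with the adjoint of another.\<close>

lemma generated: "cstar_generated E alg = carrier E"
proof
  have "operator_algebra E (carrier E)"
    unfolding operator_algebra_def using subset_closure[of "carrier E"] closure_subset[of "carrier E"] by auto
  then show "cstar_generated E alg \<subseteq> carrier E"
    unfolding cstar_generated_def using alg_carrier star_closed by (intro Inter_lower) auto
  show "carrier E \<subseteq> cstar_generated E alg"
    unfolding cstar_generated_def
  proof (rule Inter_greatest)
    fix S assume "S \<in> {S. operator_algebra E S \<and> star E ` S \<subseteq> S \<and> alg \<subseteq> S}"
    then have S: "S \<subseteq> carrier E" "\<zero> \<in> S" "\<And>x y. \<lbrakk>x \<in> S; y \<in> S\<rbrakk> \<Longrightarrow> x \<oplus> y \<in> S"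
      "\<And>x y. \<lbrakk>x \<in> S; y \<in> S\<rbrakk> \<Longrightarrow> x \<otimes> y \<in> S" "\<And>c x. x \<in> S \<Longrightarrow> c \<odot> x \<in> S" "cstar_closure E S = S"
      "\<And>x. x \<in> S \<Longrightarrow> star E x \<in> S" "alg \<subseteq> S"
      unfolding operator_algebra_def by auto
    have u: "u n i j \<in> S" if "i < k n" "j < k n" for n i j
    proof -
      have rt: "u n a (rt n) \<in> S" if "a < k n" for a
        by (rule subsetD[OF S(8) subsetD[OF level_alg u_level[OF R_rt[OF that]]]])
      have "u n i (rt n) \<otimes> star E (u n j (rt n)) \<in> S"
        by (intro S(4) S(7) rt that)
      then show ?thesis using rt_less by (simp add: u_star u_mult)
    qed
    have "lin n \<alpha> \<in> S" for n \<alpha>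
      unfolding lin_eq_sum by (rule finsum_mem) (use S(1-3,5) u in auto)
    then have "cstar_closure E (\<Union>n. range (lin n)) \<subseteq> cstar_closure E S" by (intro closure_mono) blast
    then show "carrier E \<subseteq> S" unfolding dense S(6) .
  qed
qed

lemma cover: "cstar_cover E alg E (\<lambda>x. x)"
proof -
  have "alg_hom E alg E (\<lambda>x. x)" unfolding alg_hom_def using alg_carrier by auto
  then show ?thesis
    unfolding cstar_cover_def completely_isometric_def using generated cstar_algebra_axioms by simp
qed

text \<open>The envelope C is arbitrary and known only through its universal property. Applied to
  the cover E, that property yields \<pi>, whose values on the algebra have known norms. The
  distance estimate therefore has to be made with elements of the algebra and their adjoints, and
  the root column provides enough of them.\<close>

lemma not_dirichlet:
  assumes inc: "i < k 0" "j < k 0" "\<not> R 0 i j" "\<not> R 0 j i"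
  shows "\<not> dirichlet E alg"
proof
  assume "dirichlet E alg"
  then obtain C f where env: "cstar_envelope E alg C f"
    and D: "cstar_closure C (plus_adjoint C (f ` alg)) = carrier C"
    unfolding dirichlet_def by blast
  have C: "cstar_algebra C" and f: "alg_hom E alg C f" "completely_isometric E alg C f"
    using env unfolding cstar_envelope_def cstar_cover_def by auto
  interpret C: cstar_algebra C by fact
  obtain \<pi> where \<pi>: "star_hom E C \<pi>" "\<And>x. x \<in> alg \<Longrightarrow> \<pi> x = f x"
    using env cover unfolding cstar_envelope_def by blast
  note \<pi>_simps = star_hom_simps[OF \<pi>(1)]
  have iso: "nrm C (f x) = nrm E x" if "x \<in> alg" for x
    by (rule completely_isometric_nrm[OF cstar_algebra_axioms C f(2,1) alg_carrier that])
  \<comment> \<open>Under refinement the first vertices of the two blocks are again incomparable,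
    and the coefficient at this pair is still 1.\<close>
  have inc': "\<exists>a b. a < k n \<and> b < k n \<and> \<not> R n a b \<and> \<not> R n b a \<and>
      (\<exists>\<alpha>. u 0 i j = lin n \<alpha> \<and> \<alpha> (a, b) = 1)" for n
  proof (induction n)
    case 0
    show ?case using inc unfolding u_def
      by (intro exI[of _ i] exI[of _ j] conjI exI[of _ "\<lambda>q. if q = (i, j) then 1 else 0"]) auto
  next
    case (Suc n)
    then obtain a b \<alpha> where ab: "a < k n" "b < k n" "\<not> R n a b" "\<not> R n b a" "u 0 i j = lin n \<alpha>" "\<alpha> (a, b) = 1"
      by blast
    have "a * ratio n < k (Suc n)" "b * ratio n < k (Suc n)" using ab ratio_pos[of n] by (simp_all add: k_Suc)
    moreover have "\<not> R (Suc n) (a * ratio n) (b * ratio n)" "\<not> R (Suc n) (b * ratio n) (a * ratio n)"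
      using ab ratio_pos[of n] by (simp_all add: R_Suc)
    moreover have "u 0 i j = lin (Suc n) (\<lambda>(i, j). if i mod ratio n = j mod ratio n then \<alpha> (i div ratio n, j div ratio n) else 0)"
      unfolding ab(5) by (rule lin_refine)
    moreover have "(\<lambda>(i, j). if i mod ratio n = j mod ratio n then \<alpha> (i div ratio n, j div ratio n) else 0) (a * ratio n, b * ratio n) = 1"
      using ab ratio_pos[of n] by simp
    ultimately show ?case by blast
  qed
  have far: "1 \<le> nrm C (\<pi> (u 0 i j \<ominus> (x \<oplus> star E y)))" if xy: "x \<in> level n" "y \<in> level n" for n x y
  proof -
    obtain a b \<alpha> where ab: "a < k n" "b < k n" "\<not> R n a b" "\<not> R n b a" "u 0 i j = lin n \<alpha>" "\<alpha> (a, b) = 1"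
      using inc'[of n] by blast
    obtain \<beta> where x: "x = lin n \<beta>" "\<And>i j. \<beta> (i, j) \<noteq> 0 \<Longrightarrow> R n i j" using xy(1) unfolding level_def by auto
    obtain \<gamma> where y: "y = lin n \<gamma>" "\<And>i j. \<gamma> (i, j) \<noteq> 0 \<Longrightarrow> R n i j" using xy(2) unfolding level_def by auto
    define p where "p = rt n"
    have p: "p < k n" unfolding p_def by (rule rt_less)
    define v where "v = u 0 i j \<ominus> (x \<oplus> star E y)"
    have "v = lin n (\<lambda>q. \<alpha> q + - 1 * (\<beta> q + (case q of (i, j) \<Rightarrow> cnj (\<gamma> (j, i)))))"
      unfolding v_def ab(5) x(1) y(1) lin_star by (simp only: lin_add minus_smult lin_closed lin_smult)
    \<comment> \<open>Multiplying by a row unit and a column unit at the root isolates the entry (a,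
      b). Incomparability keeps x and the adjoint of y from contributing to it.\<close>
    then have "u n p a \<otimes> (v \<otimes> u n b p) = (\<alpha> (a, b) + - 1 * (\<beta> (a, b) + cnj (\<gamma> (b, a)))) \<odot> u n p p"
      using u_lin_u[OF ab(1,2)] by simp
    moreover have "\<beta> (a, b) = 0" "\<gamma> (b, a) = 0" using ab x y by blast+
    ultimately have e: "u n p a \<otimes> (v \<otimes> u n b p) = u n p p" using ab by simp
    have vc: "v \<in> carrier E" using x y by (simp add: v_def)
    have ualg: "u n q p \<in> alg" if "q < k n" for q using R_rt[OF that] u_level level_alg unfolding p_def by blast
    have un: "nrm C (\<pi> (u n q p)) = 1" if "q < k n" for q
      using iso[OF ualg[OF that]] \<pi>(2)[OF ualg[OF that]] u_nrm[OF that p] by simp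
    have "nrm C (\<pi> (u n p p)) = nrm C (\<pi> (u n p a) \<otimes>\<^bsub>C\<^esub> (\<pi> v \<otimes>\<^bsub>C\<^esub> \<pi> (u n b p)))"
      unfolding e[symmetric] using vc \<pi>_simps by simp
    also have "\<dots> \<le> nrm C (\<pi> (u n p a)) * (nrm C (\<pi> v) * nrm C (\<pi> (u n b p)))"
      using vc \<pi>_simps by (intro order_trans[OF C.nrm_mult] mult_left_mono C.nrm_mult) (auto simp: C.nrm_nonneg)
    also have "\<pi> (u n p a) = star C (\<pi> (u n a p))" using \<pi>_simps(5)[of "u n a p"] by (simp add: u_star)
    finally show ?thesis using un ab p \<pi>_simps by (simp add: v_def)
  qed
  have "\<pi> (u 0 i j) \<in> carrier C" using \<pi>_simps by simp
  then obtain w where w: "w \<in> plus_adjoint C (f ` alg)" "nrm C (\<pi> (u 0 i j) \<ominus>\<^bsub>C\<^esub> w) < 1 / 2"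
    using C.closureD[of "\<pi> (u 0 i j)" "plus_adjoint C (f ` alg)" "1 / 2"] D by auto
  then obtain x y where xy: "x \<in> alg" "y \<in> alg" "w = f x \<oplus>\<^bsub>C\<^esub> star C (f y)"
    unfolding plus_adjoint_def by auto
  have xyc: "x \<in> carrier E" "y \<in> carrier E" using xy alg_carrier by auto
  have wE: "w = \<pi> (x \<oplus> star E y)" using xy xyc \<pi> \<pi>_simps by simp
  \<comment> \<open>Two errors below 1/4 from passing to levels and one below 1/2 from the assumed
    density stay below the gap 1.\<close>
  obtain x' where x': "x' \<in> (\<Union>n. level n)" "nrm E (x \<ominus> x') < 1 / 4" using closureD[OF xy(1)[unfolded alg_eq], of "1 / 4"] by auto
  obtain y' where y': "y' \<in> (\<Union>n. level n)" "nrm E (y \<ominus> y') < 1 / 4" using closureD[OF xy(2)[unfolded alg_eq], of "1 / 4"] by auto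
  have c': "x' \<in> carrier E" "y' \<in> carrier E" using x' y' level_carrier by auto
  obtain n where n: "x' \<in> level n" "y' \<in> level n" using level_common[OF x'(1) y'(1)] by blast
  have "u 0 i j \<ominus> (x' \<oplus> star E y') = (u 0 i j \<ominus> (x \<oplus> star E y)) \<oplus> ((x \<ominus> x') \<oplus> star E (y \<ominus> y'))"
    apply (simp add: c' xyc star_minus)
    by (rule coeffs_eq, (rule coeffs_rules | (simp add: c' xyc algebra_simps; fail))+)
  then have "\<pi> (u 0 i j \<ominus> (x' \<oplus> star E y')) = \<pi> (u 0 i j \<ominus> (x \<oplus> star E y)) \<oplus>\<^bsub>C\<^esub> \<pi> ((x \<ominus> x') \<oplus> star E (y \<ominus> y'))"
    using c' xyc \<pi>_simps by simp
  then have "1 \<le> nrm C (\<pi> (u 0 i j \<ominus> (x \<oplus> star E y))) + nrm C (\<pi> ((x \<ominus> x') \<oplus> star E (y \<ominus> y')))"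
    using far[OF n] c' xyc \<pi>_simps(1) C.nrm_triangle[of "\<pi> (u 0 i j \<ominus> (x \<oplus> star E y))" "\<pi> ((x \<ominus> x') \<oplus> star E (y \<ominus> y'))"] by simp
  moreover have "nrm C (\<pi> ((x \<ominus> x') \<oplus> star E (y \<ominus> y'))) \<le> nrm E ((x \<ominus> x') \<oplus> star E (y \<ominus> y'))"
    using c' xyc by (intro star_hom_contractive[OF cstar_algebra_axioms C \<pi>(1)]) simp
  moreover have "\<dots> \<le> nrm E (x \<ominus> x') + nrm E (y \<ominus> y')"
    using nrm_triangle[of "x \<ominus> x'" "star E (y \<ominus> y')"] c' xyc by simp
  moreover have "nrm C (\<pi> (u 0 i j \<ominus> (x \<oplus> star E y))) < 1 / 2"
    using w(2) wE xyc star_hom_minus[OF cstar_algebra_axioms C \<pi>(1), of "u 0 i j" "x \<oplus> star E y"] by simp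
  ultimately show False using x'(2) y'(2) by linarith
qed

end

section \<open>Orthogonal sums and sums of positive elements\<close>

context cstar_algebra
begin

lemma finsum_minus:
  assumes "finite F" "h \<in> F \<rightarrow> carrier A" "g \<in> F \<rightarrow> carrier A"
  shows "(\<Oplus>a\<in>F. h a \<ominus> g a) = (\<Oplus>a\<in>F. h a) \<ominus> (\<Oplus>a\<in>F. g a)"
  using assms
proof (induction F rule: finite_induct)
  case (insert x F)
  have c: "h x \<in> carrier A" "g x \<in> carrier A" "(\<Oplus>a\<in>F. h a) \<in> carrier A" "(\<Oplus>a\<in>F. g a) \<in> carrier A"
    using insert.prems by (auto intro!: M.finsum_closed)
  have "(\<Oplus>a\<in>insert x F. h a \<ominus> g a) = (h x \<ominus> g x) \<oplus> ((\<Oplus>a\<in>F. h a) \<ominus> (\<Oplus>a\<in>F. g a))"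
    using insert by (subst M.finsum_insert) (auto simp: Pi_iff)
  also have "\<dots> = (h x \<oplus> (\<Oplus>a\<in>F. h a)) \<ominus> (g x \<oplus> (\<Oplus>a\<in>F. g a))"
    by (rule coeffs_eq, (rule coeffs_rules | (simp add: c algebra_simps; fail))+)
  also have "\<dots> = (\<Oplus>a\<in>insert x F. h a) \<ominus> (\<Oplus>a\<in>insert x F. g a)"
    using insert by (subst (1 2) M.finsum_insert) (auto simp: Pi_iff)
  finally show ?case .
qed simp

lemma finsum_const:
  assumes "finite F" "x \<in> carrier A"
  shows "(\<Oplus>a\<in>F. x) = of_nat (card F) \<odot> x"
  using assms by (induction F rule: finite_induct) (simp_all add: smult_add_l)

text \<open>This is the theorem of Pythagoras for the algebra-valued inner product x^* y: expanding
  the square leaves only the terms on the diagonal.\<close>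

lemma orthogonal_sum:
  assumes "finite F" "\<And>a. a \<in> F \<Longrightarrow> w a \<in> carrier A"
    and "\<And>a b. \<lbrakk>a \<in> F; b \<in> F; a \<noteq> b\<rbrakk> \<Longrightarrow> star A (w a) \<otimes> w b = \<zero>"
  shows "star A (\<Oplus>a\<in>F. \<beta> a \<odot> w a) \<otimes> (\<Oplus>a\<in>F. \<beta> a \<odot> w a)
    = (\<Oplus>a\<in>F. complex_of_real ((cmod (\<beta> a))\<^sup>2) \<odot> (star A (w a) \<otimes> w a))"
  using assms
proof (induction F rule: finite_induct)
  case (insert x F)
  define S where "S = (\<Oplus>a\<in>F. \<beta> a \<odot> w a)"
  have wc: "w x \<in> carrier A" "\<And>a. a \<in> F \<Longrightarrow> w a \<in> carrier A" using insert.prems by auto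
  have S: "S \<in> carrier A" unfolding S_def using wc by (intro M.finsum_closed) auto
  have orth: "star A (w x) \<otimes> w a = \<zero>" if "a \<in> F" for a
    using insert.prems(2)[of x a] insert.hyps that by fastforce
  have "star A (w x) \<otimes> S = (\<Oplus>a\<in>F. star A (w x) \<otimes> (\<beta> a \<odot> w a))"
    unfolding S_def using wc insert.hyps by (intro finsum_mult_l) auto
  also have "\<dots> = (\<Oplus>a\<in>F. \<zero>)"
    using wc orth by (intro M.finsum_cong') (simp_all add: smult_mult_r)
  finally have 1: "star A (w x) \<otimes> S = \<zero>" by simp
  then have "star A (star A (w x) \<otimes> S) = \<zero>" by simp
  then have 2: "star A S \<otimes> w x = \<zero>" using wc S by (simp add: star_mult star_star)
  have sum: "(\<Oplus>a\<in>insert x F. \<beta> a \<odot> w a) = \<beta> x \<odot> w x \<oplus> S"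
    unfolding S_def using wc insert.hyps by (intro M.finsum_insert) auto
  have "cnj (\<beta> x) * \<beta> x = complex_of_real ((cmod (\<beta> x))\<^sup>2)"
    by (metis complex_norm_square mult.commute of_real_power)
  then have "star A (\<beta> x \<odot> w x \<oplus> S) \<otimes> (\<beta> x \<odot> w x \<oplus> S)
      = complex_of_real ((cmod (\<beta> x))\<^sup>2) \<odot> (star A (w x) \<otimes> w x) \<oplus> star A S \<otimes> S"
    using wc S 1 2 by (simp add: expand smult_add_r mult.commute)
  also have "star A S \<otimes> S = (\<Oplus>a\<in>F. complex_of_real ((cmod (\<beta> a))\<^sup>2) \<odot> (star A (w a) \<otimes> w a))"
    unfolding S_def using insert by blast
  finally show ?case
    unfolding sum using wc insert.hyps by (subst M.finsum_insert) auto
qed simp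

end

context unital_cstar_algebra
begin

lemma pos_finsum: "\<lbrakk>finite F; \<And>a. a \<in> F \<Longrightarrow> pos (h a)\<rbrakk> \<Longrightarrow> pos (\<Oplus>a\<in>F. h a)"
proof (induction F rule: finite_induct)
  case (insert x F)
  then have "(\<Oplus>a\<in>insert x F. h a) = h x \<oplus> (\<Oplus>a\<in>F. h a)" by (intro M.finsum_insert) auto
  then show ?case using insert pos_add by simp
qed simp

lemma nrm_le_finsum_pos:
  assumes "finite F" "\<And>a. a \<in> F \<Longrightarrow> pos (h a)" "b \<in> F"
  shows "nrm A (h b) \<le> nrm A (\<Oplus>a\<in>F. h a)"
proof -
  define S where "S = (\<Oplus>a\<in>F - {b}. h a)"
  have S: "pos S" unfolding S_def by (intro pos_finsum) (use assms in auto)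
  have F: "F = insert b (F - {b})" using assms(3) by auto
  have e: "(\<Oplus>a\<in>F. h a) = h b \<oplus> S"
    unfolding S_def by (subst F, rule M.finsum_insert) (use assms in auto)
  have c: "h b \<in> carrier A" "S \<in> carrier A" using assms S by auto
  have "(h b \<oplus> S) \<ominus> h b = S"
    by (rule coeffs_eq, (rule coeffs_rules | (simp add: c algebra_simps; fail))+)
  then show ?thesis unfolding e using S assms c by (intro nrm_mono) auto
qed

text \<open>The element s is the defect operator of the contraction x; the size of s w measures how
  far x is from preserving w.\<close>

lemma pos_one_minus_star_mult:
  assumes "x \<in> carrier A" "nrm A x \<le> 1"
  obtains s where "self_adj s" "s \<otimes> s = \<one> \<ominus> star A x \<otimes> x" "nrm A s \<le> 1"
proof -
  have n: "nrm A (star A x \<otimes> x) \<le> 1" using cstar_identity[OF assms(1)] assms nrm_nonneg by (simp add: power_le_one)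
  obtain s where s: "self_adj s" "s \<otimes> s = \<one> \<ominus> star A x \<otimes> x"
    using sqrt_one_minus[OF self_adj_star_mult[OF assms(1)] n] by metis
  have "(nrm A s)\<^sup>2 \<le> 1"
    using nrm_self_adj_square[OF s(1)] pos_imp_nrm[OF pos_star_mult[OF assms(1)] n] s(2) by simp
  then have "nrm A s \<le> 1" using power2_le_imp_le[of "nrm A s" 1] by simp
  then show ?thesis using s that by blast
qed

end

section \<open>The C*-envelope\<close>

text \<open>In the application U is the unitization of a cover. Its unit makes the square roots and
  approximate eigenvectors of the first section available.\<close>

locale isometric_rep = tree_refinement E G k \<iota> + U: unital_cstar_algebra U
  for E :: "'e cstar" (structure) and G k \<iota> and U :: "'b cstar" +
  fixes i :: "'e \<Rightarrow> 'b"
  assumes i_hom: "alg_hom E alg U i" and i_nrm: "x \<in> alg \<Longrightarrow> nrm U (i x) = nrm E x"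
begin

lemmas i_simps = alg_hom_simps[OF i_hom]

lemma i_zero: "i \<zero> = \<zero>\<^bsub>U\<^esub>"
  by (rule alg_hom_zero[OF U.cstar_algebra_axioms i_hom])

lemma i_finsum: "\<lbrakk>finite F; h ` F \<subseteq> alg\<rbrakk> \<Longrightarrow> i (\<Oplus>a\<in>F. h a) = (\<Oplus>\<^bsub>U\<^esub>a\<in>F. i (h a))"
  by (rule alg_hom_finsum[OF U.cstar_algebra_axioms i_hom])

definition f :: "nat \<Rightarrow> nat \<Rightarrow> nat \<Rightarrow> 'b" where
  "f n a b = i (u n a b)"

lemma f_closed: "R n a b \<Longrightarrow> f n a b \<in> carrier U"
  unfolding f_def by (rule i_simps(1)[OF u_alg])

lemma f_mult: "\<lbrakk>R n a b; R n b' d\<rbrakk> \<Longrightarrow> f n a b \<otimes>\<^bsub>U\<^esub> f n b' d = (if b = b' then f n a d else \<zero>\<^bsub>U\<^esub>)"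
  unfolding f_def using i_simps(3)[OF u_alg u_alg, of n a b n b' d] R_less[of n a b]
  by (cases "b = b'") (simp_all add: u_mult i_zero)

lemma f_nrm: "R n a b \<Longrightarrow> nrm U (f n a b) = 1"
  unfolding f_def using i_nrm[OF u_alg] R_less by (simp add: u_nrm)

text \<open>A homomorphism of operator algebras gives no control of adjoints; self-adjointness comes
  from the image being a contractive idempotent.\<close>

lemma f_diag_star: "a < k n \<Longrightarrow> star U (f n a a) = f n a a"
  by (rule U.contractive_idempotent) (simp_all add: f_closed f_mult f_nrm R_refl)

definition g :: "nat \<Rightarrow> nat \<Rightarrow> 'b" where
  "g n a = f n a (rt n)"

lemma g_closed: "a < k n \<Longrightarrow> g n a \<in> carrier U"
  unfolding g_def by (rule f_closed[OF R_rt])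

lemma f_g: "\<lbrakk>R n a b; d < k n\<rbrakk> \<Longrightarrow> f n a b \<otimes>\<^bsub>U\<^esub> g n d = (if b = d then g n a else \<zero>\<^bsub>U\<^esub>)"
  unfolding g_def by (rule f_mult[OF _ R_rt])

text \<open>The left factor of f n a b = f n a a f n a b is a projection, and it annihilates the
  column entries g n d with d different from a.\<close>

lemma f_star_g:
  assumes "R n a b" "d < k n" "d \<noteq> a" shows "star U (f n a b) \<otimes>\<^bsub>U\<^esub> g n d = \<zero>\<^bsub>U\<^esub>"
proof -
  have a: "a < k n" using R_less[OF assms(1)] by simp
  have c: "f n a b \<in> carrier U" "f n a a \<in> carrier U" "g n d \<in> carrier U"
    using assms f_closed g_closed R_refl[OF a] by auto
  have "f n a b = f n a a \<otimes>\<^bsub>U\<^esub> f n a b" using f_mult[OF R_refl[OF a] assms(1)] by simp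
  then have "star U (f n a b) = star U (f n a b) \<otimes>\<^bsub>U\<^esub> f n a a"
    using U.star_mult[OF c(2,1)] f_diag_star[OF a] by simp
  then have "star U (f n a b) \<otimes>\<^bsub>U\<^esub> g n d = star U (f n a b) \<otimes>\<^bsub>U\<^esub> (f n a a \<otimes>\<^bsub>U\<^esub> g n d)"
    using c by (metis U.mult_assoc U.star_closed)
  then show ?thesis using f_g[OF R_refl[OF a] assms(2)] assms(3) c by simp
qed

lemma g_orth: "\<lbrakk>a < k n; b < k n; a \<noteq> b\<rbrakk> \<Longrightarrow> star U (g n a) \<otimes>\<^bsub>U\<^esub> g n b = \<zero>\<^bsub>U\<^esub>"
  using f_star_g[OF R_rt, of a n b] by (simp add: g_def)

text \<open>The column \<open>\<Sum>a. u n a (rt n)\<close> lies in the algebra and has norm \<open>sqrt (k n)\<close>.\<close>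

lemma column_nrm: "nrm U (\<Oplus>\<^bsub>U\<^esub>a\<in>{..<k n}. star U (g n a) \<otimes>\<^bsub>U\<^esub> g n a) = real (k n)"
proof -
  define X where "X = (\<Oplus>a\<in>{..<k n}. 1 \<odot> u n a (rt n))"
  have Xalg: "X \<in> alg" unfolding X_def
    by (rule finsum_mem) (use alg_closed alg_carrier u_alg[OF R_rt] in auto)
  have XE: "X \<in> carrier E" using Xalg alg_carrier by auto
  have "star E X \<otimes> X = (\<Oplus>a\<in>{..<k n}. complex_of_real ((cmod 1)\<^sup>2) \<odot> (star E (u n a (rt n)) \<otimes> u n a (rt n)))"
    unfolding X_def by (rule orthogonal_sum) (simp_all add: u_star u_mult)
  also have "\<dots> = (\<Oplus>a\<in>{..<k n}. u n (rt n) (rt n))"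
    by (intro M.finsum_cong') (simp_all add: u_star u_mult)
  also have "\<dots> = of_nat (k n) \<odot> u n (rt n) (rt n)" by (simp add: finsum_const)
  finally have nE: "(nrm E X)\<^sup>2 = real (k n)"
    using cstar_identity[OF XE] by (simp add: nrm_smult u_diag_nrm rt_less)
  have iX: "i X = (\<Oplus>\<^bsub>U\<^esub>a\<in>{..<k n}. 1 \<odot>\<^bsub>U\<^esub> g n a)"
    unfolding X_def g_def f_def
    by (subst i_finsum) (use alg_closed u_alg[OF R_rt] in \<open>auto intro!: U.M.finsum_cong' simp: i_simps(4) i_simps(1)\<close>)
  have "star U (i X) \<otimes>\<^bsub>U\<^esub> i X = (\<Oplus>\<^bsub>U\<^esub>a\<in>{..<k n}. complex_of_real ((cmod 1)\<^sup>2) \<odot>\<^bsub>U\<^esub> (star U (g n a) \<otimes>\<^bsub>U\<^esub> g n a))"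
    unfolding iX by (rule U.orthogonal_sum) (simp_all add: g_closed g_orth)
  also have "\<dots> = (\<Oplus>\<^bsub>U\<^esub>a\<in>{..<k n}. star U (g n a) \<otimes>\<^bsub>U\<^esub> g n a)"
    by (intro U.M.finsum_cong') (simp_all add: g_closed)
  finally show ?thesis
    using U.cstar_identity[OF i_simps(1)[OF Xalg]] i_nrm[OF Xalg] nE by simp
qed

text \<open>The average z of the positive contractions c a has norm one by
  \<open>column_nrm\<close>, so an approximate eigenvector y of z at 1 exists. Each defect
  \<open>h a\<close> is positive, hence bounded in norm by the sum of all defects, and that sum is
  controlled by (1 - z) y.\<close>

lemma almost_isometric_vector:
  assumes "e > 0"
  shows "\<exists>y\<in>carrier U. nrm U y = 1 \<and>
    (\<forall>a<k n. nrm U (star U y \<otimes>\<^bsub>U\<^esub> y \<ominus>\<^bsub>U\<^esub> star U (g n a \<otimes>\<^bsub>U\<^esub> y) \<otimes>\<^bsub>U\<^esub> (g n a \<otimes>\<^bsub>U\<^esub> y)) \<le> e)"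
proof -
  define c where "c a = star U (g n a) \<otimes>\<^bsub>U\<^esub> g n a" for a
  define C where "C = (\<Oplus>\<^bsub>U\<^esub>a\<in>{..<k n}. c a)"
  define z where "z = complex_of_real (1 / real (k n)) \<odot>\<^bsub>U\<^esub> C"
  have cc: "c a \<in> carrier U" "U.pos (c a)" if "a < k n" for a
    using g_closed[OF that] by (simp_all add: c_def U.pos_star_mult)
  have C: "C \<in> carrier U" "U.pos C" unfolding C_def using cc by (auto intro!: U.pos_finsum U.M.finsum_closed)
  have kp: "real (k n) > 0" using k_pos by simp
  have z: "U.pos z" "nrm U z = 1"
    unfolding z_def using C kp column_nrm[of n]
    by (auto intro!: U.pos_smult simp: U.nrm_smult norm_divide C_def c_def simp del: of_real_divide)
  \<comment> \<open>The tolerance is divided by \<open>k n\<close> because the defects sum to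
    \<open>k n\<close> times y^* (1 - z) y.\<close>
  have "0 < e / real (k n)" using assms kp by simp
  then obtain y where y: "y \<in> carrier U" "nrm U y = 1" "nrm U ((\<one>\<^bsub>U\<^esub> \<ominus>\<^bsub>U\<^esub> z) \<otimes>\<^bsub>U\<^esub> y) < e / real (k n)"
    using U.approximate_eigenvector[OF z] by metis
  define h where "h a = star U y \<otimes>\<^bsub>U\<^esub> ((\<one>\<^bsub>U\<^esub> \<ominus>\<^bsub>U\<^esub> c a) \<otimes>\<^bsub>U\<^esub> y)" for a
  have h_eq: "h a = star U y \<otimes>\<^bsub>U\<^esub> y \<ominus>\<^bsub>U\<^esub> star U (g n a \<otimes>\<^bsub>U\<^esub> y) \<otimes>\<^bsub>U\<^esub> (g n a \<otimes>\<^bsub>U\<^esub> y)" if "a < k n" for a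
    unfolding h_def c_def using y g_closed[OF that] by (simp add: U.expand)
  have h_pos: "U.pos (h a)" if a: "a < k n" for a
  proof -
    obtain s where s: "U.self_adj s" "s \<otimes>\<^bsub>U\<^esub> s = \<one>\<^bsub>U\<^esub> \<ominus>\<^bsub>U\<^esub> c a"
      using U.pos_one_minus_star_mult[OF g_closed[OF a]] f_nrm[OF R_rt[OF a]] unfolding c_def g_def by auto
    have sc: "s \<in> carrier U" "star U s = s" using s(1) by (simp_all add: U.self_adj_def)
    have "h a = star U (s \<otimes>\<^bsub>U\<^esub> y) \<otimes>\<^bsub>U\<^esub> (s \<otimes>\<^bsub>U\<^esub> y)"
      unfolding h_def s(2)[symmetric] using sc y by (simp add: U.star_mult U.mult_assoc)
    then show ?thesis using U.pos_star_mult[of "s \<otimes>\<^bsub>U\<^esub> y"] sc y by simp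
  qed
  have "(\<Oplus>\<^bsub>U\<^esub>a\<in>{..<k n}. h a) = star U y \<otimes>\<^bsub>U\<^esub> (\<Oplus>\<^bsub>U\<^esub>a\<in>{..<k n}. (\<one>\<^bsub>U\<^esub> \<ominus>\<^bsub>U\<^esub> c a) \<otimes>\<^bsub>U\<^esub> y)"
    unfolding h_def using y cc by (intro U.finsum_mult_l[symmetric]) auto
  also have "(\<Oplus>\<^bsub>U\<^esub>a\<in>{..<k n}. (\<one>\<^bsub>U\<^esub> \<ominus>\<^bsub>U\<^esub> c a) \<otimes>\<^bsub>U\<^esub> y) = (\<Oplus>\<^bsub>U\<^esub>a\<in>{..<k n}. \<one>\<^bsub>U\<^esub> \<ominus>\<^bsub>U\<^esub> c a) \<otimes>\<^bsub>U\<^esub> y"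
    using y cc by (intro U.finsum_mult_r[symmetric]) auto
  also have "(\<Oplus>\<^bsub>U\<^esub>a\<in>{..<k n}. \<one>\<^bsub>U\<^esub> \<ominus>\<^bsub>U\<^esub> c a) = (\<Oplus>\<^bsub>U\<^esub>a\<in>{..<k n}. \<one>\<^bsub>U\<^esub>) \<ominus>\<^bsub>U\<^esub> C"
    unfolding C_def using cc by (intro U.finsum_minus) auto
  also have "(\<Oplus>\<^bsub>U\<^esub>a\<in>{..<k n}. \<one>\<^bsub>U\<^esub>) = of_nat (k n) \<odot>\<^bsub>U\<^esub> \<one>\<^bsub>U\<^esub>" by (subst U.finsum_const) simp_all
  also have "of_nat (k n) \<odot>\<^bsub>U\<^esub> \<one>\<^bsub>U\<^esub> \<ominus>\<^bsub>U\<^esub> C = of_nat (k n) \<odot>\<^bsub>U\<^esub> (\<one>\<^bsub>U\<^esub> \<ominus>\<^bsub>U\<^esub> z)"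
    unfolding z_def using kp
    by - (rule U.coeffs_eq, (rule U.coeffs_rules | (simp add: C algebra_simps; fail))+)
  finally have sum: "(\<Oplus>\<^bsub>U\<^esub>a\<in>{..<k n}. h a) = star U y \<otimes>\<^bsub>U\<^esub> (of_nat (k n) \<odot>\<^bsub>U\<^esub> (\<one>\<^bsub>U\<^esub> \<ominus>\<^bsub>U\<^esub> z) \<otimes>\<^bsub>U\<^esub> y)" .
  have zc: "z \<in> carrier U" using z by simp
  have "nrm U (\<Oplus>\<^bsub>U\<^esub>a\<in>{..<k n}. h a) \<le> nrm U (star U y) * nrm U (of_nat (k n) \<odot>\<^bsub>U\<^esub> (\<one>\<^bsub>U\<^esub> \<ominus>\<^bsub>U\<^esub> z) \<otimes>\<^bsub>U\<^esub> y)"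
    unfolding sum using y zc by (intro U.nrm_mult) auto
  also have "\<dots> = real (k n) * nrm U ((\<one>\<^bsub>U\<^esub> \<ominus>\<^bsub>U\<^esub> z) \<otimes>\<^bsub>U\<^esub> y)"
    using y zc by (simp add: U.smult_mult_l U.nrm_smult)
  also have "\<dots> \<le> e" using y(3) kp by (simp add: field_simps)
  finally have "nrm U (h a) \<le> e" if "a < k n" for a
    using U.nrm_le_finsum_pos[of "{..<k n}" h a] h_pos that by force
  then show ?thesis using y h_eq by (intro bexI[of _ y]) auto
qed

section \<open>Almost isometric copies of the space of column vectors\<close>

definition Y :: "nat \<Rightarrow> nat \<Rightarrow> 'b" where
  "Y n N = (SOME y. y \<in> carrier U \<and> nrm U y = 1 \<and>
    (\<forall>a<k n. nrm U (star U y \<otimes>\<^bsub>U\<^esub> y \<ominus>\<^bsub>U\<^esub> star U (g n a \<otimes>\<^bsub>U\<^esub> y) \<otimes>\<^bsub>U\<^esub> (g n a \<otimes>\<^bsub>U\<^esub> y)) \<le> 1 / real (Suc N)))"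

text \<open>This is the copy of the a-th basis vector. The squares of all copies agree with the
  common value y^* y up to 1 / (N + 1).\<close>

definition W :: "nat \<Rightarrow> nat \<Rightarrow> nat \<Rightarrow> 'b" where
  "W n a N = g n a \<otimes>\<^bsub>U\<^esub> Y n N"

lemma Y: "Y n N \<in> carrier U" "nrm U (Y n N) = 1"
  "a < k n \<Longrightarrow> nrm U (star U (Y n N) \<otimes>\<^bsub>U\<^esub> Y n N \<ominus>\<^bsub>U\<^esub> star U (W n a N) \<otimes>\<^bsub>U\<^esub> W n a N) \<le> 1 / real (Suc N)"
proof -
  have "\<exists>y. y \<in> carrier U \<and> nrm U y = 1 \<and>
    (\<forall>a<k n. nrm U (star U y \<otimes>\<^bsub>U\<^esub> y \<ominus>\<^bsub>U\<^esub> star U (g n a \<otimes>\<^bsub>U\<^esub> y) \<otimes>\<^bsub>U\<^esub> (g n a \<otimes>\<^bsub>U\<^esub> y)) \<le> 1 / real (Suc N))"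
    using almost_isometric_vector[of "1 / real (Suc N)" n] by (auto simp: Bex_def)
  from someI_ex[OF this] show "Y n N \<in> carrier U" "nrm U (Y n N) = 1"
    "a < k n \<Longrightarrow> nrm U (star U (Y n N) \<otimes>\<^bsub>U\<^esub> Y n N \<ominus>\<^bsub>U\<^esub> star U (W n a N) \<otimes>\<^bsub>U\<^esub> W n a N) \<le> 1 / real (Suc N)"
    unfolding Y_def[symmetric] W_def by blast+
qed

lemma W_closed: "a < k n \<Longrightarrow> W n a N \<in> carrier U"
  unfolding W_def by (intro U.mult_closed g_closed Y)

lemma W_orth: "\<lbrakk>a < k n; b < k n; a \<noteq> b\<rbrakk> \<Longrightarrow> star U (W n a N) \<otimes>\<^bsub>U\<^esub> W n b N = \<zero>\<^bsub>U\<^esub>"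
proof -
  assume a: "a < k n" "b < k n" "a \<noteq> b"
  have "star U (W n a N) \<otimes>\<^bsub>U\<^esub> W n b N = star U (Y n N) \<otimes>\<^bsub>U\<^esub> ((star U (g n a) \<otimes>\<^bsub>U\<^esub> g n b) \<otimes>\<^bsub>U\<^esub> Y n N)"
    unfolding W_def using a Y by (simp add: g_closed U.star_mult U.mult_assoc)
  then show ?thesis using g_orth[OF a] Y by simp
qed

lemma f_W: "\<lbrakk>R n a b; d < k n\<rbrakk> \<Longrightarrow> f n a b \<otimes>\<^bsub>U\<^esub> W n d N = (if b = d then W n a N else \<zero>\<^bsub>U\<^esub>)"
  unfolding W_def using f_g[of n a b d] f_closed[of n a b] g_closed[of d n] Y
  by (auto simp: U.mult_assoc[symmetric])

lemma f_star_W_zero: "\<lbrakk>R n a b; d < k n; d \<noteq> a\<rbrakk> \<Longrightarrow> star U (f n a b) \<otimes>\<^bsub>U\<^esub> W n d N = \<zero>\<^bsub>U\<^esub>"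
  unfolding W_def using f_star_g[of n a b d] f_closed[of n a b] g_closed[of d n] Y
  by (auto simp: U.mult_assoc[symmetric])

text \<open>A contraction F that nearly preserves w satisfies F^* F w close to w. With s the defect
  operator of F the error is s (s w), and the square of the norm of s w is the norm of the
  difference between the squares of w and F w. Both lie within 1 / (N + 1) of y^* y, whence the
  constant 2.\<close>

lemma f_star_W:
  assumes ab: "R n a b"
  shows "nrm U (star U (f n a b) \<otimes>\<^bsub>U\<^esub> W n a N \<ominus>\<^bsub>U\<^esub> W n b N) \<le> sqrt (2 / real (Suc N))"
proof -
  have lt: "a < k n" "b < k n" using R_less[OF ab] by auto
  define F where "F = f n a b"
  define w where "w = W n b N"
  have F: "F \<in> carrier U" "nrm U F \<le> 1" using f_closed[OF ab] f_nrm[OF ab] by (simp_all add: F_def)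
  have w: "w \<in> carrier U" "F \<otimes>\<^bsub>U\<^esub> w = W n a N" using W_closed[OF lt(2)] f_W[OF ab lt(2)] by (simp_all add: w_def F_def)
  obtain s where s: "U.self_adj s" "s \<otimes>\<^bsub>U\<^esub> s = \<one>\<^bsub>U\<^esub> \<ominus>\<^bsub>U\<^esub> star U F \<otimes>\<^bsub>U\<^esub> F" "nrm U s \<le> 1"
    using U.pos_one_minus_star_mult[OF F] by metis
  have sc: "s \<in> carrier U" "star U s = s" using s(1) by (simp_all add: U.self_adj_def)
  have "w \<ominus>\<^bsub>U\<^esub> star U F \<otimes>\<^bsub>U\<^esub> W n a N = (s \<otimes>\<^bsub>U\<^esub> s) \<otimes>\<^bsub>U\<^esub> w"
    unfolding s(2) w(2)[symmetric] using F w(1) by (simp add: U.expand)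
  also have "\<dots> = s \<otimes>\<^bsub>U\<^esub> (s \<otimes>\<^bsub>U\<^esub> w)" using sc w by (simp add: U.mult_assoc)
  finally have "nrm U (w \<ominus>\<^bsub>U\<^esub> star U F \<otimes>\<^bsub>U\<^esub> W n a N) \<le> nrm U s * nrm U (s \<otimes>\<^bsub>U\<^esub> w)"
    using sc w U.nrm_mult[of s "s \<otimes>\<^bsub>U\<^esub> w"] by simp
  also have "\<dots> \<le> 1 * nrm U (s \<otimes>\<^bsub>U\<^esub> w)" using s(3) sc w by (intro mult_right_mono) (auto simp: U.nrm_nonneg)
  finally have 1: "nrm U (w \<ominus>\<^bsub>U\<^esub> star U F \<otimes>\<^bsub>U\<^esub> W n a N) \<le> nrm U (s \<otimes>\<^bsub>U\<^esub> w)" by simp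
  define y where "y = star U (Y n N) \<otimes>\<^bsub>U\<^esub> Y n N"
  have yc: "y \<in> carrier U" using Y by (simp add: y_def)
  define p where "p = star U w \<otimes>\<^bsub>U\<^esub> w"
  define q where "q = star U (W n a N) \<otimes>\<^bsub>U\<^esub> W n a N"
  have pq: "p \<in> carrier U" "q \<in> carrier U" using w W_closed[OF lt(1)] by (simp_all add: p_def q_def)
  have "star U (s \<otimes>\<^bsub>U\<^esub> w) \<otimes>\<^bsub>U\<^esub> (s \<otimes>\<^bsub>U\<^esub> w) = star U w \<otimes>\<^bsub>U\<^esub> ((s \<otimes>\<^bsub>U\<^esub> s) \<otimes>\<^bsub>U\<^esub> w)"
    using sc w by (simp add: U.star_mult U.mult_assoc)
  also have "\<dots> = p \<ominus>\<^bsub>U\<^esub> q"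
    unfolding s(2) p_def q_def w(2)[symmetric] using F w(1) by (simp add: U.expand)
  finally have "(nrm U (s \<otimes>\<^bsub>U\<^esub> w))\<^sup>2 = nrm U (p \<ominus>\<^bsub>U\<^esub> q)" using U.cstar_identity[of "s \<otimes>\<^bsub>U\<^esub> w"] sc w by simp
  also have "\<dots> \<le> nrm U (p \<ominus>\<^bsub>U\<^esub> y) + nrm U (y \<ominus>\<^bsub>U\<^esub> q)" using pq yc by (rule_tac U.nrm_dist_triangle)
  also have "\<dots> \<le> 1 / real (Suc N) + 1 / real (Suc N)"
    using Y(3)[OF lt(1), of N] Y(3)[OF lt(2), of N] U.nrm_minus_commute[OF pq(1) yc]
    by (intro add_mono) (simp_all add: p_def q_def y_def w_def)
  finally have "(nrm U (s \<otimes>\<^bsub>U\<^esub> w))\<^sup>2 \<le> 2 / real (Suc N)" by simp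
  then have "nrm U (s \<otimes>\<^bsub>U\<^esub> w) \<le> sqrt (2 / real (Suc N))" by (rule real_le_rsqrt)
  then show ?thesis
    using 1 F w W_closed[OF lt(1)] U.nrm_minus_commute[of w "star U F \<otimes>\<^bsub>U\<^esub> W n a N"]
    by (simp add: F_def[symmetric] w_def[symmetric])
qed

definition comb :: "nat \<Rightarrow> nat \<Rightarrow> (nat \<Rightarrow> complex) \<Rightarrow> 'b" where
  "comb n N \<beta> = (\<Oplus>\<^bsub>U\<^esub>a\<in>{..<k n}. \<beta> a \<odot>\<^bsub>U\<^esub> W n a N)"

lemma comb_closed: "comb n N \<beta> \<in> carrier U"
  unfolding comb_def by (rule U.M.finsum_closed) (use W_closed in auto)

lemma comb_add: "comb n N (\<lambda>a. \<beta> a + \<gamma> a) = comb n N \<beta> \<oplus>\<^bsub>U\<^esub> comb n N \<gamma>"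
proof -
  have "comb n N (\<lambda>a. \<beta> a + \<gamma> a) = (\<Oplus>\<^bsub>U\<^esub>a\<in>{..<k n}. \<beta> a \<odot>\<^bsub>U\<^esub> W n a N \<oplus>\<^bsub>U\<^esub> \<gamma> a \<odot>\<^bsub>U\<^esub> W n a N)"
    unfolding comb_def using W_closed by (intro U.M.finsum_cong') (simp_all add: U.smult_add_l Pi_iff)
  also have "\<dots> = comb n N \<beta> \<oplus>\<^bsub>U\<^esub> comb n N \<gamma>"
    unfolding comb_def using W_closed by (intro U.M.finsum_addf) (simp_all add: Pi_iff)
  finally show ?thesis .
qed

lemma comb_smult: "comb n N (\<lambda>a. c * \<beta> a) = c \<odot>\<^bsub>U\<^esub> comb n N \<beta>"
proof -
  have "c \<odot>\<^bsub>U\<^esub> comb n N \<beta> = (\<Oplus>\<^bsub>U\<^esub>a\<in>{..<k n}. c \<odot>\<^bsub>U\<^esub> (\<beta> a \<odot>\<^bsub>U\<^esub> W n a N))"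
    unfolding comb_def using W_closed by (intro U.finsum_smultC) (simp_all add: Pi_iff)
  also have "\<dots> = comb n N (\<lambda>a. c * \<beta> a)"
    unfolding comb_def using W_closed by (intro U.M.finsum_cong') (simp_all add: Pi_iff)
  finally show ?thesis by simp
qed

lemma comb_zero: "comb n N (\<lambda>_. 0) = \<zero>\<^bsub>U\<^esub>"
  using comb_smult[of n N 0 "\<lambda>_. 0"] comb_closed by simp

lemma comb_sum:
  "finite F \<Longrightarrow> comb n N (\<lambda>a. \<Sum>d\<in>F. c d * \<alpha> a d) = (\<Oplus>\<^bsub>U\<^esub>d\<in>F. c d \<odot>\<^bsub>U\<^esub> comb n N (\<lambda>a. \<alpha> a d))"
proof (induction F rule: finite_induct)
  case (insert x F)
  have "comb n N (\<lambda>a. \<Sum>d\<in>insert x F. c d * \<alpha> a d) = comb n N (\<lambda>a. c x * \<alpha> a x + (\<Sum>d\<in>F. c d * \<alpha> a d))"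
    using insert.hyps by simp
  also have "\<dots> = c x \<odot>\<^bsub>U\<^esub> comb n N (\<lambda>a. \<alpha> a x) \<oplus>\<^bsub>U\<^esub> (\<Oplus>\<^bsub>U\<^esub>d\<in>F. c d \<odot>\<^bsub>U\<^esub> comb n N (\<lambda>a. \<alpha> a d))"
    unfolding comb_add comb_smult insert.IH ..
  also have "\<dots> = (\<Oplus>\<^bsub>U\<^esub>d\<in>insert x F. c d \<odot>\<^bsub>U\<^esub> comb n N (\<lambda>a. \<alpha> a d))"
    using insert.hyps comb_closed by (intro U.M.finsum_insert[symmetric]) auto
  finally show ?case .
qed (simp add: comb_zero)

lemma comb_single: "a < k n \<Longrightarrow> comb n N (\<lambda>l. if l = a then 1 else 0) = W n a N"
proof -
  assume a: "a < k n"
  have "comb n N (\<lambda>l. if l = a then 1 else 0) = (\<Oplus>\<^bsub>U\<^esub>l\<in>{a}. 1 \<odot>\<^bsub>U\<^esub> W n l N)"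
    unfolding comb_def
    by (rule U.M.add.finprod_mono_neutral_cong_right) (use a W_closed in auto)
  then show ?thesis using W_closed[OF a] by simp
qed

text \<open>By orthogonality the square of the combination is a weighted sum of the squares of the
  \<open>W n a N\<close>. Replacing each by y^* y, which has norm one, costs 1 / (N + 1) times its
  weight.\<close>

lemma comb_nrm:
  "\<bar>(nrm U (comb n N \<beta>))\<^sup>2 - (\<Sum>a<k n. (cmod (\<beta> a))\<^sup>2)\<bar> \<le> (\<Sum>a<k n. (cmod (\<beta> a))\<^sup>2) * (1 / real (Suc N))"
proof -
  define y where "y = star U (Y n N) \<otimes>\<^bsub>U\<^esub> Y n N"
  define q where "q a = star U (W n a N) \<otimes>\<^bsub>U\<^esub> W n a N" for a
  define r where "r a = (cmod (\<beta> a))\<^sup>2" for a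
  define S where "S = (\<Oplus>\<^bsub>U\<^esub>a\<in>{..<k n}. complex_of_real (r a) \<odot>\<^bsub>U\<^esub> q a)"
  have yc: "y \<in> carrier U" "nrm U y = 1" using Y by (simp_all add: y_def U.cstar_identity)
  have qc: "q a \<in> carrier U" if "a < k n" for a using W_closed[OF that] by (simp add: q_def)
  have Sc: "S \<in> carrier U" unfolding S_def using qc by (intro U.M.finsum_closed) auto
  have "star U (comb n N \<beta>) \<otimes>\<^bsub>U\<^esub> comb n N \<beta> = S"
    unfolding comb_def S_def q_def r_def by (rule U.orthogonal_sum) (use W_closed W_orth in auto)
  then have nS: "(nrm U (comb n N \<beta>))\<^sup>2 = nrm U S" using U.cstar_identity[OF comb_closed[of n N \<beta>]] by simp
  have "(\<Oplus>\<^bsub>U\<^esub>a\<in>F. complex_of_real (r a) \<odot>\<^bsub>U\<^esub> y) = complex_of_real (\<Sum>a\<in>F. r a) \<odot>\<^bsub>U\<^esub> y" if "finite F" for F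
    using that by (induction F rule: finite_induct) (use yc in \<open>simp_all add: U.smult_add_l\<close>)
  from this[of "{..<k n}"] have sy: "(\<Oplus>\<^bsub>U\<^esub>a\<in>{..<k n}. complex_of_real (r a) \<odot>\<^bsub>U\<^esub> y) = complex_of_real (\<Sum>a<k n. r a) \<odot>\<^bsub>U\<^esub> y" by simp
  have "complex_of_real (\<Sum>a<k n. r a) \<odot>\<^bsub>U\<^esub> y \<ominus>\<^bsub>U\<^esub> S
      = (\<Oplus>\<^bsub>U\<^esub>a\<in>{..<k n}. complex_of_real (r a) \<odot>\<^bsub>U\<^esub> y \<ominus>\<^bsub>U\<^esub> complex_of_real (r a) \<odot>\<^bsub>U\<^esub> q a)"
    unfolding sy[symmetric] S_def using yc qc by (intro U.finsum_minus[symmetric]) auto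
  also have "nrm U \<dots> \<le> (\<Sum>a<k n. nrm U (complex_of_real (r a) \<odot>\<^bsub>U\<^esub> y \<ominus>\<^bsub>U\<^esub> complex_of_real (r a) \<odot>\<^bsub>U\<^esub> q a))"
    using yc qc by (intro U.finsum_nrm_le) auto
  also have "\<dots> \<le> (\<Sum>a<k n. r a * (1 / real (Suc N)))"
  proof (rule sum_mono)
    fix a assume "a \<in> {..<k n}"
    then have a: "a < k n" by simp
    have ra: "0 \<le> r a" by (simp add: r_def)
    have "complex_of_real (r a) \<odot>\<^bsub>U\<^esub> y \<ominus>\<^bsub>U\<^esub> complex_of_real (r a) \<odot>\<^bsub>U\<^esub> q a = complex_of_real (r a) \<odot>\<^bsub>U\<^esub> (y \<ominus>\<^bsub>U\<^esub> q a)"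
      by (rule U.coeffs_eq, (rule U.coeffs_rules | (simp add: yc qc[OF a] algebra_simps; fail))+)
    then have "nrm U (complex_of_real (r a) \<odot>\<^bsub>U\<^esub> y \<ominus>\<^bsub>U\<^esub> complex_of_real (r a) \<odot>\<^bsub>U\<^esub> q a) = r a * nrm U (y \<ominus>\<^bsub>U\<^esub> q a)"
      using yc qc[OF a] ra by (simp add: U.nrm_smult)
    also have "\<dots> \<le> r a * (1 / real (Suc N))"
      using Y(3)[OF a] by (intro mult_left_mono) (simp_all add: y_def q_def r_def)
    finally show "nrm U (complex_of_real (r a) \<odot>\<^bsub>U\<^esub> y \<ominus>\<^bsub>U\<^esub> complex_of_real (r a) \<odot>\<^bsub>U\<^esub> q a) \<le> r a * (1 / real (Suc N))" .
  qed
  also have "\<dots> = (\<Sum>a<k n. r a) * (1 / real (Suc N))" by (rule sum_distrib_right[symmetric])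
  finally have d: "nrm U (complex_of_real (\<Sum>a<k n. r a) \<odot>\<^bsub>U\<^esub> y \<ominus>\<^bsub>U\<^esub> S) \<le> (\<Sum>a<k n. r a) * (1 / real (Suc N))" .
  have r0: "0 \<le> (\<Sum>a<k n. r a)" by (intro sum_nonneg) (simp add: r_def)
  then have "nrm U (complex_of_real (\<Sum>a<k n. r a) \<odot>\<^bsub>U\<^esub> y) = (\<Sum>a<k n. r a)"
    using yc by (simp add: U.nrm_smult del: of_real_sum)
  then have "\<bar>nrm U S - (\<Sum>a<k n. r a)\<bar> \<le> (\<Sum>a<k n. r a) * (1 / real (Suc N))"
    using d U.nrm_dist_ge[of "complex_of_real (\<Sum>a<k n. r a) \<odot>\<^bsub>U\<^esub> y" S] U.nrm_dist_ge[of S "complex_of_real (\<Sum>a<k n. r a) \<odot>\<^bsub>U\<^esub> y"]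
      U.nrm_minus_commute[of S "complex_of_real (\<Sum>a<k n. r a) \<odot>\<^bsub>U\<^esub> y"] yc Sc
    by (simp add: abs_le_iff del: of_real_sum)
  then show ?thesis by (simp add: nS r_def)
qed

lemma comb_lim: "(\<lambda>N. nrm U (comb n N \<beta>)) \<longlonglongrightarrow> sqrt (\<Sum>a<k n. (cmod (\<beta> a))\<^sup>2)"
proof -
  define r where "r = (\<Sum>a<k n. (cmod (\<beta> a))\<^sup>2)"
  have z: "(\<lambda>N. r * (1 / real (Suc N))) \<longlonglongrightarrow> 0"
    using tendsto_mult_right_zero[OF LIMSEQ_inverse_real_of_nat, of r] by (simp add: inverse_eq_divide)
  have b: "\<bar>(nrm U (comb n N \<beta>))\<^sup>2 - r\<bar> \<le> \<bar>r * (1 / real (Suc N))\<bar>" for N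
    using comb_nrm[of n N \<beta>] unfolding r_def[symmetric] by (rule order_trans[OF _ abs_ge_self])
  have "(\<lambda>N. (nrm U (comb n N \<beta>))\<^sup>2 - r) \<longlonglongrightarrow> 0"
    by (rule tendsto_0_le[OF z, of _ 1]) (intro always_eventually allI, simp only: real_norm_def mult_1_right b)
  then have "(\<lambda>N. (nrm U (comb n N \<beta>))\<^sup>2) \<longlonglongrightarrow> r" by (rule LIM_zero_cancel)
  then have "(\<lambda>N. sqrt ((nrm U (comb n N \<beta>))\<^sup>2)) \<longlonglongrightarrow> sqrt r" by (rule tendsto_real_sqrt)
  moreover have "(\<lambda>N. sqrt ((nrm U (comb n N \<beta>))\<^sup>2)) = (\<lambda>N. nrm U (comb n N \<beta>))"
    by (intro ext) (simp add: U.nrm_nonneg comb_closed)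
  ultimately show ?thesis unfolding r_def by simp
qed

text \<open>\<open>b\<close> acts on the almost isometric images of \<open>\<complex>\<^sup>k\<close> asymptotically like the matrix \<open>\<alpha>\<close>.\<close>

definition acts :: "nat \<Rightarrow> 'b \<Rightarrow> (nat \<times> nat \<Rightarrow> complex) \<Rightarrow> bool" where
  "acts n b \<alpha> \<longleftrightarrow> b \<in> carrier U \<and>
    (\<forall>d<k n. (\<lambda>N. nrm U (b \<otimes>\<^bsub>U\<^esub> W n d N \<ominus>\<^bsub>U\<^esub> comb n N (\<lambda>a. \<alpha> (a, d)))) \<longlonglongrightarrow> 0)"

lemma acts_closed: "acts n b \<alpha> \<Longrightarrow> b \<in> carrier U"
  by (simp add: acts_def)

lemma null_add:
  assumes "\<And>N. x N \<in> carrier U" "\<And>N. y N \<in> carrier U"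
    "(\<lambda>N. nrm U (x N)) \<longlonglongrightarrow> 0" "(\<lambda>N. nrm U (y N)) \<longlonglongrightarrow> 0"
  shows "(\<lambda>N. nrm U (x N \<oplus>\<^bsub>U\<^esub> y N)) \<longlonglongrightarrow> 0"
proof -
  have "(\<lambda>N. nrm U (x N) + nrm U (y N)) \<longlonglongrightarrow> 0" using assms(3,4) by (rule tendsto_add_zero)
  then show ?thesis
  proof (rule tendsto_0_le[of _ _ _ 1], intro always_eventually allI)
    show "norm (nrm U (x N \<oplus>\<^bsub>U\<^esub> y N)) \<le> norm (nrm U (x N) + nrm U (y N)) * 1" for N
      using U.nrm_triangle[OF assms(1,2), of N N] U.nrm_nonneg[of "x N \<oplus>\<^bsub>U\<^esub> y N"] assms(1,2) by simp
  qed
qed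

lemma null_mult:
  assumes "b \<in> carrier U" "\<And>N. x N \<in> carrier U" "(\<lambda>N. nrm U (x N)) \<longlonglongrightarrow> 0"
  shows "(\<lambda>N. nrm U (b \<otimes>\<^bsub>U\<^esub> x N)) \<longlonglongrightarrow> 0"
proof (rule tendsto_0_le[OF assms(3), of _ "nrm U b"], intro always_eventually allI)
  show "norm (nrm U (b \<otimes>\<^bsub>U\<^esub> x N)) \<le> norm (nrm U (x N)) * nrm U b" for N
    using U.nrm_mult[OF assms(1,2), of N] U.nrm_nonneg[of "b \<otimes>\<^bsub>U\<^esub> x N"] U.nrm_nonneg[of "x N"] assms(1,2)
    by (simp add: mult.commute)
qed

lemma null_smult:
  assumes "\<And>N. x N \<in> carrier U" "(\<lambda>N. nrm U (x N)) \<longlonglongrightarrow> 0"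
  shows "(\<lambda>N. nrm U (c \<odot>\<^bsub>U\<^esub> x N)) \<longlonglongrightarrow> 0"
  using tendsto_mult_right_zero[OF assms(2), of "cmod c"] assms(1) by (simp add: U.nrm_smult)

lemma null_finsum:
  assumes "finite F" "\<And>d N. d \<in> F \<Longrightarrow> x d N \<in> carrier U" "\<And>d. d \<in> F \<Longrightarrow> (\<lambda>N. nrm U (x d N)) \<longlonglongrightarrow> 0"
  shows "(\<lambda>N. nrm U (\<Oplus>\<^bsub>U\<^esub>d\<in>F. x d N)) \<longlonglongrightarrow> 0"
  using assms
proof (induction F rule: finite_induct)
  case (insert a F)
  have "(\<lambda>N. nrm U (x a N \<oplus>\<^bsub>U\<^esub> (\<Oplus>\<^bsub>U\<^esub>d\<in>F. x d N))) \<longlonglongrightarrow> 0"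
    by (rule null_add) (use insert in \<open>auto intro!: U.M.finsum_closed\<close>)
  moreover have "(\<Oplus>\<^bsub>U\<^esub>d\<in>insert a F. x d N) = x a N \<oplus>\<^bsub>U\<^esub> (\<Oplus>\<^bsub>U\<^esub>d\<in>F. x d N)" for N
    by (rule U.M.finsum_insert) (use insert in auto)
  ultimately show ?case by simp
qed simp

lemma acts_comb:
  assumes "acts n b \<alpha>"
  shows "(\<lambda>N. nrm U (b \<otimes>\<^bsub>U\<^esub> comb n N \<beta> \<ominus>\<^bsub>U\<^esub> comb n N (\<lambda>a. \<Sum>d<k n. \<alpha> (a, d) * \<beta> d))) \<longlonglongrightarrow> 0"
proof -
  have b: "b \<in> carrier U" using assms by (rule acts_closed)
  have eq: "b \<otimes>\<^bsub>U\<^esub> comb n N \<beta> \<ominus>\<^bsub>U\<^esub> comb n N (\<lambda>a. \<Sum>d<k n. \<alpha> (a, d) * \<beta> d)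
      = (\<Oplus>\<^bsub>U\<^esub>d\<in>{..<k n}. \<beta> d \<odot>\<^bsub>U\<^esub> (b \<otimes>\<^bsub>U\<^esub> W n d N \<ominus>\<^bsub>U\<^esub> comb n N (\<lambda>a. \<alpha> (a, d))))" for N
  proof -
    have 1: "b \<otimes>\<^bsub>U\<^esub> comb n N \<beta> = (\<Oplus>\<^bsub>U\<^esub>d\<in>{..<k n}. b \<otimes>\<^bsub>U\<^esub> (\<beta> d \<odot>\<^bsub>U\<^esub> W n d N))"
      unfolding comb_def using b W_closed by (intro U.finsum_mult_l) auto
    have 2: "comb n N (\<lambda>a. \<Sum>d<k n. \<alpha> (a, d) * \<beta> d) = (\<Oplus>\<^bsub>U\<^esub>d\<in>{..<k n}. \<beta> d \<odot>\<^bsub>U\<^esub> comb n N (\<lambda>a. \<alpha> (a, d)))"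
      using comb_sum[of "{..<k n}" n N \<beta> "\<lambda>a d. \<alpha> (a, d)"] by (simp add: mult.commute)
    have "b \<otimes>\<^bsub>U\<^esub> comb n N \<beta> \<ominus>\<^bsub>U\<^esub> comb n N (\<lambda>a. \<Sum>d<k n. \<alpha> (a, d) * \<beta> d)
      = (\<Oplus>\<^bsub>U\<^esub>d\<in>{..<k n}. b \<otimes>\<^bsub>U\<^esub> (\<beta> d \<odot>\<^bsub>U\<^esub> W n d N) \<ominus>\<^bsub>U\<^esub> \<beta> d \<odot>\<^bsub>U\<^esub> comb n N (\<lambda>a. \<alpha> (a, d)))"
      unfolding 1 2 using b W_closed comb_closed by (intro U.finsum_minus[symmetric]) auto
    also have "\<dots> = (\<Oplus>\<^bsub>U\<^esub>d\<in>{..<k n}. \<beta> d \<odot>\<^bsub>U\<^esub> (b \<otimes>\<^bsub>U\<^esub> W n d N \<ominus>\<^bsub>U\<^esub> comb n N (\<lambda>a. \<alpha> (a, d))))"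
      using b W_closed comb_closed
      by (intro U.M.finsum_cong') (auto simp: U.smult_mult_r U.minus_smult U.smult_add_r mult.commute)
    finally show ?thesis .
  qed
  show ?thesis
    unfolding eq
    by (intro null_finsum null_smult) (use assms b W_closed comb_closed in \<open>auto simp: acts_def\<close>)
qed

text \<open>The copies become isometric as N grows. The inequality for b applied to a combination
  therefore turns, in the limit, into the operator norm inequality for the matrix. Contractivity of
  the map back to E rests on this.\<close>

lemma acts_bound:
  assumes "acts n b \<alpha>" shows "nrm E (lin n \<alpha>) \<le> nrm U b"
proof (rule nrm_lin_le)
  have b: "b \<in> carrier U" using assms by (rule acts_closed)
  show "0 \<le> nrm U b" using b by (rule U.nrm_nonneg)
  fix \<beta> :: "nat \<Rightarrow> complex"
  let ?\<gamma> = "\<lambda>a. \<Sum>d<k n. \<alpha> (a, d) * \<beta> d"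
  have "nrm U (comb n N ?\<gamma>) \<le> nrm U b * nrm U (comb n N \<beta>) + nrm U (b \<otimes>\<^bsub>U\<^esub> comb n N \<beta> \<ominus>\<^bsub>U\<^esub> comb n N ?\<gamma>)" for N
    using U.nrm_dist_ge[of "comb n N ?\<gamma>" "b \<otimes>\<^bsub>U\<^esub> comb n N \<beta>"] U.nrm_mult[OF b comb_closed, of n N \<beta>]
      U.nrm_minus_commute[of "comb n N ?\<gamma>" "b \<otimes>\<^bsub>U\<^esub> comb n N \<beta>"] b comb_closed[of n N]
    by simp
  moreover have "(\<lambda>N. nrm U b * nrm U (comb n N \<beta>) + nrm U (b \<otimes>\<^bsub>U\<^esub> comb n N \<beta> \<ominus>\<^bsub>U\<^esub> comb n N ?\<gamma>))
      \<longlonglongrightarrow> nrm U b * sqrt (\<Sum>a<k n. (cmod (\<beta> a))\<^sup>2) + 0"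
    by (intro tendsto_intros comb_lim acts_comb[OF assms])
  ultimately show "sqrt (\<Sum>a<k n. (cmod (?\<gamma> a))\<^sup>2) \<le> nrm U b * sqrt (\<Sum>a<k n. (cmod (\<beta> a))\<^sup>2)"
    using LIMSEQ_le[OF comb_lim[of n ?\<gamma>], of _ "nrm U b * sqrt (\<Sum>a<k n. (cmod (\<beta> a))\<^sup>2) + 0"] by simp
qed

lemma acts_add:
  assumes "acts n b \<alpha>" "acts n c \<beta>" shows "acts n (b \<oplus>\<^bsub>U\<^esub> c) (\<lambda>q. \<alpha> q + \<beta> q)"
  unfolding acts_def
proof (intro conjI allI impI)
  have c: "b \<in> carrier U" "c \<in> carrier U" using assms acts_closed by auto
  then show "b \<oplus>\<^bsub>U\<^esub> c \<in> carrier U" by simp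
  fix d assume d: "d < k n"
  have "(b \<oplus>\<^bsub>U\<^esub> c) \<otimes>\<^bsub>U\<^esub> W n d N \<ominus>\<^bsub>U\<^esub> comb n N (\<lambda>a. \<alpha> (a, d) + \<beta> (a, d))
      = (b \<otimes>\<^bsub>U\<^esub> W n d N \<ominus>\<^bsub>U\<^esub> comb n N (\<lambda>a. \<alpha> (a, d))) \<oplus>\<^bsub>U\<^esub> (c \<otimes>\<^bsub>U\<^esub> W n d N \<ominus>\<^bsub>U\<^esub> comb n N (\<lambda>a. \<beta> (a, d)))" for N
    unfolding comb_add
    apply (simp add: c W_closed[OF d] U.mult_l_distr)
    by (rule U.coeffs_eq, (rule U.coeffs_rules | (simp add: c W_closed[OF d] comb_closed algebra_simps; fail))+)
  then show "(\<lambda>N. nrm U ((b \<oplus>\<^bsub>U\<^esub> c) \<otimes>\<^bsub>U\<^esub> W n d N \<ominus>\<^bsub>U\<^esub> comb n N (\<lambda>a. \<alpha> (a, d) + \<beta> (a, d)))) \<longlonglongrightarrow> 0"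
    using assms d c W_closed[OF d] comb_closed by (simp add: acts_def null_add)
qed

lemma acts_smult:
  assumes "acts n b \<alpha>" shows "acts n (r \<odot>\<^bsub>U\<^esub> b) (\<lambda>q. r * \<alpha> q)"
  unfolding acts_def
proof (intro conjI allI impI)
  have c: "b \<in> carrier U" using assms acts_closed by auto
  then show "r \<odot>\<^bsub>U\<^esub> b \<in> carrier U" by simp
  fix d assume d: "d < k n"
  have "(r \<odot>\<^bsub>U\<^esub> b) \<otimes>\<^bsub>U\<^esub> W n d N \<ominus>\<^bsub>U\<^esub> comb n N (\<lambda>a. r * \<alpha> (a, d))
      = r \<odot>\<^bsub>U\<^esub> (b \<otimes>\<^bsub>U\<^esub> W n d N \<ominus>\<^bsub>U\<^esub> comb n N (\<lambda>a. \<alpha> (a, d)))" for N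
    unfolding comb_smult
    apply (simp add: c W_closed[OF d] U.smult_mult_l)
    by (rule U.coeffs_eq, (rule U.coeffs_rules | (simp add: c W_closed[OF d] comb_closed algebra_simps; fail))+)
  then show "(\<lambda>N. nrm U ((r \<odot>\<^bsub>U\<^esub> b) \<otimes>\<^bsub>U\<^esub> W n d N \<ominus>\<^bsub>U\<^esub> comb n N (\<lambda>a. r * \<alpha> (a, d)))) \<longlonglongrightarrow> 0"
    using assms d c W_closed[OF d] comb_closed by (simp add: acts_def null_smult)
qed

lemma acts_mult:
  assumes "acts n b \<alpha>" "acts n c \<beta>" shows "acts n (b \<otimes>\<^bsub>U\<^esub> c) (\<lambda>(i, j). \<Sum>l<k n. \<alpha> (i, l) * \<beta> (l, j))"
  unfolding acts_def
proof (intro conjI allI impI)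
  have c: "b \<in> carrier U" "c \<in> carrier U" using assms acts_closed by auto
  then show "b \<otimes>\<^bsub>U\<^esub> c \<in> carrier U" by simp
  fix d assume d: "d < k n"
  let ?s = "\<lambda>a. \<Sum>l<k n. \<alpha> (a, l) * \<beta> (l, d)"
  \<comment> \<open>First c is replaced by its matrix, which leaves an error multiplied by the fixed
    element b; then b acts on a combination whose coefficients do not depend on N.\<close>
  have eq: "(b \<otimes>\<^bsub>U\<^esub> c) \<otimes>\<^bsub>U\<^esub> W n d N \<ominus>\<^bsub>U\<^esub> comb n N ?s
      = b \<otimes>\<^bsub>U\<^esub> (c \<otimes>\<^bsub>U\<^esub> W n d N \<ominus>\<^bsub>U\<^esub> comb n N (\<lambda>a. \<beta> (a, d)))
        \<oplus>\<^bsub>U\<^esub> (b \<otimes>\<^bsub>U\<^esub> comb n N (\<lambda>a. \<beta> (a, d)) \<ominus>\<^bsub>U\<^esub> comb n N ?s)" for N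
    apply (simp add: c W_closed[OF d] comb_closed U.mult_minus_r U.mult_assoc)
    by (rule U.coeffs_eq, (rule U.coeffs_rules | (simp add: c W_closed[OF d] comb_closed algebra_simps; fail))+)
  have "(\<lambda>N. nrm U ((b \<otimes>\<^bsub>U\<^esub> c) \<otimes>\<^bsub>U\<^esub> W n d N \<ominus>\<^bsub>U\<^esub> comb n N ?s)) \<longlonglongrightarrow> 0"
    unfolding eq
    by (intro null_add null_mult acts_comb assms)
      (use assms d c W_closed[OF d] comb_closed in \<open>auto simp: acts_def\<close>)
  then show "(\<lambda>N. nrm U ((b \<otimes>\<^bsub>U\<^esub> c) \<otimes>\<^bsub>U\<^esub> W n d N \<ominus>\<^bsub>U\<^esub> comb n N (\<lambda>a. case (a, d) of (i, j) \<Rightarrow> \<Sum>l<k n. \<alpha> (i, l) * \<beta> (l, j)))) \<longlonglongrightarrow> 0"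
    by simp
qed

lemma acts_zero: "acts n \<zero>\<^bsub>U\<^esub> (\<lambda>_. 0)"
  unfolding acts_def using W_closed by (simp add: comb_zero)

lemma acts_f:
  assumes ab: "R n a b" shows "acts n (f n a b) (\<lambda>q. if q = (a, b) then 1 else 0)"
  unfolding acts_def
proof (intro conjI allI impI)
  show "f n a b \<in> carrier U" by (rule f_closed[OF ab])
  fix d assume d: "d < k n"
  have a: "a < k n" using R_less[OF ab] by simp
  have "f n a b \<otimes>\<^bsub>U\<^esub> W n d N \<ominus>\<^bsub>U\<^esub> comb n N (\<lambda>l. if (l, d) = (a, b) then 1 else 0) = \<zero>\<^bsub>U\<^esub>" for N
    by (cases "d = b") (use f_W[OF ab d] comb_single[OF a] comb_zero W_closed[OF a] in simp_all)
  then show "(\<lambda>N. nrm U (f n a b \<otimes>\<^bsub>U\<^esub> W n d N \<ominus>\<^bsub>U\<^esub> comb n N (\<lambda>l. if (l, d) = (a, b) then 1 else 0))) \<longlonglongrightarrow> 0"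
    by (simp only: U.nrm_zero tendsto_const)
qed

text \<open>On \<open>W n a\<close> the adjoint agrees with its matrix only in the limit, by
  \<open>f_star_W\<close>; the remaining basis vectors are annihilated exactly.\<close>

lemma acts_f_star:
  assumes ab: "R n a b" shows "acts n (star U (f n a b)) (\<lambda>q. if q = (b, a) then 1 else 0)"
  unfolding acts_def
proof (intro conjI allI impI)
  show "star U (f n a b) \<in> carrier U" using f_closed[OF ab] by simp
  fix d assume d: "d < k n"
  have b: "a < k n" "b < k n" using R_less[OF ab] by simp_all
  show "(\<lambda>N. nrm U (star U (f n a b) \<otimes>\<^bsub>U\<^esub> W n d N \<ominus>\<^bsub>U\<^esub> comb n N (\<lambda>l. if (l, d) = (b, a) then 1 else 0))) \<longlonglongrightarrow> 0"
  proof (cases "d = a")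
    case False
    then have "star U (f n a b) \<otimes>\<^bsub>U\<^esub> W n d N \<ominus>\<^bsub>U\<^esub> comb n N (\<lambda>l. if (l, d) = (b, a) then 1 else 0) = \<zero>\<^bsub>U\<^esub>" for N
      using f_star_W_zero[OF ab d] comb_zero by simp
    then show ?thesis by (simp only: U.nrm_zero tendsto_const)
  next
    case True
    have "(\<lambda>N. sqrt (2 * (1 / real (Suc N)))) \<longlonglongrightarrow> sqrt (2 * 0)"
      using LIMSEQ_inverse_real_of_nat by (intro tendsto_intros) (simp add: inverse_eq_divide)
    then have z: "(\<lambda>N. sqrt (2 / real (Suc N))) \<longlonglongrightarrow> 0" by simp
    have "(\<lambda>N. nrm U (star U (f n a b) \<otimes>\<^bsub>U\<^esub> W n a N \<ominus>\<^bsub>U\<^esub> W n b N)) \<longlonglongrightarrow> 0"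
    proof (rule tendsto_0_le[OF z, of _ 1], intro always_eventually allI)
      show "norm (nrm U (star U (f n a b) \<otimes>\<^bsub>U\<^esub> W n a N \<ominus>\<^bsub>U\<^esub> W n b N)) \<le> norm (sqrt (2 / real (Suc N))) * 1" for N
        using f_star_W[OF ab, of N] U.nrm_nonneg[of "star U (f n a b) \<otimes>\<^bsub>U\<^esub> W n a N \<ominus>\<^bsub>U\<^esub> W n b N"]
          f_closed[OF ab] W_closed[OF b(1)] W_closed[OF b(2)] by simp
    qed
    then show ?thesis using True comb_single[OF b(2)] by simp
  qed
qed

text \<open>The asymptotic action of b on the copies does not by itself give the action of its
  adjoint. Recording both makes the relation stable under adjoints.\<close>

definition star_acts :: "nat \<Rightarrow> 'b \<Rightarrow> 'e \<Rightarrow> bool" where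
  "star_acts n b x \<longleftrightarrow> (\<exists>\<alpha>. x = lin n \<alpha> \<and> acts n b \<alpha> \<and> acts n (star U b) (\<lambda>(i, j). cnj (\<alpha> (j, i))))"

lemma star_actsE:
  assumes "star_acts n b x"
  obtains \<alpha> where "x = lin n \<alpha>" "acts n b \<alpha>" "acts n (star U b) (\<lambda>(i, j). cnj (\<alpha> (j, i)))"
  using assms unfolding star_acts_def by blast

lemma star_acts_bound: "star_acts n b x \<Longrightarrow> nrm E x \<le> nrm U b"
  using acts_bound unfolding star_acts_def by blast

lemma star_acts_closed: "star_acts n b x \<Longrightarrow> b \<in> carrier U \<and> x \<in> carrier E"
  unfolding star_acts_def using acts_closed by auto

lemma star_acts_add:
  assumes "star_acts n b x" "star_acts n c y" shows "star_acts n (b \<oplus>\<^bsub>U\<^esub> c) (x \<oplus> y)"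
proof -
  obtain \<alpha> where a: "x = lin n \<alpha>" "acts n b \<alpha>" "acts n (star U b) (\<lambda>(i, j). cnj (\<alpha> (j, i)))" using star_actsE[OF assms(1)] .
  obtain \<beta> where b: "y = lin n \<beta>" "acts n c \<beta>" "acts n (star U c) (\<lambda>(i, j). cnj (\<beta> (j, i)))" using star_actsE[OF assms(2)] .
  have s: "star U (b \<oplus>\<^bsub>U\<^esub> c) = star U b \<oplus>\<^bsub>U\<^esub> star U c" by (rule U.star_add) (use a b acts_closed in auto)
  have e: "(\<lambda>(i, j). cnj (\<alpha> (j, i) + \<beta> (j, i))) = (\<lambda>q. (case q of (i, j) \<Rightarrow> cnj (\<alpha> (j, i))) + (case q of (i, j) \<Rightarrow> cnj (\<beta> (j, i))))"
    by auto
  show ?thesis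
    unfolding star_acts_def
    by (rule exI[of _ "\<lambda>q. \<alpha> q + \<beta> q"]) (simp only: s e a(1) b(1) lin_add acts_add a(2,3) b(2,3) simp_thms)
qed

lemma star_acts_smult:
  assumes "star_acts n b x" shows "star_acts n (r \<odot>\<^bsub>U\<^esub> b) (r \<odot> x)"
proof -
  obtain \<alpha> where a: "x = lin n \<alpha>" "acts n b \<alpha>" "acts n (star U b) (\<lambda>(i, j). cnj (\<alpha> (j, i)))" using star_actsE[OF assms(1)] .
  have s: "star U (r \<odot>\<^bsub>U\<^esub> b) = cnj r \<odot>\<^bsub>U\<^esub> star U b" by (rule U.star_smult) (use a acts_closed in auto)
  have e: "(\<lambda>(i, j). cnj (r * \<alpha> (j, i))) = (\<lambda>q. cnj r * (case q of (i, j) \<Rightarrow> cnj (\<alpha> (j, i))))"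
    by auto
  show ?thesis
    unfolding star_acts_def
    by (rule exI[of _ "\<lambda>q. r * \<alpha> q"]) (simp only: s e a(1) lin_smult acts_smult a(2,3) simp_thms)
qed

lemma star_acts_mult:
  assumes "star_acts n b x" "star_acts n c y" shows "star_acts n (b \<otimes>\<^bsub>U\<^esub> c) (x \<otimes> y)"
proof -
  obtain \<alpha> where a: "x = lin n \<alpha>" "acts n b \<alpha>" "acts n (star U b) (\<lambda>(i, j). cnj (\<alpha> (j, i)))" using star_actsE[OF assms(1)] .
  obtain \<beta> where b: "y = lin n \<beta>" "acts n c \<beta>" "acts n (star U c) (\<lambda>(i, j). cnj (\<beta> (j, i)))" using star_actsE[OF assms(2)] .
  let ?\<gamma> = "\<lambda>(i, j). \<Sum>l<k n. \<alpha> (i, l) * \<beta> (l, j)"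
  have s: "star U (b \<otimes>\<^bsub>U\<^esub> c) = star U c \<otimes>\<^bsub>U\<^esub> star U b" by (rule U.star_mult) (use a b acts_closed in auto)
  have "(\<lambda>(i, j). cnj (?\<gamma> (j, i))) = (\<lambda>(i, j). \<Sum>l<k n. (case (i, l) of (i, j) \<Rightarrow> cnj (\<beta> (j, i))) * (case (l, j) of (i, j) \<Rightarrow> cnj (\<alpha> (j, i))))"
    by (auto simp: mult.commute)
  then have "acts n (star U (b \<otimes>\<^bsub>U\<^esub> c)) (\<lambda>(i, j). cnj (?\<gamma> (j, i)))"
    using acts_mult[OF b(3) a(3)] s by simp
  then show ?thesis
    unfolding star_acts_def a(1) b(1) lin_mult using acts_mult[OF a(2) b(2)] by blast
qed

lemma star_acts_star:
  assumes "star_acts n b x" shows "star_acts n (star U b) (star E x)"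
proof -
  obtain \<alpha> where a: "x = lin n \<alpha>" "acts n b \<alpha>" "acts n (star U b) (\<lambda>(i, j). cnj (\<alpha> (j, i)))" using star_actsE[OF assms(1)] .
  have "(\<lambda>(i, j). cnj ((\<lambda>(i, j). cnj (\<alpha> (j, i))) (j, i))) = \<alpha>" by auto
  then have "acts n (star U (star U b)) (\<lambda>(i, j). cnj ((\<lambda>(i, j). cnj (\<alpha> (j, i))) (j, i)))"
    using a(2) acts_closed[OF a(2)] by (simp add: U.star_star)
  then show ?thesis unfolding star_acts_def a(1) lin_star using a(3) by blast
qed

text \<open>The map i is controlled only on the algebra, so x is expanded in units that belong to
  it, and the partial sums are followed one term at a time.\<close>

lemma star_acts_level:
  assumes "x \<in> level n" shows "star_acts n (i x) x"
proof -
  obtain \<alpha> where a: "x = lin n \<alpha>" "\<And>i j. \<alpha> (i, j) \<noteq> 0 \<Longrightarrow> R n i j" using assms unfolding level_def by auto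
  let ?F = "{q \<in> {..<k n} \<times> {..<k n}. R n (fst q) (snd q)}"
  have "x = lin n (\<lambda>q. if q \<in> ?F then \<alpha> q else 0)"
    unfolding a(1) using a(2) by (intro lin_cong) auto
  also have "\<dots> = (\<Oplus>q\<in>?F. \<alpha> q \<odot> u n (fst q) (snd q))" by (rule lin_sum) auto
  finally have x: "x = (\<Oplus>q\<in>?F. \<alpha> q \<odot> u n (fst q) (snd q))" .
  have unit: "star_acts n (i (u n a b)) (u n a b)" if "R n a b" for a b
  proof -
    have e: "(\<lambda>(i, j). cnj (if (j, i) = (a, b) then 1 else 0)) = (\<lambda>q. if q = (b, a) then 1 else (0::complex))" by auto
    show ?thesis
      unfolding star_acts_def
      by (rule exI[of _ "\<lambda>q. if q = (a, b) then 1 else 0"])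
        (simp only: e f_def[symmetric] acts_f[OF that] acts_f_star[OF that] u_def[symmetric] simp_thms)
  qed
  have zero: "star_acts n (i \<zero>) \<zero>"
  proof -
    have e: "(\<lambda>(i, j). cnj ((\<lambda>_. 0) (j, i))) = (\<lambda>_::nat \<times> nat. 0::complex)" by auto
    show ?thesis
      unfolding star_acts_def
      by (rule exI[of _ "\<lambda>_. 0"]) (simp only: i_zero U.star_zero acts_zero lin_zero e simp_thms)
  qed
  have part: "star_acts n (i (\<Oplus>q\<in>F. \<alpha> q \<odot> u n (fst q) (snd q))) (\<Oplus>q\<in>F. \<alpha> q \<odot> u n (fst q) (snd q))" if "finite F" "F \<subseteq> ?F" for F
    using that
  proof (induction F rule: finite_induct)
    case (insert q F)
    have q: "R n (fst q) (snd q)" using insert.prems by auto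
    have ualg: "u n (fst q) (snd q) \<in> alg" by (rule u_alg[OF q])
    have Falg: "(\<Oplus>q\<in>F. \<alpha> q \<odot> u n (fst q) (snd q)) \<in> alg"
      by (rule finsum_mem) (use insert alg_closed alg_carrier u_alg in auto)
    have e: "(\<Oplus>q\<in>insert q F. \<alpha> q \<odot> u n (fst q) (snd q)) = \<alpha> q \<odot> u n (fst q) (snd q) \<oplus> (\<Oplus>q\<in>F. \<alpha> q \<odot> u n (fst q) (snd q))"
      using insert.hyps by (intro M.finsum_insert) auto
    have ie: "i (\<Oplus>q\<in>insert q F. \<alpha> q \<odot> u n (fst q) (snd q))
        = \<alpha> q \<odot>\<^bsub>U\<^esub> i (u n (fst q) (snd q)) \<oplus>\<^bsub>U\<^esub> i (\<Oplus>q\<in>F. \<alpha> q \<odot> u n (fst q) (snd q))"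
      unfolding e using i_simps(2)[OF alg_closed(4)[OF ualg] Falg] i_simps(4)[OF ualg] by simp
    show ?case unfolding ie unfolding e
      by (intro star_acts_add star_acts_smult unit[OF q] insert.IH) (use insert.prems in auto)
  qed (simp add: zero)
  then show ?thesis unfolding x by (intro part) auto
qed

end

section \<open>The limit algebra as its own C*-envelope\<close>

context tree_refinement
begin

text \<open>A *-polynomial in represented elements is paired with the same polynomial in E. The
  construction starts from the levels, not from their closure, so that every pair is already visible
  in some finite matrix algebra.\<close>

inductive_set graph :: "'b cstar \<Rightarrow> ('e \<Rightarrow> 'b) \<Rightarrow> ('b \<times> 'e) set" for B i where
  graph_level: "x \<in> level n \<Longrightarrow> (i x, x) \<in> graph B i"
| graph_add: "\<lbrakk>(b, x) \<in> graph B i; (c, y) \<in> graph B i\<rbrakk> \<Longrightarrow> (b \<oplus>\<^bsub>B\<^esub> c, x \<oplus> y) \<in> graph B i"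
| graph_mult: "\<lbrakk>(b, x) \<in> graph B i; (c, y) \<in> graph B i\<rbrakk> \<Longrightarrow> (b \<otimes>\<^bsub>B\<^esub> c, x \<otimes> y) \<in> graph B i"
| graph_smult: "(b, x) \<in> graph B i \<Longrightarrow> (a \<odot>\<^bsub>B\<^esub> b, a \<odot> x) \<in> graph B i"
| graph_star: "(b, x) \<in> graph B i \<Longrightarrow> (star B b, star E x) \<in> graph B i"

lemma envelope_map:
  assumes B: "cstar_algebra B" and hom: "alg_hom E alg B i"
    and iso: "\<And>x. x \<in> alg \<Longrightarrow> nrm B (i x) = nrm E x"
    and gen: "cstar_generated B (i ` alg) = carrier B"
  shows "\<exists>\<pi>. star_hom B E \<pi> \<and> (\<forall>x\<in>alg. \<pi> (i x) = x)"
proof -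
  interpret B: cstar_algebra B by fact
  interpret U: unital_cstar_algebra "unitization B" by (rule B.unital_unitization)
  interpret I: isometric_rep E G k \<iota> "unitization B" "\<lambda>x. (i x, 0)"
  proof
    show "alg_hom E alg (unitization B) (\<lambda>x. (i x, 0))"
      using alg_hom_simps[OF hom] unfolding alg_hom_def by auto
    show "nrm (unitization B) (i x, 0) = nrm E x" if "x \<in> alg" for x
      using iso[OF that] alg_hom_simps(1)[OF hom that] by (simp add: B.nrm_unitization_embed del: unitization_simps(8))
  qed
  \<comment> \<open>A polynomial involves finitely many levels and acts correctly at all
    sufficiently high ones. Asking for all n beyond a threshold lets two polynomials be
    combined.\<close>
  have key: "b \<in> carrier B \<and> (\<exists>m. \<forall>n\<ge>m. I.star_acts n (b, 0) x)" if "(b, x) \<in> graph B i" for b x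
    using that
  proof (induction rule: graph.induct)
    case (graph_level x n)
    have "I.star_acts m (i x, 0) x" if "m \<ge> n" for m
      by (rule I.star_acts_level) (use graph_level level_mono[OF that] in blast)
    then show ?case using alg_hom_simps(1)[OF hom] graph_level level_alg by blast
  next
    case (graph_add b x c y)
    then obtain m m' where m: "\<And>n. n \<ge> m \<Longrightarrow> I.star_acts n (b, 0) x" "\<And>n. n \<ge> m' \<Longrightarrow> I.star_acts n (c, 0) y" by blast
    have "I.star_acts n (b \<oplus>\<^bsub>B\<^esub> c, 0) (x \<oplus> y)" if "n \<ge> max m m'" for n
      using I.star_acts_add[OF m(1) m(2), of n] that by simp
    then show ?case using graph_add.IH by (intro conjI exI[of _ "max m m'"]) auto
  next
    case (graph_mult b x c y)
    then obtain m m' where m: "\<And>n. n \<ge> m \<Longrightarrow> I.star_acts n (b, 0) x" "\<And>n. n \<ge> m' \<Longrightarrow> I.star_acts n (c, 0) y" by blast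
    have "I.star_acts n (b \<otimes>\<^bsub>B\<^esub> c, 0) (x \<otimes> y)" if "n \<ge> max m m'" for n
      using I.star_acts_mult[OF m(1) m(2), of n] that graph_mult by simp
    then show ?case using graph_mult.IH by (intro conjI exI[of _ "max m m'"]) auto
  next
    case (graph_smult b x a)
    then obtain m where m: "\<And>n. n \<ge> m \<Longrightarrow> I.star_acts n (b, 0) x" by blast
    have "I.star_acts n (a \<odot>\<^bsub>B\<^esub> b, 0) (a \<odot> x)" if "n \<ge> m" for n
      using I.star_acts_smult[OF m, of n a] that by simp
    then show ?case using graph_smult.IH by (intro conjI exI[of _ m]) auto
  next
    case (graph_star b x)
    then obtain m where m: "\<And>n. n \<ge> m \<Longrightarrow> I.star_acts n (b, 0) x" by blast
    have "I.star_acts n (star B b, 0) (star E x)" if "n \<ge> m" for n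
      using I.star_acts_star[OF m, of n] that by simp
    then show ?case using graph_star.IH by (intro conjI exI[of _ m]) auto
  qed
  interpret \<Gamma>: star_graph B E "graph B i"
  proof
    show "graph B i \<subseteq> carrier B \<times> carrier E"
      using key I.star_acts_closed by fastforce
    show "nrm E x \<le> nrm B b" if "(b, x) \<in> graph B i" for b x
    proof -
      obtain n where "I.star_acts n (b, 0) x" and b: "b \<in> carrier B" using key[OF \<open>(b, x) \<in> graph B i\<close>] by blast
      then have "nrm E x \<le> nrm (unitization B) (b, 0)" by (rule_tac I.star_acts_bound)
      then show ?thesis using B.nrm_unitization_embed[OF b] by simp
    qed
  qed (fact graph_add graph_mult graph_smult graph_star)+
  have iconv: "B.conv (\<lambda>n. i (v n)) (i x)" if v: "\<And>n. v n \<in> alg" "conv v x" and x: "x \<in> alg" for v x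
  proof (rule B.conv_bound)
    have "i (v n) \<ominus>\<^bsub>B\<^esub> i x = i (v n \<ominus> x)" for n
      by (rule alg_hom_minus[OF cstar_algebra_axioms B hom alg_carrier _ v(1) x, symmetric]) (rule alg_closed)
    moreover have "v n \<ominus> x \<in> alg" for n
      using v(1)[of n] x alg_closed alg_carrier by (subst minus_smult) auto
    ultimately show "nrm B (i (v n) \<ominus>\<^bsub>B\<^esub> i x) \<le> nrm E (v n \<ominus> x)" for n by (simp add: iso)
    show "(\<lambda>n. nrm E (v n \<ominus> x)) \<longlonglongrightarrow> 0" using v(2) by (simp add: conv_def)
  qed (use alg_hom_simps(1)[OF hom] v x in auto)
  \<comment> \<open>Elements of the algebra outside the levels enter through the closure of the
    relation, since i is isometric and hence continuous.\<close>
  have lim: "\<Gamma>.lim (i x) x" if x: "x \<in> alg" for x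
  proof -
    obtain v where v: "\<And>n. v n \<in> (\<Union>n. level n)" "conv v x"
      using closure_seq[OF x[unfolded alg_eq] union_level_carrier] by blast
    have "v n \<in> alg" for n using v(1) level_alg by blast
    then have c: "B.conv (\<lambda>n. i (v n)) (i x)" using v(2) x by (rule iconv)
    have "(i (v n), v n) \<in> graph B i" for n using v(1)[of n] graph_level by blast
    then show ?thesis by (rule \<Gamma>.limI[OF _ c v(2)])
  qed
  have sub: "fst ` graph B i \<subseteq> carrier B" using \<Gamma>.graph_carrier by auto
  have dom: "b \<in> fst ` graph B i \<longleftrightarrow> (\<exists>x. (b, x) \<in> graph B i)" for b by force
  \<comment> \<open>The closure of the domain is a norm-closed self-adjoint subalgebra containing
    the image of the algebra. As that image generates B, the domain is dense.\<close>
  have "operator_algebra B (cstar_closure B (fst ` graph B i))"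
  proof (rule B.operator_algebra_closure[OF sub])
    have "(0 \<odot>\<^bsub>B\<^esub> i (lin 0 (\<lambda>_. 0)), 0 \<odot> lin 0 (\<lambda>_. 0)) \<in> graph B i"
      by (rule graph_smult[OF graph_level[of _ 0]]) (auto simp: level_def)
    moreover have "i (lin 0 (\<lambda>_. 0)) \<in> carrier B"
      by (rule alg_hom_simps(1)[OF hom]) (simp add: lin_zero alg_closed)
    ultimately show "\<zero>\<^bsub>B\<^esub> \<in> fst ` graph B i" unfolding dom by auto
    fix b c
    assume "b \<in> fst ` graph B i"
    then obtain x where x: "(b, x) \<in> graph B i" unfolding dom ..
    show "a \<odot>\<^bsub>B\<^esub> b \<in> fst ` graph B i" for a unfolding dom by (rule exI, rule graph_smult[OF x])
    assume "c \<in> fst ` graph B i"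
    then obtain y where y: "(c, y) \<in> graph B i" unfolding dom ..
    show "b \<oplus>\<^bsub>B\<^esub> c \<in> fst ` graph B i" unfolding dom by (rule exI, rule graph_add[OF x y])
    show "b \<otimes>\<^bsub>B\<^esub> c \<in> fst ` graph B i" unfolding dom by (rule exI, rule graph_mult[OF x y])
  qed
  moreover have "star B ` cstar_closure B (fst ` graph B i) \<subseteq> cstar_closure B (fst ` graph B i)"
  proof
    fix b assume "b \<in> star B ` cstar_closure B (fst ` graph B i)"
    then obtain c where c: "b = star B c" "c \<in> cstar_closure B (fst ` graph B i)" by blast
    have "star B d \<in> fst ` graph B i" if d: "d \<in> fst ` graph B i" for d
    proof -
      obtain x where x: "(d, x) \<in> graph B i" using d unfolding dom ..
      show ?thesis unfolding dom by (rule exI, rule graph_star[OF x])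
    qed
    then show "b \<in> cstar_closure B (fst ` graph B i)" unfolding c(1) by (rule B.star_closure[OF sub _ c(2)])
  qed
  moreover have "i ` alg \<subseteq> cstar_closure B (fst ` graph B i)"
  proof
    fix b assume "b \<in> i ` alg"
    then obtain x where x: "x \<in> alg" "b = i x" by blast
    obtain c y where c: "\<And>n. (c n, y n) \<in> graph B i" "B.conv c (i x)" using \<Gamma>.limE[OF lim[OF x(1)]] by metis
    have "c n \<in> fst ` graph B i" for n unfolding dom by (rule exI, rule c(1))
    then show "b \<in> cstar_closure B (fst ` graph B i)"
      unfolding x(2) by (rule B.conv_closure[OF c(2)])
  qed
  ultimately have "carrier B \<subseteq> cstar_closure B (fst ` graph B i)"
    unfolding gen[symmetric] cstar_generated_def by (intro Inter_lower) blast
  then obtain \<pi> where "star_hom B E \<pi>" "\<forall>b x. \<Gamma>.lim b x \<longrightarrow> \<pi> b = x" using \<Gamma>.extension by blast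
  then show ?thesis using lim by blast
qed

lemma semi_dirichlet: "semi_dirichlet E alg"
proof -
  have "cstar_envelope E alg E (\<lambda>x. x)"
    unfolding cstar_envelope_def
  proof (intro conjI allI impI cover)
    fix B :: "'e cstar" and i
    assume c: "cstar_cover E alg B i"
    then have B: "cstar_algebra B" "alg_hom E alg B i" "completely_isometric E alg B i" "cstar_generated B (i ` alg) = carrier B"
      unfolding cstar_cover_def by auto
    show "\<exists>\<pi>. star_hom B E \<pi> \<and> (\<forall>x\<in>alg. \<pi> (i x) = x)"
      by (rule envelope_map[OF B(1,2) _ B(4)])
        (rule completely_isometric_nrm[OF cstar_algebra_axioms B(1,3,2) alg_carrier])
  qed
  moreover have "(\<lambda>x. x) ` alg = alg" by simp
  ultimately show ?thesis
    unfolding semi_dirichlet_def using alg_star_mult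
    by (intro exI[of _ E] exI[of _ "\<lambda>x. x"]) simp
qed

end

section \<open>Gauge action and order ideals of a tensor algebra\<close>

definition unit_root :: "nat \<Rightarrow> nat \<Rightarrow> complex" where
  "unit_root M a = cis (2 * pi * real a / real M)"

lemma cmod_unit_root [simp]: "cmod (unit_root M a) = 1"
  by (simp add: unit_root_def)

text \<open>For p different from q this is a geometric sum whose ratio is an M-th root of unity; the
  bounds on p and q ensure that the ratio is not 1.\<close>

lemma unit_root_orthogonal:
  assumes "p < M" "q < M"
  shows "(\<Sum>a<M. unit_root M a ^ p * cnj (unit_root M a ^ q)) = (if p = q then of_nat M else 0)"
proof (cases "p = q")
  case True
  have "unit_root M a ^ p * cnj (unit_root M a ^ p) = 1" for a
    by (simp only: complex_norm_square[symmetric] norm_power cmod_unit_root power_one of_real_1)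
  then show ?thesis using True by simp
next
  case False
  define r where "r = unit_root M p * cnj (unit_root M q)"
  have pw: "unit_root M a ^ c = unit_root M c ^ a" for a c
    by (simp add: unit_root_def DeMoivre mult.commute mult.left_commute)
  have r: "unit_root M a ^ p * cnj (unit_root M a ^ q) = r ^ a" for a
    unfolding r_def power_mult_distrib complex_cnj_power[symmetric] pw[of a p] pw[of a q] by simp
  have M: "M > 0" using assms by simp
  have one: "unit_root M c ^ M = 1" for c
    using M by (simp add: unit_root_def DeMoivre)
  have rM: "r ^ M = 1" unfolding r_def power_mult_distrib complex_cnj_power[symmetric] one by simp
  have "r \<noteq> 1"
  proof
    assume "r = 1"
    then have "r * unit_root M q = unit_root M q" by simp
    moreover have "r * unit_root M q = unit_root M p * (unit_root M q * cnj (unit_root M q))" by (simp add: r_def ac_simps)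
    moreover have "unit_root M q * cnj (unit_root M q) = 1" by (simp add: complex_norm_square[symmetric])
    ultimately have "unit_root M p = unit_root M q" by simp
    moreover have "inj_on (\<lambda>c. unit_root M c) {..<M}"
      using bij_betw_roots_unity[OF M] unfolding unit_root_def bij_betw_def by blast
    ultimately show False using assms False by (auto dest: inj_onD)
  qed
  then have "(\<Sum>a<M. r ^ a) = 0" using geometric_sum[of r M] rM by simp
  then show ?thesis using False unfolding r by simp
qed

text \<open>The Fejer kernel of order K, sampled at the M-th roots of unity and divided by M. Finite
  averages with these weights stand in for an integral over the circle.\<close>

definition fejer :: "nat \<Rightarrow> nat \<Rightarrow> nat \<Rightarrow> real" where
  "fejer K M a = (cmod (\<Sum>j<K. unit_root M a ^ j))\<^sup>2 / (real M * real K)"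

lemma fejer_nonneg: "0 \<le> fejer K M a"
  by (simp add: fejer_def)

text \<open>The condition K + d \<le> M keeps all exponents below M and so excludes aliasing.
  Natural subtraction makes the value zero for d \<ge> K, which is what annihilates high degrees
  later.\<close>

lemma fejer_coefficient:
  assumes "0 < K" "K + d \<le> M"
  shows "(\<Sum>a<M. complex_of_real (fejer K M a) * unit_root M a ^ d) = of_nat (K - d) / of_nat K"
proof -
  have M: "0 < M" using assms by simp
  have "complex_of_real (fejer K M a) * unit_root M a ^ d
      = (\<Sum>j<K. \<Sum>l<K. unit_root M a ^ (j + d) * cnj (unit_root M a ^ l)) / (of_nat M * of_nat K)" for a
  proof -
    have "(\<Sum>j<K. unit_root M a ^ (j + d)) = (\<Sum>j<K. unit_root M a ^ j) * unit_root M a ^ d"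
      by (simp add: power_add sum_distrib_right)
    then have "complex_of_real ((cmod (\<Sum>j<K. unit_root M a ^ j))\<^sup>2) * unit_root M a ^ d
        = (\<Sum>j<K. unit_root M a ^ (j + d)) * (\<Sum>l<K. cnj (unit_root M a ^ l))"
      unfolding complex_norm_square cnj_sum by (simp only: ac_simps)
    also have "\<dots> = (\<Sum>j<K. \<Sum>l<K. unit_root M a ^ (j + d) * cnj (unit_root M a ^ l))" by (rule sum_product)
    finally show ?thesis by (simp add: fejer_def)
  qed
  then have "(\<Sum>a<M. complex_of_real (fejer K M a) * unit_root M a ^ d)
      = (\<Sum>a<M. \<Sum>j<K. \<Sum>l<K. unit_root M a ^ (j + d) * cnj (unit_root M a ^ l)) / (of_nat M * of_nat K)"
    by (simp add: sum_divide_distrib)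
  also have "(\<Sum>a<M. \<Sum>j<K. \<Sum>l<K. unit_root M a ^ (j + d) * cnj (unit_root M a ^ l))
      = (\<Sum>j<K. \<Sum>l<K. \<Sum>a<M. unit_root M a ^ (j + d) * cnj (unit_root M a ^ l))"
    by (rule trans[OF sum.swap]) (intro sum.cong refl sum.swap)
  also have "\<dots> = (\<Sum>j<K. \<Sum>l<K. if j + d = l then of_nat M else 0)"
    by (intro sum.cong refl unit_root_orthogonal) (use assms in auto)
  also have "\<dots> = (\<Sum>j<K. if j + d < K then of_nat M else 0)"
    by (intro sum.cong refl) (simp add: sum.delta')
  also have "\<dots> = (\<Sum>j\<in>{j. j < K \<and> j + d < K}. of_nat M)"
    by (subst sum.inter_filter[symmetric]) (auto intro!: sum.cong)
  also have "{j. j < K \<and> j + d < K} = {..<K - d}" by auto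
  finally show ?thesis using M assms by simp
qed

lemma fejer_sum:
  assumes "0 < K" "K \<le> M" shows "(\<Sum>a<M. fejer K M a) = 1"
proof -
  have "complex_of_real (\<Sum>a<M. fejer K M a) = 1"
    using fejer_coefficient[of K 0 M] assms by simp
  then show ?thesis using of_real_eq_1_iff by blast
qed

section \<open>The gauge action and homogeneous elements\<close>

locale universal_rep = cstar_correspondence D X + T: cstar_algebra T
  for D :: "'d cstar" and X :: "('d, 'x) corr" and T :: "('d + 'x) cstar" (structure) +
  fixes \<pi> :: "'d \<Rightarrow> 'd + 'x" and t :: "'x \<Rightarrow> 'd + 'x"
  assumes universal: "universal_toeplitz_rep D X T \<pi> t"
begin

lemma rep: "toeplitz_rep D X T \<pi> t"
  using universal by (simp add: universal_toeplitz_rep_def)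

lemma \<pi>_hom: "star_hom D T \<pi>"
  using rep by (simp add: toeplitz_rep_def)

lemmas \<pi>_simps = star_hom_simps[OF \<pi>_hom]

lemma t_closed: "\<xi> \<in> carrier X \<Longrightarrow> t \<xi> \<in> carrier T"
  using rep by (auto simp: toeplitz_rep_def)

text \<open>Multiplying t by a scalar of modulus one preserves the Toeplitz relations, and T itself
  is an admissible target of the universal property.\<close>

lemma gauge_ex:
  assumes "cmod w = 1"
  shows "\<exists>\<rho>. star_hom T T \<rho> \<and> (\<forall>d\<in>carrier D. \<rho> (\<pi> d) = \<pi> d) \<and> (\<forall>\<xi>\<in>carrier X. \<rho> (t \<xi>) = w \<odot> t \<xi>)"
proof -
  have w: "w * cnj w = 1" using complex_norm_square[of w] assms by simp
  have "toeplitz_rep D X T \<pi> (\<lambda>\<xi>. w \<odot> t \<xi>)"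
    unfolding toeplitz_rep_def
  proof (intro conjI ballI allI)
    show "star_hom D T \<pi>" by (rule \<pi>_hom)
    show "(\<lambda>\<xi>. w \<odot> t \<xi>) ` carrier X \<subseteq> carrier T" using t_closed by auto
    fix \<xi> assume x: "\<xi> \<in> carrier X"
    show "w \<odot> t (c \<odot>\<^bsub>X\<^esub> \<xi>) = c \<odot> (w \<odot> t \<xi>)" for c
      using rep x t_closed[OF x] by (simp add: toeplitz_rep_def mult.commute)
    show "w \<odot> t (\<xi> \<oplus>\<^bsub>X\<^esub> \<eta>) = w \<odot> t \<xi> \<oplus> w \<odot> t \<eta>" if "\<eta> \<in> carrier X" for \<eta>
      using rep x that t_closed[OF x] t_closed[OF that] by (simp add: toeplitz_rep_def T.smult_add_r)
    show "star T (w \<odot> t \<xi>) \<otimes> (w \<odot> t \<eta>) = \<pi> (inner X \<xi> \<eta>)" if "\<eta> \<in> carrier X" for \<eta>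
      using rep x that t_closed[OF x] t_closed[OF that] w inner_closed[OF x that] \<pi>_simps(1)
      by (simp add: toeplitz_rep_def T.star_smult T.smult_mult_l T.smult_mult_r mult.commute)
    show "\<pi> d \<otimes> (w \<odot> t \<xi>) = w \<odot> t (lact X d \<xi>)" if "d \<in> carrier D" for d
      using rep x that t_closed[OF x] \<pi>_simps(1)[OF that] by (simp add: toeplitz_rep_def T.smult_mult_r)
  qed
  then show ?thesis
    using universal T.cstar_algebra_axioms unfolding universal_toeplitz_rep_def by blast
qed

definition gauge :: "complex \<Rightarrow> 'd + 'x \<Rightarrow> 'd + 'x" where
  "gauge w = (SOME \<rho>. star_hom T T \<rho> \<and> (\<forall>d\<in>carrier D. \<rho> (\<pi> d) = \<pi> d) \<and> (\<forall>\<xi>\<in>carrier X. \<rho> (t \<xi>) = w \<odot> t \<xi>))"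

lemma gauge:
  assumes "cmod w = 1"
  shows "star_hom T T (gauge w)" "d \<in> carrier D \<Longrightarrow> gauge w (\<pi> d) = \<pi> d"
    "\<xi> \<in> carrier X \<Longrightarrow> gauge w (t \<xi>) = w \<odot> t \<xi>"
  using someI_ex[OF gauge_ex[OF assms]] unfolding gauge_def by blast+

lemma gauge_zero: "cmod w = 1 \<Longrightarrow> gauge w \<zero> = \<zero>"
  using star_hom_simps(4)[OF gauge(1), of w \<zero> 0] star_hom_simps(1)[OF gauge(1), of w \<zero>] by simp

lemma gauge_nrm: "\<lbrakk>cmod w = 1; x \<in> carrier T\<rbrakk> \<Longrightarrow> nrm T (gauge w x) \<le> nrm T x"
  using star_hom_contractive[OF T.cstar_algebra_axioms T.cstar_algebra_axioms gauge(1)] .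

text \<open>The spectral subspace is taken in the whole Toeplitz algebra, where degree zero also
  contains products such as t(\<xi>) t(\<eta>)^*. The sharper description for the tensor algebra is
  given by \<open>splits\<close>.\<close>

definition homogeneous :: "nat \<Rightarrow> ('d + 'x) set" where
  "homogeneous d = {x \<in> carrier T. \<forall>w. cmod w = 1 \<longrightarrow> gauge w x = w ^ d \<odot> x}"

lemma homogeneous_mult: "\<lbrakk>x \<in> homogeneous d; y \<in> homogeneous e\<rbrakk> \<Longrightarrow> x \<otimes> y \<in> homogeneous (d + e)"
  unfolding homogeneous_def
  by (auto simp: star_hom_simps(3)[OF gauge(1)] T.smult_mult_l T.smult_mult_r power_add mult.commute)

lemma homogeneous_smult: "x \<in> homogeneous d \<Longrightarrow> c \<odot> x \<in> homogeneous d"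
  unfolding homogeneous_def by (auto simp: star_hom_simps(4)[OF gauge(1)] mult.commute)

lemma homogeneous_\<pi>: "d \<in> carrier D \<Longrightarrow> \<pi> d \<in> homogeneous 0"
  unfolding homogeneous_def using \<pi>_simps(1) gauge(2) by simp

lemma homogeneous_t: "\<xi> \<in> carrier X \<Longrightarrow> t \<xi> \<in> homogeneous 1"
  unfolding homogeneous_def using t_closed gauge(3) by simp

lemma homogeneous_closed: "x \<in> homogeneous d \<Longrightarrow> x \<in> carrier T"
  by (simp add: homogeneous_def)

text \<open>Homogeneous terms are added one at a time, so that statements about means can be proved
  by induction over the terms.\<close>

inductive_set polys :: "nat \<Rightarrow> ('d + 'x) set" for L where
  zero: "\<zero> \<in> polys L"
| add: "\<lbrakk>x \<in> homogeneous d; L \<le> d; p \<in> polys L\<rbrakk> \<Longrightarrow> x \<oplus> p \<in> polys L"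

lemma polys_carrier: "p \<in> polys L \<Longrightarrow> p \<in> carrier T"
  by (induction rule: polys.induct) (use homogeneous_closed in auto)

lemma polys_homogeneous: "\<lbrakk>x \<in> homogeneous d; L \<le> d\<rbrakk> \<Longrightarrow> x \<in> polys L"
  using polys.add[OF _ _ polys.zero, of x d L] homogeneous_closed by auto

lemma polys_add: "\<lbrakk>p \<in> polys L; q \<in> polys L\<rbrakk> \<Longrightarrow> p \<oplus> q \<in> polys L"
proof (induction rule: polys.induct)
  case (add x d p)
  then have "(x \<oplus> p) \<oplus> q = x \<oplus> (p \<oplus> q)"
    using homogeneous_closed polys_carrier by (intro T.M.a_assoc) auto
  then show ?case using add polys.add by simp
qed (simp add: polys_carrier)

lemma polys_smult: "p \<in> polys L \<Longrightarrow> c \<odot> p \<in> polys L"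
proof (induction rule: polys.induct)
  case (add x d p)
  then have "c \<odot> (x \<oplus> p) = c \<odot> x \<oplus> c \<odot> p"
    using homogeneous_closed polys_carrier by (intro T.smult_add_r) auto
  then show ?case using polys.add[OF homogeneous_smult[OF add.hyps(1)] add.hyps(2) add.IH] by simp
qed (simp add: polys.zero)

lemma homogeneous_polys_mult: "\<lbrakk>q \<in> polys M; x \<in> homogeneous d; L \<le> d\<rbrakk> \<Longrightarrow> x \<otimes> q \<in> polys (L + M)"
proof (induction rule: polys.induct)
  case zero
  then show ?case using homogeneous_closed[of x d] polys.zero by simp
next
  case (add y e q)
  then have "x \<otimes> (y \<oplus> q) = x \<otimes> y \<oplus> x \<otimes> q"
    using homogeneous_closed polys_carrier by (intro T.mult_r_distr) auto
  then show ?case using add homogeneous_mult[of x d y e] by (simp add: polys.add)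
qed

lemma polys_mult: "\<lbrakk>p \<in> polys L; q \<in> polys M\<rbrakk> \<Longrightarrow> p \<otimes> q \<in> polys (L + M)"
proof (induction rule: polys.induct)
  case zero
  then show ?case using polys_carrier polys.zero by auto
next
  case (add x d p)
  then have "(x \<oplus> p) \<otimes> q = x \<otimes> q \<oplus> p \<otimes> q"
    using homogeneous_closed polys_carrier by (intro T.mult_l_distr) auto
  then show ?case using add homogeneous_polys_mult polys_add by simp
qed

lemma polys_mono: "L \<le> M \<Longrightarrow> polys M \<subseteq> polys L"
proof
  fix p assume "L \<le> M" "p \<in> polys M"
  then show "p \<in> polys L" by (induction rule: polys.induct[consumes 1, OF \<open>p \<in> polys M\<close>]) (auto intro: polys.intros)
qed

definition order_ideal :: "nat \<Rightarrow> ('d + 'x) set" where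
  "order_ideal L = cstar_closure T (polys L)"

lemma polys_subset: "polys L \<subseteq> carrier T"
  using polys_carrier by blast

lemma order_idealE:
  assumes "x \<in> order_ideal L"
  obtains v where "\<And>n. v n \<in> polys L" "T.conv v x"
  using T.closure_seq[OF assms[unfolded order_ideal_def] polys_subset] by blast

lemma order_ideal_add: assumes "x \<in> order_ideal L" "y \<in> order_ideal L" shows "x \<oplus> y \<in> order_ideal L"
proof -
  obtain v where v: "\<And>n. v n \<in> polys L" "T.conv v x" using order_idealE[OF assms(1)] by blast
  obtain w where w: "\<And>n. w n \<in> polys L" "T.conv w y" using order_idealE[OF assms(2)] by blast
  show ?thesis unfolding order_ideal_def
    by (rule T.conv_closure[OF T.conv_add[OF v(2) w(2)]]) (rule polys_add[OF v(1) w(1)])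
qed

lemma order_ideal_mult: assumes "x \<in> order_ideal L" "y \<in> order_ideal M" shows "x \<otimes> y \<in> order_ideal (L + M)"
proof -
  obtain v where v: "\<And>n. v n \<in> polys L" "T.conv v x" using order_idealE[OF assms(1)] by blast
  obtain w where w: "\<And>n. w n \<in> polys M" "T.conv w y" using order_idealE[OF assms(2)] by blast
  show ?thesis unfolding order_ideal_def
    by (rule T.conv_closure[OF T.conv_mult[OF v(2) w(2)]]) (rule polys_mult[OF v(1) w(1)])
qed

lemma order_ideal_zero: "\<zero> \<in> order_ideal L"
  unfolding order_ideal_def using T.subset_closure[OF polys_subset] polys.zero by blast

lemma order_ideal_carrier: "order_ideal L \<subseteq> carrier T"
  unfolding order_ideal_def by (rule T.closure_subset)

lemma order_ideal_closed:
  assumes "T.conv v x" "\<And>n. v n \<in> order_ideal L" shows "x \<in> order_ideal L"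
  using T.conv_closure[OF assms] T.closure_closure[OF polys_subset, of L] unfolding order_ideal_def by simp

section \<open>Fejer means and the intersection of the order ideals\<close>

definition mean :: "nat \<Rightarrow> nat \<Rightarrow> 'd + 'x \<Rightarrow> 'd + 'x" where
  "mean K M x = (\<Oplus>a\<in>{..<M}. complex_of_real (fejer K M a) \<odot> gauge (unit_root M a) x)"

lemma gauge_closed: "x \<in> carrier T \<Longrightarrow> gauge (unit_root M a) x \<in> carrier T"
  by (rule star_hom_simps(1)[OF gauge(1)]) simp_all

lemma mean_closed: "x \<in> carrier T \<Longrightarrow> mean K M x \<in> carrier T"
  unfolding mean_def by (rule T.M.finsum_closed) (simp add: gauge_closed)

lemma mean_add:
  assumes "x \<in> carrier T" "y \<in> carrier T" shows "mean K M (x \<oplus> y) = mean K M x \<oplus> mean K M y"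
proof -
  have "mean K M (x \<oplus> y) = (\<Oplus>a\<in>{..<M}. complex_of_real (fejer K M a) \<odot> gauge (unit_root M a) x \<oplus> complex_of_real (fejer K M a) \<odot> gauge (unit_root M a) y)"
    unfolding mean_def using assms
    by (intro T.M.finsum_cong') (simp_all add: gauge_closed star_hom_simps(2)[OF gauge(1)] T.smult_add_r)
  also have "\<dots> = mean K M x \<oplus> mean K M y"
    unfolding mean_def using assms by (intro T.M.finsum_addf) (simp_all add: gauge_closed)
  finally show ?thesis .
qed

lemma mean_minus:
  assumes "x \<in> carrier T" "y \<in> carrier T" shows "mean K M (x \<ominus> y) = mean K M x \<ominus> mean K M y"
proof -
  have "mean K M (x \<ominus> y) \<oplus> mean K M y = mean K M x"
    using mean_add[of "x \<ominus> y" y K M] assms by (simp add: T.minus_add_cancel)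
  moreover have "mean K M (x \<ominus> y) = (mean K M (x \<ominus> y) \<oplus> mean K M y) \<ominus> mean K M y"
    by (rule T.coeffs_eq, (rule T.coeffs_rules | (simp add: assms mean_closed algebra_simps; fail))+)
  ultimately show ?thesis by simp
qed

lemma mean_nrm:
  assumes x: "x \<in> carrier T" and "0 < K" "K \<le> M" shows "nrm T (mean K M x) \<le> nrm T x"
proof -
  have "nrm T (mean K M x) \<le> (\<Sum>a<M. nrm T (complex_of_real (fejer K M a) \<odot> gauge (unit_root M a) x))"
    unfolding mean_def using x by (intro T.finsum_nrm_le) (simp_all add: gauge_closed)
  also have "\<dots> \<le> (\<Sum>a<M. fejer K M a * nrm T x)"
    using x by (intro sum_mono) (simp add: T.nrm_smult gauge_closed fejer_nonneg gauge_nrm mult_left_mono)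
  also have "\<dots> = nrm T x" using fejer_sum[OF assms(2,3)] by (simp add: sum_distrib_right[symmetric])
  finally show ?thesis .
qed

lemma mean_homogeneous:
  assumes x: "x \<in> homogeneous d" and "0 < K" "K + d \<le> M"
  shows "mean K M x = (of_nat (K - d) / of_nat K) \<odot> x"
proof -
  have xc: "x \<in> carrier T" using x homogeneous_closed by auto
  have sum: "(\<Oplus>a\<in>F. c a \<odot> x) = (\<Sum>a\<in>F. c a) \<odot> x" if "finite F" for F :: "nat set" and c
    using that by (induction F rule: finite_induct) (simp_all add: xc T.smult_add_l)
  have "mean K M x = (\<Oplus>a\<in>{..<M}. (complex_of_real (fejer K M a) * unit_root M a ^ d) \<odot> x)"
    unfolding mean_def using x xc by (intro T.M.finsum_cong') (simp_all add: homogeneous_def)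
  also have "\<dots> = (of_nat (K - d) / of_nat K) \<odot> x"
    unfolding sum[OF finite_lessThan] fejer_coefficient[OF assms(2,3)] ..
  finally show ?thesis .
qed

text \<open>Every degree from K on has Fejer coefficient zero. The threshold for M depends on p,
  because M has to reach K plus each degree occurring in p.\<close>

lemma mean_polys_zero:
  assumes "p \<in> polys K" "0 < K" shows "\<exists>N. \<forall>M\<ge>N. mean K M p = \<zero>"
  using assms(1)
proof (induction rule: polys.induct)
  case zero
  show ?case using mean_homogeneous[of \<zero> 0 K] assms(2) gauge_zero by (intro exI[of _ K]) (simp add: homogeneous_def)
next
  case (add x d p)
  then obtain N where N: "\<And>M. M \<ge> N \<Longrightarrow> mean K M p = \<zero>" by blast
  have c: "x \<in> carrier T" "p \<in> carrier T" using add homogeneous_closed polys_carrier by auto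
  have "mean K M (x \<oplus> p) = \<zero>" if M: "M \<ge> max N (K + d)" for M
    using mean_homogeneous[OF add.hyps(1) assms(2), of M] N[of M] M add.hyps(2) c by (simp add: mean_add)
  then show ?case by blast
qed

text \<open>On degree d the mean differs from the identity by a factor of at most d / K. Hence K is
  chosen first, and M afterwards beyond K plus all degrees in p.\<close>

lemma mean_polys:
  assumes "p \<in> polys L"
  shows "\<forall>e>0. \<exists>K0. \<forall>K\<ge>K0. 0 < K \<longrightarrow> (\<exists>N. \<forall>M\<ge>N. nrm T (mean K M p \<ominus> p) \<le> e)"
  using assms
proof (induction rule: polys.induct)
  case zero
  have "mean K M \<zero> = \<zero>" if "0 < K" "M \<ge> K" for K M
    using mean_homogeneous[of \<zero> 0 K M] that gauge_zero by (simp add: homogeneous_def)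
  note mean_zero = this
  show ?case
  proof (intro allI impI)
    fix e :: real assume e: "e > 0"
    have "\<forall>K\<ge>0. 0 < K \<longrightarrow> (\<exists>N. \<forall>M\<ge>N. nrm T (mean K M \<zero> \<ominus> \<zero>) \<le> e)"
    proof (intro allI impI)
      fix K :: nat assume "0 < K"
      then show "\<exists>N. \<forall>M\<ge>N. nrm T (mean K M \<zero> \<ominus> \<zero>) \<le> e"
        using e by (intro exI[of _ K]) (simp add: mean_zero)
    qed
    then show "\<exists>K0. \<forall>K\<ge>K0. 0 < K \<longrightarrow> (\<exists>N. \<forall>M\<ge>N. nrm T (mean K M \<zero> \<ominus> \<zero>) \<le> e)" by blast
  qed
next
  case (add x d p)
  have c: "x \<in> carrier T" "p \<in> carrier T" using add homogeneous_closed polys_carrier by auto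
  show ?case
  proof (intro allI impI)
    fix e :: real assume e: "e > 0"
    then obtain K0 where K0: "\<And>K. \<lbrakk>K \<ge> K0; 0 < K\<rbrakk> \<Longrightarrow> \<exists>N. \<forall>M\<ge>N. nrm T (mean K M p \<ominus> p) \<le> e / 2"
      using add.IH half_gt_zero by blast
    \<comment> \<open>From this bound on, the error d / K times the norm of x is at most e /
      2.\<close>
    obtain K1 :: nat where K1: "real d * nrm T x / (e / 2) < real K1" using reals_Archimedean2 by blast
    have "\<exists>N. \<forall>M\<ge>N. nrm T (mean K M (x \<oplus> p) \<ominus> (x \<oplus> p)) \<le> e" if K: "K \<ge> max K0 K1" "0 < K" for K
    proof -
      obtain N where N: "\<And>M. M \<ge> N \<Longrightarrow> nrm T (mean K M p \<ominus> p) \<le> e / 2" using K0[of K] K by auto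
      have "nrm T (mean K M (x \<oplus> p) \<ominus> (x \<oplus> p)) \<le> e" if M: "M \<ge> max N (K + d)" for M
      proof -
        have "mean K M x \<ominus> x = (of_nat (K - d) / of_nat K - 1) \<odot> x"
          using mean_homogeneous[OF add.hyps(1) K(2), of M] M c
          by (simp add: T.minus_smult T.smult_add_l[symmetric] add.commute)
        then have n: "nrm T (mean K M x \<ominus> x) = cmod (of_nat (K - d) / of_nat K - 1) * nrm T x"
          using c by (simp add: T.nrm_smult)
        have le: "cmod (of_nat (K - d) / of_nat K - 1) \<le> real d / real K"
        proof -
          have "of_nat (K - d) / of_nat K - 1 = complex_of_real (real (K - d) / real K - 1)" by simp
          then have "cmod (of_nat (K - d) / of_nat K - 1) = \<bar>real (K - d) / real K - 1\<bar>" by (simp only: norm_of_real)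
          also have "\<dots> \<le> real d / real K" using K(2) by (cases "d \<le> K") (auto simp: field_simps of_nat_diff abs_if)
          finally show ?thesis .
        qed
        have "nrm T (mean K M x \<ominus> x) \<le> real d / real K * nrm T x"
          unfolding n by (rule mult_right_mono[OF le T.nrm_nonneg[OF c(1)]])
        also have "\<dots> \<le> e / 2"
        proof -
          have "real d * nrm T x < real K1 * (e / 2)" using K1 e by (simp add: field_simps)
          also have "\<dots> \<le> real K * (e / 2)" using K e by (intro mult_right_mono) auto
          finally show ?thesis using K(2) by (simp add: field_simps)
        qed
        finally have 1: "nrm T (mean K M x \<ominus> x) \<le> e / 2" .
        have "mean K M (x \<oplus> p) \<ominus> (x \<oplus> p) = (mean K M x \<ominus> x) \<oplus> (mean K M p \<ominus> p)"
          unfolding mean_add[OF c]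
          by (rule T.coeffs_eq, (rule T.coeffs_rules | (simp add: c mean_closed algebra_simps; fail))+)
        then have "nrm T (mean K M (x \<oplus> p) \<ominus> (x \<oplus> p)) \<le> nrm T (mean K M x \<ominus> x) + nrm T (mean K M p \<ominus> p)"
          using c mean_closed by (simp add: T.nrm_triangle)
        then show ?thesis using 1 N[of M] M by simp
      qed
      then show ?thesis by blast
    qed
    then show "\<exists>K0. \<forall>K\<ge>K0. 0 < K \<longrightarrow> (\<exists>N. \<forall>M\<ge>N. nrm T (mean K M (x \<oplus> p) \<ominus> (x \<oplus> p)) \<le> e)"
      by blast
  qed
qed

text \<open>The element x is approximated twice. The mean nearly reproduces p, but annihilates q,
  whose degrees are at least K, so the mean of x is small. The four errors are those between x and
  p, between p and its mean, between the means of p and x, and the mean of x itself.\<close>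

lemma order_ideal_Inter:
  assumes x: "\<And>L. x \<in> order_ideal L" shows "x = \<zero>"
proof -
  have xc: "x \<in> carrier T" using x[of 0] order_ideal_carrier by blast
  have 4: "nrm T x \<le> 4 * e" if e: "e > 0" for e
  proof -
    obtain p where p: "p \<in> polys 0" "nrm T (x \<ominus> p) < e"
      using T.closureD[OF x[of 0, unfolded order_ideal_def] e] by blast
    have pc: "p \<in> carrier T" using p polys_carrier by blast
    obtain K0 where "\<And>K. \<lbrakk>K \<ge> K0; 0 < K\<rbrakk> \<Longrightarrow> \<exists>N. \<forall>M\<ge>N. nrm T (mean K M p \<ominus> p) \<le> e"
      using mean_polys[OF p(1)] e by blast
    then obtain K N where K: "0 < K" and N: "\<And>M. M \<ge> N \<Longrightarrow> nrm T (mean K M p \<ominus> p) \<le> e"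
      by (metis le_SucI order_refl zero_less_Suc)
    obtain q where q: "q \<in> polys K" "nrm T (x \<ominus> q) < e"
      using T.closureD[OF x[of K, unfolded order_ideal_def] e] by blast
    have qc: "q \<in> carrier T" using q polys_carrier by blast
    obtain N' where N': "\<And>M. M \<ge> N' \<Longrightarrow> mean K M q = \<zero>" using mean_polys_zero[OF q(1) K] by blast
    define M where "M = max K (max N N')"
    have M: "M \<ge> K" "M \<ge> N" "M \<ge> N'" by (auto simp: M_def)
    note c = xc pc qc mean_closed[OF xc, of K M] mean_closed[OF pc, of K M]
    have "nrm T (mean K M p \<ominus> mean K M x) \<le> nrm T (p \<ominus> x)"
      unfolding mean_minus[OF pc xc, symmetric] using c K M by (intro mean_nrm) auto
    then have 1: "nrm T (mean K M p \<ominus> mean K M x) \<le> e" using p(2) T.nrm_minus_commute[OF pc xc] by simp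
    have "nrm T (mean K M (x \<ominus> q)) \<le> nrm T (x \<ominus> q)" using c K M by (intro mean_nrm) auto
    moreover have "mean K M (x \<ominus> q) = mean K M x"
      unfolding mean_minus[OF xc qc] N'[OF M(3)] using c by (simp add: T.minus_smult)
    ultimately have 2: "nrm T (mean K M x) \<le> e" using q(2) by simp
    have "nrm T x \<le> nrm T (x \<ominus> p) + nrm T p" using T.nrm_dist_ge[OF xc pc] by simp
    moreover have "nrm T p \<le> nrm T (mean K M p \<ominus> p) + nrm T (mean K M p)"
      using T.nrm_dist_ge[OF pc c(5)] T.nrm_minus_commute[OF pc c(5)] by simp
    moreover have "nrm T (mean K M p) \<le> nrm T (mean K M p \<ominus> mean K M x) + nrm T (mean K M x)"
      using T.nrm_dist_ge[OF c(5) c(4)] by simp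
    ultimately show ?thesis using p(2) N[OF M(2)] 1 2 by linarith
  qed
  have "nrm T x \<le> 0 + e" if "e > 0" for e using 4[of "e / 4"] that by simp
  then have "nrm T x \<le> 0" by (rule field_le_epsilon)
  then have "nrm T x = 0" using T.nrm_nonneg[OF xc] by simp
  then show ?thesis by (simp add: T.nrm_eq_0[OF xc])
qed

section \<open>The degree zero part of the tensor algebra\<close>

definition tensor :: "('d + 'x) set" where
  "tensor = closed_algebra_generated T (\<pi> ` carrier D \<union> t ` carrier X)"

lemma \<pi>_tensor: "d \<in> carrier D \<Longrightarrow> \<pi> d \<in> tensor"
  unfolding tensor_def closed_algebra_generated_def by blast

text \<open>In a tensor algebra the degree zero part comes from D alone, and D is closed under
  adjoints.\<close>

definition splits :: "('d + 'x) set" where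
  "splits = {\<pi> d \<oplus> z |d z. d \<in> carrier D \<and> z \<in> polys 1}"

lemma splits_carrier: "splits \<subseteq> carrier T"
  unfolding splits_def using \<pi>_simps(1) polys_carrier by auto

text \<open>Sums of this shape are closed under multiplication: the parts from D multiply in D, and
  every other product has positive degree. Their closure is thus a closed algebra containing the
  generators.\<close>

lemma tensor_subset: "tensor \<subseteq> cstar_closure T splits"
proof -
  have \<pi>0: "\<pi> \<zero>\<^bsub>D\<^esub> = \<zero>" using \<pi>_simps(4)[of "\<zero>\<^bsub>D\<^esub>" 0] \<pi>_simps(1)[of "\<zero>\<^bsub>D\<^esub>"] by simp
  have alg: "operator_algebra T (cstar_closure T splits)"
  proof (rule T.operator_algebra_closure[OF splits_carrier])
    show "\<zero> \<in> splits" unfolding splits_def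
      by (intro CollectI exI[of _ "\<zero>\<^bsub>D\<^esub>"] exI[of _ \<zero>]) (simp add: \<pi>0 polys.zero)
    fix x y assume "x \<in> splits"
    then obtain d z where x: "x = \<pi> d \<oplus> z" "d \<in> carrier D" "z \<in> polys 1" unfolding splits_def by blast
    have zc: "z \<in> carrier T" "\<pi> d \<in> carrier T" using x polys_carrier \<pi>_simps(1) by auto
    show "c \<odot> x \<in> splits" for c
      unfolding splits_def x(1)
      by (intro CollectI exI[of _ "c \<odot>\<^bsub>D\<^esub> d"] exI[of _ "c \<odot> z"])
        (use x zc in \<open>simp add: \<pi>_simps(4) T.smult_add_r polys_smult\<close>)
    assume "y \<in> splits"
    then obtain d' z' where y: "y = \<pi> d' \<oplus> z'" "d' \<in> carrier D" "z' \<in> polys 1" unfolding splits_def by blast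
    have zc': "z' \<in> carrier T" "\<pi> d' \<in> carrier T" using y polys_carrier \<pi>_simps(1) by auto
    have "x \<oplus> y = \<pi> (d \<oplus>\<^bsub>D\<^esub> d') \<oplus> (z \<oplus> z')"
      unfolding x(1) y(1) \<pi>_simps(2)[OF x(2) y(2)]
      by (rule T.coeffs_eq, (rule T.coeffs_rules | (simp add: zc zc' algebra_simps; fail))+)
    then show "x \<oplus> y \<in> splits"
      unfolding splits_def using x y polys_add
      by (intro CollectI exI[of _ "d \<oplus>\<^bsub>D\<^esub> d'"] exI[of _ "z \<oplus> z'"]) simp
    have "x \<otimes> y = \<pi> (d \<otimes>\<^bsub>D\<^esub> d') \<oplus> ((\<pi> d \<otimes> z' \<oplus> z \<otimes> \<pi> d') \<oplus> z \<otimes> z')"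
      unfolding x(1) y(1) \<pi>_simps(3)[OF x(2) y(2)]
      apply (simp add: zc zc' T.expand)
      by (rule T.coeffs_eq, (rule T.coeffs_rules | (simp add: zc zc' algebra_simps; fail))+)
    moreover have "\<pi> d \<otimes> z' \<in> polys (0 + 1)"
      by (rule polys_mult[OF polys_homogeneous[OF homogeneous_\<pi>] y(3)]) (use x in auto)
    moreover have "z \<otimes> \<pi> d' \<in> polys (1 + 0)"
      by (rule polys_mult[OF x(3) polys_homogeneous[OF homogeneous_\<pi>]]) (use y in auto)
    moreover have "z \<otimes> z' \<in> polys 1"
      using polys_mult[OF x(3) y(3)] polys_mono[of 1 "1 + 1"] by auto
    ultimately show "x \<otimes> y \<in> splits"
      unfolding splits_def using x y polys_add
      by (intro CollectI exI[of _ "d \<otimes>\<^bsub>D\<^esub> d'"] exI[of _ "(\<pi> d \<otimes> z' \<oplus> z \<otimes> \<pi> d') \<oplus> z \<otimes> z'"]) simp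
  qed
  have "\<pi> d \<in> splits" if "d \<in> carrier D" for d
    unfolding splits_def
    by (intro CollectI exI[of _ d] exI[of _ \<zero>]) (use that \<pi>_simps(1) polys.zero in simp)
  moreover have "t \<xi> \<in> splits" if "\<xi> \<in> carrier X" for \<xi>
    unfolding splits_def
    by (intro CollectI exI[of _ "\<zero>\<^bsub>D\<^esub>"] exI[of _ "t \<xi>"])
      (use that \<pi>0 t_closed polys_homogeneous[OF homogeneous_t] in simp)
  ultimately have "\<pi> ` carrier D \<union> t ` carrier X \<subseteq> cstar_closure T splits"
    using T.subset_closure[OF splits_carrier] by blast
  then show ?thesis unfolding tensor_def closed_algebra_generated_def using alg by blast
qed

lemma tensor_order_ideal: "tensor \<subseteq> order_ideal 0"
proof -
  have "splits \<subseteq> polys 0"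
    unfolding splits_def using polys_add polys_homogeneous[OF homogeneous_\<pi>] polys_mono[of 0 1] by auto
  then show ?thesis using tensor_subset T.closure_mono unfolding order_ideal_def by blast
qed

text \<open>
  The degree zero part of \<open>q x r\<close> is a limit of elements \<open>q \<pi>(d) r = (r \<pi>(d\<^sup>*) q)\<^sup>*\<close>.
\<close>

lemma corner_in_order_ideal:
  assumes q: "q \<in> tensor" "star T q = q" and r: "r \<in> tensor" "star T r = r"
    and zero: "\<And>s. s \<in> tensor \<Longrightarrow> r \<otimes> (s \<otimes> q) = \<zero>"
    and x: "x \<in> tensor" "x = q \<otimes> (x \<otimes> r)"
  shows "x \<in> order_ideal 1"
proof -
  have qr: "q \<in> order_ideal 0" "r \<in> order_ideal 0" using q r tensor_order_ideal by auto
  then have c: "q \<in> carrier T" "r \<in> carrier T" using order_ideal_carrier by auto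
  have "x \<in> cstar_closure T splits" using x(1) tensor_subset by blast
  then obtain v where v: "\<And>n. v n \<in> splits" "T.conv v x" using T.closure_seq[OF _ splits_carrier] by blast
  \<comment> \<open>Compression by q and r fixes x, so the compressed approximants still converge to
    x, and only their corners need to be examined.\<close>
  have lim: "T.conv (\<lambda>n. q \<otimes> (v n \<otimes> r)) x"
    by (subst x(2)) (intro T.conv_mult T.conv_const c v(2))
  show ?thesis
  proof (rule order_ideal_closed[OF lim])
    fix n
    obtain d z where d: "v n = \<pi> d \<oplus> z" "d \<in> carrier D" "z \<in> polys 1" using v(1)[of n] unfolding splits_def by blast
    have ds: "star D d \<in> carrier D" using d(2) by simp
    have dc: "\<pi> d \<in> carrier T" "z \<in> carrier T" "\<pi> (star D d) \<in> carrier T" using d ds \<pi>_simps(1) polys_carrier by auto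
    have "star T (r \<otimes> (\<pi> (star D d) \<otimes> q)) = q \<otimes> (\<pi> d \<otimes> r)"
      using c dc q r d by (simp add: T.star_mult T.mult_assoc T.star_star \<pi>_simps(5))
    then have "q \<otimes> (\<pi> d \<otimes> r) = \<zero>" using zero[OF \<pi>_tensor[OF ds]] by simp
    then have e: "q \<otimes> (v n \<otimes> r) = q \<otimes> (z \<otimes> r)" unfolding d(1) using c dc by (simp add: T.mult_l_distr T.mult_r_distr)
    have "z \<in> order_ideal 1" unfolding order_ideal_def using d(3) T.subset_closure[OF polys_subset] by blast
    then have "q \<otimes> (z \<otimes> r) \<in> order_ideal (0 + (1 + 0))" using qr by (intro order_ideal_mult)
    then show "q \<otimes> (v n \<otimes> r) \<in> order_ideal 1" unfolding e by simp
  qed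
qed

end

section \<open>Strict matrix units under refinement\<close>

context tree_refinement
begin

text \<open>Reachability between refined vertices implies reachability between their blocks, so its
  failure for a and b persists at every later level. Both diagonal units are refined until they
  reach the level of x.\<close>

lemma corner_zero_level:
  "\<lbrakk>a < k n; b < k n; \<not> R n b a; x \<in> level (n + d)\<rbrakk> \<Longrightarrow> u n b b \<otimes> (x \<otimes> u n a a) = \<zero>"
proof (induction d arbitrary: n a b)
  case 0
  then obtain \<alpha> where x: "x = lin n \<alpha>" "\<And>i j. \<alpha> (i, j) \<noteq> 0 \<Longrightarrow> R n i j" unfolding level_def by auto
  have "\<alpha> (b, a) = 0" using x(2) 0 by blast
  then show ?case unfolding x(1) using u_lin_u[of b n a b \<alpha> a] 0 by simp
next
  case (Suc d)
  let ?m = "ratio n"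
  let ?F = "\<lambda>a. (\<lambda>s. (a * ?m + s, a * ?m + s)) ` {..<?m}"
  have lt: "c * ?m + s < k (Suc n)" if "c < k n" "s < ?m" for c s
  proof -
    have "c * ?m + s < (c + 1) * ?m" using that by simp
    also have "\<dots> \<le> k n * ?m" using that by (intro mult_right_mono) auto
    finally show ?thesis by (simp add: k_Suc)
  qed
  have xc: "x \<in> carrier E" using Suc.prems(4) level_carrier by blast
  have zero: "u (Suc n) (fst p) (snd p) \<otimes> (x \<otimes> u (Suc n) (fst q) (snd q)) = \<zero>"
    if p: "p \<in> ?F b" and q: "q \<in> ?F a" for p q
  proof -
    obtain s where s: "s < ?m" "p = (b * ?m + s, b * ?m + s)" using p by auto
    obtain s' where s': "s' < ?m" "q = (a * ?m + s', a * ?m + s')" using q by auto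
    have "\<not> R (Suc n) (b * ?m + s) (a * ?m + s')" using Suc.prems(3) s s' by (simp add: R_Suc)
    then show ?thesis
      using Suc.IH[of "a * ?m + s'" "Suc n" "b * ?m + s"] lt[OF Suc.prems(1) s'(1)] lt[OF Suc.prems(2) s(1)] Suc.prems(4)
      by (simp add: s(2) s'(2))
  qed
  have inner: "u n b b \<otimes> (x \<otimes> u (Suc n) (fst q) (snd q)) = \<zero>" if q: "q \<in> ?F a" for q
  proof -
    have "u n b b \<otimes> (x \<otimes> u (Suc n) (fst q) (snd q))
        = (\<Oplus>p\<in>?F b. u (Suc n) (fst p) (snd p)) \<otimes> (x \<otimes> u (Suc n) (fst q) (snd q))"
      using u_refine[OF Suc.prems(2,2)] by simp
    also have "\<dots> = (\<Oplus>p\<in>?F b. u (Suc n) (fst p) (snd p) \<otimes> (x \<otimes> u (Suc n) (fst q) (snd q)))"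
      using xc by (intro finsum_mult_r) auto
    also have "\<dots> = (\<Oplus>p\<in>?F b. \<zero>)"
      using zero[OF _ q] by (intro M.finsum_cong') auto
    finally show ?thesis by simp
  qed
  have "u n b b \<otimes> (x \<otimes> u n a a) = (u n b b \<otimes> x) \<otimes> (\<Oplus>q\<in>?F a. u (Suc n) (fst q) (snd q))"
    using u_refine[OF Suc.prems(1,1)] xc by (simp add: mult_assoc)
  also have "\<dots> = (\<Oplus>q\<in>?F a. (u n b b \<otimes> x) \<otimes> u (Suc n) (fst q) (snd q))"
    using xc by (intro finsum_mult_l) auto
  also have "\<dots> = (\<Oplus>q\<in>?F a. \<zero>)"
    using inner xc by (intro M.finsum_cong') (auto simp: mult_assoc)
  finally show ?case by simp
qed

lemma corner_zero:
  assumes "a < k n" "b < k n" "\<not> R n b a" "x \<in> alg"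
  shows "u n b b \<otimes> (x \<otimes> u n a a) = \<zero>"
proof -
  obtain v where v: "\<And>N. v N \<in> (\<Union>n. level n)" "conv v x"
    using closure_seq[OF assms(4)[unfolded alg_eq] union_level_carrier] by blast
  have "u n b b \<otimes> (v N \<otimes> u n a a) = \<zero>" for N
  proof -
    obtain m where "v N \<in> level m" using v(1)[of N] by blast
    moreover have "m \<le> n + (m - n)" by simp
    ultimately have "v N \<in> level (n + (m - n))" using level_mono by blast
    then show ?thesis by (rule corner_zero_level[OF assms(1-3)])
  qed
  moreover have "conv (\<lambda>N. u n b b \<otimes> (v N \<otimes> u n a a)) (u n b b \<otimes> (x \<otimes> u n a a))"
    by (intro conv_mult conv_const v(2)) simp_all
  ultimately have "conv (\<lambda>N. \<zero>) (u n b b \<otimes> (x \<otimes> u n a a))" by simp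
  from conv_unique[OF conv_const[OF M.zero_closed] this] show ?thesis by simp
qed

lemma strict_refine:
  assumes "R n a b" "a \<noteq> b" "q \<in> (\<lambda>s. (a * ratio n + s, b * ratio n + s)) ` {..<ratio n}"
  shows "R (Suc n) (fst q) (snd q)" "fst q \<noteq> snd q"
proof -
  obtain s where s: "s < ratio n" "q = (a * ratio n + s, b * ratio n + s)" using assms(3) by auto
  then show "R (Suc n) (fst q) (snd q)" using assms(1,2) by (simp add: R_Suc)
  show "fst q \<noteq> snd q" using s assms(2) ratio_pos[of n] by simp
qed

text \<open>
  For multiplicity at least two a strict pair becomes a product of two strict pairs, through the
  last vertex above the source or the first vertex above the target.
\<close>

lemma strict_factor:
  assumes ab: "R n a b" "a \<noteq> b" and m: "2 \<le> ratio n" and q: "q \<in> (\<lambda>s. (a * ratio n + s, b * ratio n + s)) ` {..<ratio n}"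
  obtains v where "R (Suc n) (fst q) v" "fst q \<noteq> v" "R (Suc n) v (snd q)" "v \<noteq> snd q"
proof -
  let ?m = "ratio n"
  obtain s where s: "s < ?m" "q = (a * ?m + s, b * ?m + s)" using q by auto
  have lt: "a < k n" "b < k n" using R_less[OF ab(1)] by auto
  have dm: "(c * ?m + r) div ?m = c" "(c * ?m + r) mod ?m = r" if "r < ?m" for c r
    using that by simp_all
  show ?thesis
  proof (cases "s = ?m - 1")
    case False
    let ?v = "b * ?m + (?m - 1)"
    have m1: "?m - 1 < ?m" using m by simp
    have ne: "a * ?m + s \<noteq> ?v" using dm(1)[OF s(1), of a] dm(1)[OF m1, of b] ab(2) by metis
    show ?thesis
      by (rule that[of ?v])
        (use s ab False ne R_refl[OF lt(2)] m1 in \<open>simp_all only: R_Suc dm fst_conv snd_conv, auto\<close>)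
  next
    case True
    \<comment> \<open>At the last position the other choice would be the source itself. As the
      multiplicity is at least two, the last position is not the first, so the start of the block of
      a is a new vertex. The summand 0 keeps the form that \<open>dm\<close> rewrites.\<close>
    let ?v = "a * ?m + 0"
    have m0: "0 < ?m" using m by simp
    have ne: "?v \<noteq> b * ?m + s" using dm(1)[OF s(1), of b] dm(1)[OF m0, of a] ab(2) by metis
    show ?thesis
      by (rule that[of ?v])
        (use s ab True ne R_refl[OF lt(1)] m0 m in \<open>simp_all only: R_Suc dm fst_conv snd_conv, auto\<close>)
  qed
qed

lemma ratio_ge_2:
  assumes "\<And>N. \<exists>n. N < k n" shows "\<exists>d. 2 \<le> ratio (n + d)"
proof (rule ccontr)
  assume "\<not> ?thesis"
  then have "ratio (n + d) = 1" for d using ratio_pos[of "n + d"] by (metis One_nat_def Suc_1 leI less_2_cases not_gr_zero)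
  then have const: "k (n + d) = k n" for d by (induction d) (simp_all add: k_Suc)
  \<comment> \<open>Monotonicity covers the case in which the larger value of k occurs at an index
    before n.\<close>
  have mono: "k m \<le> k (m + d)" for m d
  proof (induction d)
    case (Suc d)
    have "k (m + d) * 1 \<le> k (m + d) * ratio (m + d)" using ratio_pos[of "m + d"] by (intro mult_le_mono2) linarith
    then show ?case using Suc unfolding add_Suc_right k_Suc by linarith
  qed simp
  obtain m where "k n < k m" using assms by blast
  moreover have "k m \<le> k (m + n)" by (rule mono)
  ultimately show False using const[of m] by (simp add: add.commute)
qed

lemma not_tensor_algebra:
  fixes D :: "'d cstar" and X :: "('d, 'x) corr" and T :: "('d + 'x) cstar"
  assumes inc: "i < k 0" "j < k 0" "\<not> R 0 i j" "\<not> R 0 j i"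
    and unbounded: "\<And>N. \<exists>n. N < k n" and tensor: "is_tensor_algebra D X T S"
  shows "\<not> isometrically_isomorphic E alg T S"
proof
  assume "isometrically_isomorphic E alg T S"
  then obtain \<phi> where bij: "bij_betw \<phi> alg S" and \<phi>: "alg_hom E alg T \<phi>"
    and iso: "\<And>x. x \<in> alg \<Longrightarrow> nrm T (\<phi> x) = nrm E x"
    unfolding isometrically_isomorphic_def by blast
  obtain \<pi> t where univ: "universal_toeplitz_rep D X T \<pi> t" and S: "S = closed_algebra_generated T (\<pi> ` carrier D \<union> t ` carrier X)"
    and corr: "cstar_correspondence D X"
    using tensor unfolding is_tensor_algebra_def by blast
  have T: "cstar_algebra T" using univ by (simp add: universal_toeplitz_rep_def)
  interpret Q: universal_rep D X T \<pi> t
    by (intro universal_rep.intro universal_rep_axioms.intro corr T univ)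
  have img: "\<phi> x \<in> Q.tensor" if "x \<in> alg" for x
    using bij that unfolding bij_betw_def S Q.tensor_def by blast
  have surj: "\<exists>x\<in>alg. s = \<phi> x" if "s \<in> Q.tensor" for s
    using bij that unfolding bij_betw_def S Q.tensor_def by blast
  note \<phi>_simps = alg_hom_simps[OF \<phi>]
  have zero: "\<phi> \<zero> = \<zero>\<^bsub>T\<^esub>" by (rule alg_hom_zero[OF T \<phi>])
  have diag: "u n a a \<in> alg" if "a < k n" for n a by (rule u_alg[OF R_refl[OF that]])
  \<comment> \<open>The isomorphism is not assumed to respect adjoints; on the diagonal units it
    does so because their images are contractive idempotents.\<close>
  have proj: "star T (\<phi> (u n a a)) = \<phi> (u n a a)" if a: "a < k n" for n a
    using \<phi>_simps(3)[OF diag[OF a] diag[OF a]] a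
    by (intro Q.T.contractive_idempotent_star \<phi>_simps(1) diag) (simp_all add: u_mult iso[OF diag[OF a]] u_diag_nrm)
  have base: "\<phi> (u n a b) \<in> Q.order_ideal 1" if ab: "R n a b" "a \<noteq> b" for n a b
  proof -
    have lt: "a < k n" "b < k n" using R_less[OF ab(1)] by auto
    have nR: "\<not> R n b a" using R_antisym[OF ab(1)] ab(2) by blast
    have ualg: "u n a b \<in> alg" by (rule u_alg[OF ab(1)])
    show ?thesis
    proof (rule Q.corner_in_order_ideal[of "\<phi> (u n a a)" "\<phi> (u n b b)"])
      fix s assume "s \<in> Q.tensor"
      then obtain x where x: "x \<in> alg" "s = \<phi> x" using surj by blast
      have "\<phi> (u n b b) \<otimes>\<^bsub>T\<^esub> (\<phi> x \<otimes>\<^bsub>T\<^esub> \<phi> (u n a a)) = \<phi> (u n b b \<otimes> (x \<otimes> u n a a))"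
        using \<phi>_simps(3) diag lt x alg_closed(3) by simp
      also have "\<dots> = \<zero>\<^bsub>T\<^esub>" using corner_zero[OF lt nR x(1)] zero by simp
      finally show "\<phi> (u n b b) \<otimes>\<^bsub>T\<^esub> (s \<otimes>\<^bsub>T\<^esub> \<phi> (u n a a)) = \<zero>\<^bsub>T\<^esub>" using x(2) by simp
    next
      have "\<phi> (u n a a) \<otimes>\<^bsub>T\<^esub> (\<phi> (u n a b) \<otimes>\<^bsub>T\<^esub> \<phi> (u n b b)) = \<phi> (u n a a \<otimes> (u n a b \<otimes> u n b b))"
        using \<phi>_simps(3) diag lt ualg alg_closed(3) by simp
      also have "u n a a \<otimes> (u n a b \<otimes> u n b b) = u n a b" using lt by (simp add: u_mult)
      finally show "\<phi> (u n a b) = \<phi> (u n a a) \<otimes>\<^bsub>T\<^esub> (\<phi> (u n a b) \<otimes>\<^bsub>T\<^esub> \<phi> (u n b b))" by simp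
    qed (use img diag proj lt ualg in auto)
  qed
  have refine: "\<phi> (u n a b) \<in> Q.order_ideal L"
    if ab: "R n a b" "a \<noteq> b"
      and q: "\<And>q. q \<in> (\<lambda>s. (a * ratio n + s, b * ratio n + s)) ` {..<ratio n} \<Longrightarrow> \<phi> (u (Suc n) (fst q) (snd q)) \<in> Q.order_ideal L"
    for n a b L
  proof -
    let ?F = "(\<lambda>s. (a * ratio n + s, b * ratio n + s)) ` {..<ratio n}"
    have lt: "a < k n" "b < k n" using R_less[OF ab(1)] by auto
    have "\<phi> (u n a b) = (\<Oplus>\<^bsub>T\<^esub>q\<in>?F. \<phi> (u (Suc n) (fst q) (snd q)))"
      unfolding u_refine[OF lt]
      by (rule alg_hom_finsum[OF T \<phi>]) (use strict_refine(1)[OF ab] u_alg in auto)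
    also have "\<dots> \<in> Q.order_ideal L"
      by (rule Q.T.finsum_mem) (use q Q.order_ideal_zero Q.order_ideal_add Q.order_ideal_carrier in auto)
    finally show ?thesis .
  qed
  \<comment> \<open>The outer induction raises the order, starting from order one as given by
    \<open>base\<close>. The inner induction runs over the number of levels to the next refinement
    of multiplicity at least two; intermediate levels are crossed with
    \<open>refine\<close>.\<close>
  have all: "\<phi> (u n a b) \<in> Q.order_ideal (Suc L)" if "R n a b" "a \<noteq> b" for L n a b
    using that
  proof (induction L arbitrary: n a b)
    case 0
    then show ?case using base by simp
  next
    case (Suc L)
    obtain d where "2 \<le> ratio (n + d)" using ratio_ge_2[OF unbounded] by blast
    then show ?case
      using Suc.prems
    proof (induction d arbitrary: n a b)
      case 0
      have m: "2 \<le> ratio n" using 0 by simp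
      show ?case
      proof (rule refine[OF 0(2,3)])
        fix q assume q: "q \<in> (\<lambda>s. (a * ratio n + s, b * ratio n + s)) ` {..<ratio n}"
        obtain v where v: "R (Suc n) (fst q) v" "fst q \<noteq> v" "R (Suc n) v (snd q)" "v \<noteq> snd q"
          using strict_factor[OF 0(2,3) m q] by blast
        have "u (Suc n) (fst q) (snd q) = u (Suc n) (fst q) v \<otimes> u (Suc n) v (snd q)"
          using R_less[OF v(1)] by (simp add: u_mult)
        then have e: "\<phi> (u (Suc n) (fst q) (snd q)) = \<phi> (u (Suc n) (fst q) v) \<otimes>\<^bsub>T\<^esub> \<phi> (u (Suc n) v (snd q))"
          using \<phi>_simps(3)[OF u_alg[OF v(1)] u_alg[OF v(3)]] by simp
        show "\<phi> (u (Suc n) (fst q) (snd q)) \<in> Q.order_ideal (Suc (Suc L))"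
          \<comment> \<open>Orders add: one factor has order at least \<open>Suc L\<close> by the
            outer induction, the other order at least one by \<open>base\<close>.\<close>
          unfolding e using Q.order_ideal_mult[OF Suc.IH[OF v(1,2)] base[OF v(3,4)]] by simp
      qed
    next
      case (Suc d)
      show ?case
      proof (rule refine[OF Suc.prems(2,3)])
        fix q assume q: "q \<in> (\<lambda>s. (a * ratio n + s, b * ratio n + s)) ` {..<ratio n}"
        show "\<phi> (u (Suc n) (fst q) (snd q)) \<in> Q.order_ideal (Suc (Suc L))"
          by (rule Suc.IH) (use Suc.prems(1) strict_refine[OF Suc.prems(2,3) q] in simp_all)
      qed
    qed
  qed
  \<comment> \<open>The root is comparable with every vertex, so a vertex incomparable with another
    is not the root and gives a strict unit in the root column.\<close>
  have ne: "i \<noteq> rt 0" using inc R_rt[OF inc(2)] by auto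
  have Rr: "R 0 i (rt 0)" by (rule R_rt[OF inc(1)])
  have "\<phi> (u 0 i (rt 0)) \<in> Q.order_ideal L" for L
  proof (cases L)
    case 0
    then show ?thesis using img[OF u_alg[OF Rr]] Q.tensor_order_ideal by auto
  next
    case (Suc L')
    then show ?thesis using all[OF Rr ne] by simp
  qed
  then have "\<phi> (u 0 i (rt 0)) = \<zero>\<^bsub>T\<^esub>" by (rule Q.order_ideal_Inter)
  then have "nrm E (u 0 i (rt 0)) = 0" using iso[OF u_alg[OF Rr]] by simp
  then show False using u_nrm[OF inc(1) rt_less] by simp
qed

end

theorem proposition4p3:
  fixes G :: "nat pair_pre_digraph" and k :: "nat \<Rightarrow> nat"
    and E :: "'e cstar" and \<iota> :: "nat \<Rightarrow> complex mat \<Rightarrow> 'e"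
  assumes "out_tree G" and "pverts G = {..<k 0}"
    and "\<And>n. 0 < k n" and "\<And>n. k n dvd k (Suc n)"
    and "\<not> single_directed_path G"
    and "is_refinement_limit k E \<iota>"
  shows "semi_dirichlet E (tree_refinement_algebra G k E \<iota>) \<and>
    \<not> dirichlet E (tree_refinement_algebra G k E \<iota>) \<and>
    ((\<forall>N. \<exists>n. N < k n) \<longrightarrow>
      (\<forall>(D :: 'd cstar) (X :: ('d, 'x) corr) T S.
        is_tensor_algebra D X T S \<longrightarrow>
        \<not> isometrically_isomorphic E (tree_refinement_algebra G k E \<iota>) T S))"
proof -
  have "cstar_algebra E"
    using assms(6) by (simp add: is_refinement_limit_def cstar_inductive_limit_def)
  then interpret tree_refinement E G k \<iota>
    by (intro tree_refinement.intro tree_refinement_axioms.intro assms)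
  have wf: "pair_fin_digraph G" using assms(1) by (simp add: out_tree_def)
  have "rooted_tree G (k 0) (rt 0)" using rooted_tree_rt[of 0] by simp
  then have "\<exists>i j. i < k 0 \<and> j < k 0 \<and> \<not> (reach G i j \<or> reach G j i)"
    using rooted_tree.single_directed_path_if_total[OF _ wf] assms(5) by blast
  then obtain i j where inc: "i < k 0" "j < k 0" "\<not> R 0 i j" "\<not> R 0 j i"
    by (auto simp: R_def)
  \<comment> \<open>Unboundedness of k supplies refinements of multiplicity at least two beyond
    every level. For bounded k the refinements are eventually trivial, and the algebra is the quiver
    algebra of a finite tree, which is itself a tensor algebra.\<close>
  have "\<not> isometrically_isomorphic E alg T S"
    if "\<forall>N. \<exists>n. N < k n" "is_tensor_algebra D X T S" for D :: "'d cstar" and X :: "('d, 'x) corr" and T S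
    by (rule not_tensor_algebra[OF inc _ that(2)]) (use that(1) in blast)
  then show ?thesis using semi_dirichlet not_dirichlet[OF inc] unfolding alg_def by blast
qed

end
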